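(* Let $n\ge1$, $\hbar>0$, $T>0$, and let $g\in L^1_{loc}(0,\infty)$ be a kernel satisfying the conditions (g1)–(g4) listed in the context. Let $\mathcal{H}_{\hbar,V}$ be the discrete Schrödinger operator on $\hbar\mathbb{Z}^n$. Let $s\in\mathbb{R}$, $f\in C([0,T];\mathrm{H}^{2+s}_{\mathcal{H}_{\hbar,V}})$, $u_0\in\mathrm{H}^{2+s}_{\mathcal{H}_{\hbar,V}}$, and suppose $a\in C([0,T])$ satisfies $\inf_{t\in[0,T]}a(t)=a_0>0$. Let $u$ be the classical solution, i.e. the unique solution $u\in C([0,T];\mathrm{H}^{2+s}_{\mathcal{H}_{\hbar,V}})$ with $\mathbb{D}_{(g)}u\in C([0,T];\mathrm{H}^{s}_{\mathcal{H}_{\hbar,V}})$, of $$\mathbb{D}_{(g)}u(t,k)+a(t)\mathcal{H}_{\hbar,V}u(t,k)=f(t,k),\quad (t,k)\in(0,T]\times\hbar\mathbb{Z}^n,\qquad u(0,k)=u_0(k),\quad k\in\hbar\mathbb{Z}^n,$$ and let $(u_\varepsilon)_\varepsilon$ be the very weak solution of the same problem. Then for any regularizations $(a_\varepsilon)_\varepsilon$ of $a$ and $(f_\varepsilon)_\varepsilon$ of $f$, $$u_\varepsilon\to u\quad\text{in } C([0,T];\mathrm{H}^{2+s}_{\mathcal{H}_{\hbar,V}})\quad\text{as }\varepsilon\to0.$$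
   Context: General Caputo-type derivative: $\mathbb{D}_{(g)}u(t)=\frac{d}{dt}\int_0^t g(t-\tau)u(\tau)\,d\tau-g(t)u(0)$ (in the time variable), where $g\in L^1_{loc}(0,\infty)$ satisfies: (g1) the Laplace transform $\widetilde g(p)=\int_0^\infty e^{-p\tau}g(\tau)\,d\tau$ exists for all $p>0$; (g2) $\widetilde g$ is a Stieltjes function, i.e. $\widetilde g(p)=\frac{\alpha}{p}+\beta+\int_0^\infty\frac{1}{p+\tau}\mu(d\tau)$ with $\alpha,\beta\ge0$ and $\mu$ a positive Borel measure on $(0,\infty)$ with $\int_0^\infty\frac{1}{1+\tau}\mu(d\tau)<\infty$; (g3) $\widetilde g(p)\to0$ and $p\widetilde g(p)\to\infty$ as $p\to\infty$; (g4) $\widetilde g(p)\to\infty$ and $p\widetilde g(p)\to0$ as $p\to0$. Discrete Schrödinger operator: on $\hbar\mathbb{Z}^n=\{\hbar k:k\in\mathbb{Z}^n\}$, $\mathcal{H}_{\hbar,V}u(k)=(-\hbar^{-2}\mathcal{L}_\hbar+V)u(k)$, with $\mathcal{L}_\hbar u(k)=\sum_{j=1}^n(u(k+\hbar v_j)+u(k-\hbar v_j))-2n\,u(k)$, $v_j$ the $j$-th standard basis vector of $\mathbb{Z}^n$, and $V$ multiplication by a real function with $V(k)\ge V_0>0$ for all $k\in\hbar\mathbb{Z}^n$ and $|V(k)|\to\infty$ as $|k|\to\infty$. It is positive self-adjoint on $\ell^2(\hbar\mathbb{Z}^n)$ with purely discrete spectrum. Sobolev spaces: $\mathrm{H}^s_{\mathcal{H}_{\hbar,V}}=\{u\in\mathrm{H}^{-\infty}_{\mathcal{H}_{\hbar,V}}:(I+\mathcal{H}_{\hbar,V})^{s/2}u\in\ell^2(\hbar\mathbb{Z}^n)\}$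 with norm $\|(I+\mathcal{H}_{\hbar,V})^{s/2}u\|_{\ell^2}$, where $\mathrm{H}^{-\infty}_{\mathcal{H}_{\hbar,V}}$ is the dual of the Fréchet space $\bigcap_{k\ge1}\mathrm{Dom}(\mathcal{H}_{\hbar,V}^k)$. Regularization: $a_\varepsilon=a*\psi_{\omega(\varepsilon)}$, $\varepsilon\in(0,1]$, with $\psi_{\omega}(t)=\omega^{-1}\psi(t/\omega)$, $\omega(\varepsilon)>0$, $\omega(\varepsilon)\to0$ as $\varepsilon\to0$, $\psi$ a Friedrichs mollifier ($\psi\in C_0^\infty(\mathbb{R})$, $\psi\ge0$, $\int\psi=1$, taken with support in $[0,T]$); likewise for $f$ in the time variable. Moderateness: $(a_\varepsilon)_\varepsilon\in C(\mathbb{R})^{(0,1]}$ is $C$-moderate if for every compact $K\subset\mathbb{R}$ there are $N\in\mathbb{N}_0$, $c>0$ with $\|a_\varepsilon\|_{C(K)}\le c\,\varepsilon^{-N}$ for all $\varepsilon\in(0,1]$; $(u_\varepsilon)_\varepsilon\in C([0,T];X)^{(0,1]}$ is $C([0,T];X)$-moderate if there are $N\in\mathbb{N}_0$, $c>0$ with $\|u_\varepsilon\|_{C([0,T];X)}\le c\,\varepsilon^{-N}$ for all $\varepsilon\in(0,1]$. Very weak solution (of order $s$): with $X=\mathrm{H}^{2+s}_{\mathcal{H}_{\hbar,V}}$, a $C([0,T];X)$-moderate net $(u_\varepsilon)_\varepsilon\in C([0,T];X)^{(0,1]}$ which, for a $C$-moderate regularization $(a_\varepsilon)_\varepsilon$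 of $a$ and a $C([0,T];X)$-moderate regularization $(f_\varepsilon)_\varepsilon$ of $f$, solves for all $\varepsilon\in(0,1]$ the problem $\mathbb{D}_{(g)}u_\varepsilon+a_\varepsilon(t)\mathcal{H}_{\hbar,V}u_\varepsilon=f_\varepsilon$ on $(0,T]\times\hbar\mathbb{Z}^n$, $u_\varepsilon(0,\cdot)=u_0$. In the theorem, $(u_\varepsilon)_\varepsilon$ is the very weak solution associated with the regularizations $(a_\varepsilon)_\varepsilon$, $(f_\varepsilon)_\varepsilon$. *)

theory Defs
  imports "HOL-Analysis.Analysis"
begin

section \<open>The discrete Schroedinger operator\<close>

text \<open>A function on the lattice is encoded as a function on the ambient Euclidean space; all
  function spaces below contain only functions that vanish off the lattice.\<close>

type_synonym 'n lfun = "real ^ 'n \<Rightarrow> complex"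

text \<open>Linear functionals on test functions; \<open>H_minf\<close> below contains only functionals
  that are \<open>0\<close> outside the test space, so that equality of functionals is equality of functions.\<close>

type_synonym 'n functional = "'n lfun \<Rightarrow> complex"

definition lattice :: "real \<Rightarrow> (real ^ 'n) set" where
  "lattice h = range (\<lambda>m :: int ^ 'n. \<chi> i. h * of_int (m $ i))"

definition ell2 :: "real \<Rightarrow> ('n::finite) lfun set" where
  "ell2 h = {u. (\<forall>x. x \<notin> lattice h \<longrightarrow> u x = 0)
                 \<and> (\<lambda>x. (cmod (u x))\<^sup>2) summable_on lattice h}"

definition ell2_inner :: "real \<Rightarrow> ('n::finite) lfun \<Rightarrow> 'n lfun \<Rightarrow> complex" where
  "ell2_inner h u v = (\<Sum>\<^sub>\<infinity>x\<in>lattice h. u x * cnj (v x))"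

definition ell2_norm :: "real \<Rightarrow> ('n::finite) lfun \<Rightarrow> real" where
  "ell2_norm h u = sqrt (\<Sum>\<^sub>\<infinity>x\<in>lattice h. (cmod (u x))\<^sup>2)"

definition discrete_laplacian :: "real \<Rightarrow> ('n::finite) lfun \<Rightarrow> 'n lfun" where
  "discrete_laplacian h u x =
     (\<Sum>j\<in>UNIV. u (x + h *\<^sub>R axis j 1) + u (x - h *\<^sub>R axis j 1)) - 2 * of_nat CARD('n) * u x"

definition schroedinger :: "real \<Rightarrow> (real ^ 'n \<Rightarrow> real) \<Rightarrow> 'n lfun \<Rightarrow> 'n lfun" where
  "schroedinger h V u x =
     (if x \<in> lattice h
      then - complex_of_real (1 / h\<^sup>2) * discrete_laplacian h u x + complex_of_real (V x) * u x
      else 0)"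

text \<open>Domains of the powers of the self-adjoint operator. The operator has the maximal domain
  \<open>{u \<in> ell2 h. schroedinger h V u \<in> ell2 h}\<close>, so \<open>u\<close> lies in the domain of the \<open>m\<close>-th power
  iff the formal expressions \<open>(schroedinger h V ^^ j) u\<close> are square summable for all \<open>j \<le> m\<close>.\<close>

definition dom_pow :: "real \<Rightarrow> (real ^ 'n \<Rightarrow> real) \<Rightarrow> nat \<Rightarrow> 'n lfun set" where
  "dom_pow h V m = {u. \<forall>j\<le>m. (schroedinger h V ^^ j) u \<in> ell2 h}"

definition H_inf :: "real \<Rightarrow> (real ^ 'n \<Rightarrow> real) \<Rightarrow> 'n lfun set" where
  "H_inf h V = (\<Inter>m\<in>{1..}. dom_pow h V m)"

section \<open>Functional calculus and Sobolev spaces\<close>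

definition eigenspace :: "real \<Rightarrow> (real ^ 'n \<Rightarrow> real) \<Rightarrow> real \<Rightarrow> 'n lfun set" where
  "eigenspace h V l =
     {e \<in> dom_pow h V 1. \<forall>x. schroedinger h V e x = complex_of_real l * e x}"

definition eigenvalues :: "real \<Rightarrow> (real ^ 'n \<Rightarrow> real) \<Rightarrow> real set" where
  "eigenvalues h V = {l. \<exists>e\<in>eigenspace h V l. e \<noteq> (\<lambda>x. 0)}"

text \<open>Orthogonal projection of \<open>u\<close> onto the eigenspace.\<close>

definition spectral_proj :: "real \<Rightarrow> (real ^ 'n \<Rightarrow> real) \<Rightarrow> real \<Rightarrow> 'n lfun \<Rightarrow> 'n lfun" where
  "spectral_proj h V l u =
     (THE v. v \<in> eigenspace h V l
             \<and> (\<forall>e\<in>eigenspace h V l. ell2_inner h (\<lambda>x. u x - v x) e = 0))"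

text \<open>The power \<open>(I + H)^r\<close> on test functions, by the spectral theorem for the self-adjoint
  operator \<open>H\<close>, whose spectrum is purely discrete.\<close>

definition one_plus_H_powr ::
    "real \<Rightarrow> (real ^ 'n \<Rightarrow> real) \<Rightarrow> real \<Rightarrow> 'n lfun \<Rightarrow> 'n lfun" where
  "one_plus_H_powr h V r u x =
     (\<Sum>\<^sub>\<infinity>l\<in>eigenvalues h V. complex_of_real ((1 + l) powr r) * spectral_proj h V l u x)"

text \<open>The dual of the Frechet space \<open>H_inf\<close>, whose topology is given by the seminorms
  \<open>\<phi> \<mapsto> ell2_norm h ((schroedinger h V ^^ j) \<phi>)\<close>.\<close>

definition H_minf :: "real \<Rightarrow> (real ^ 'n \<Rightarrow> real) \<Rightarrow> 'n functional set" where
  "H_minf h V =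
     {u. (\<forall>\<phi>. \<phi> \<notin> H_inf h V \<longrightarrow> u \<phi> = 0)
       \<and> (\<forall>\<phi>\<in>H_inf h V. \<forall>\<psi>\<in>H_inf h V. u (\<lambda>x. \<phi> x + \<psi> x) = u \<phi> + u \<psi>)
       \<and> (\<forall>\<phi>\<in>H_inf h V. \<forall>c. u (\<lambda>x. c * \<phi> x) = c * u \<phi>)
       \<and> (\<exists>C m. \<forall>\<phi>\<in>H_inf h V.
             cmod (u \<phi>) \<le> C * (\<Sum>j\<le>m. ell2_norm h ((schroedinger h V ^^ j) \<phi>)))}"

text \<open>The embedding of square summable functions into the dual uses the bilinear pairing, for
  which \<open>H\<close> and the powers of \<open>I + H\<close> (being real operators) are their own transposes.\<close>

definition embed :: "real \<Rightarrow> (real ^ 'n \<Rightarrow> real) \<Rightarrow> 'n lfun \<Rightarrow> 'n functional" where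
  "embed h V v \<phi> = (if \<phi> \<in> H_inf h V then (\<Sum>\<^sub>\<infinity>x\<in>lattice h. v x * \<phi> x) else 0)"

definition schroedinger_dual ::
    "real \<Rightarrow> (real ^ 'n \<Rightarrow> real) \<Rightarrow> 'n functional \<Rightarrow> 'n functional" where
  "schroedinger_dual h V u \<phi> = (if \<phi> \<in> H_inf h V then u (schroedinger h V \<phi>) else 0)"

definition one_plus_H_powr_dual ::
    "real \<Rightarrow> (real ^ 'n \<Rightarrow> real) \<Rightarrow> real \<Rightarrow> 'n functional \<Rightarrow> 'n functional" where
  "one_plus_H_powr_dual h V r u \<phi> =
     (if \<phi> \<in> H_inf h V then u (one_plus_H_powr h V r \<phi>) else 0)"

definition Sobolev :: "real \<Rightarrow> (real ^ 'n \<Rightarrow> real) \<Rightarrow> real \<Rightarrow> 'n functional set" where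
  "Sobolev h V s =
     {u \<in> H_minf h V. \<exists>v\<in>ell2 h. one_plus_H_powr_dual h V (s / 2) u = embed h V v}"

definition Sobolev_norm :: "real \<Rightarrow> (real ^ 'n \<Rightarrow> real) \<Rightarrow> real \<Rightarrow> 'n functional \<Rightarrow> real" where
  "Sobolev_norm h V s u =
     ell2_norm h (THE v. v \<in> ell2 h \<and> one_plus_H_powr_dual h V (s / 2) u = embed h V v)"

text \<open>\<open>C(I; H^s)\<close> for a set \<open>I\<close> of times, and the norm of \<open>C([0,T]; H^s)\<close>.\<close>

definition C_Sobolev ::
    "real \<Rightarrow> (real ^ 'n \<Rightarrow> real) \<Rightarrow> real \<Rightarrow> real set \<Rightarrow> (real \<Rightarrow> 'n functional) set" where
  "C_Sobolev h V s I =
     {u. \<forall>t\<in>I. u t \<in> Sobolev h V s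
           \<and> ((\<lambda>r. Sobolev_norm h V s (\<lambda>\<phi>. u r \<phi> - u t \<phi>)) \<longlongrightarrow> 0) (at t within I)}"

definition C_Sobolev_norm ::
    "real \<Rightarrow> (real ^ 'n \<Rightarrow> real) \<Rightarrow> real \<Rightarrow> real \<Rightarrow> (real \<Rightarrow> 'n functional) \<Rightarrow> real" where
  "C_Sobolev_norm h V s T u = (SUP t\<in>{0..T}. Sobolev_norm h V s (u t))"

section \<open>The kernel and the Caputo-type derivative\<close>

definition laplace :: "(real \<Rightarrow> real) \<Rightarrow> real \<Rightarrow> real" where
  "laplace g p = (LINT t:{0<..}|lborel. exp (- p * t) * g t)"

definition stieltjes_function :: "(real \<Rightarrow> real) \<Rightarrow> bool" where
  "stieltjes_function F \<longleftrightarrow>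
     (\<exists>\<alpha>\<ge>0. \<exists>\<beta>\<ge>0. \<exists>\<mu> :: real measure.
        sets \<mu> = sets (restrict_space borel {0<..})
        \<and> integrable \<mu> (\<lambda>t. 1 / (1 + t))
        \<and> (\<forall>p>0. F p = \<alpha> / p + \<beta> + (LINT t|\<mu>. 1 / (p + t))))"

definition admissible_kernel :: "(real \<Rightarrow> real) \<Rightarrow> bool" where
  "admissible_kernel g \<longleftrightarrow>
     (\<forall>K. compact K \<and> K \<subseteq> {0<..} \<longrightarrow> set_integrable lborel K g)
     \<and> (\<forall>p>0. set_integrable lborel {0<..} (\<lambda>t. exp (- p * t) * g t))
     \<and> stieltjes_function (laplace g)
     \<and> (laplace g \<longlongrightarrow> 0) at_top \<and> filterlim (\<lambda>p. p * laplace g p) at_top at_top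
     \<and> filterlim (laplace g) at_top (at_right 0) \<and> ((\<lambda>p. p * laplace g p) \<longlongrightarrow> 0) (at_right 0)"

text \<open>\<open>has_caputo T g v d t\<close>: the derivative at \<open>t\<close> (one-sided at \<open>t = T\<close>) of the convolution of
  \<open>g\<close> and \<open>v\<close> exists, and \<open>d\<close> is that derivative minus \<open>g t * v 0\<close>.\<close>

definition has_caputo ::
    "real \<Rightarrow> (real \<Rightarrow> real) \<Rightarrow> (real \<Rightarrow> complex) \<Rightarrow> complex \<Rightarrow> real \<Rightarrow> bool" where
  "has_caputo T g v d t \<longleftrightarrow>
     (\<exists>w. ((\<lambda>r. LINT \<tau>:{0..r}|lborel. g (r - \<tau>) *\<^sub>R v \<tau>) has_vector_derivative w)
             (at t within {0..T})
          \<and> d = w - g t *\<^sub>R v 0)"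

text \<open>Functional-valued integrals and derivatives are taken after pairing with test functions.\<close>

definition has_caputo_functional ::
    "real \<Rightarrow> (real ^ 'n \<Rightarrow> real) \<Rightarrow> real \<Rightarrow> (real \<Rightarrow> real) \<Rightarrow> (real \<Rightarrow> 'n functional)
      \<Rightarrow> 'n functional \<Rightarrow> real \<Rightarrow> bool" where
  "has_caputo_functional h V T g u d t \<longleftrightarrow>
     d \<in> H_minf h V \<and> (\<forall>\<phi>\<in>H_inf h V. has_caputo T g (\<lambda>\<tau>. u \<tau> \<phi>) (d \<phi>) t)"

section \<open>Classical and very weak solutions\<close>

definition solves_problem ::
    "real \<Rightarrow> (real ^ 'n \<Rightarrow> real) \<Rightarrow> real \<Rightarrow> (real \<Rightarrow> real) \<Rightarrow> (real \<Rightarrow> real)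
      \<Rightarrow> (real \<Rightarrow> 'n functional) \<Rightarrow> 'n functional \<Rightarrow> (real \<Rightarrow> 'n functional) \<Rightarrow> bool" where
  "solves_problem h V T g a f u0 u \<longleftrightarrow>
     u 0 = u0
     \<and> (\<forall>t\<in>{0<..T}. \<exists>d. has_caputo_functional h V T g u d t
           \<and> (\<lambda>\<phi>. d \<phi> + complex_of_real (a t) * schroedinger_dual h V (u t) \<phi>) = f t)"

text \<open>The Caputo-type derivative lives on \<open>(0,T]\<close> (as \<open>g\<close> does); that it belongs to
  \<open>C([0,T]; H^s)\<close> means that it extends continuously to \<open>[0,T]\<close>.\<close>

definition classical_solution ::
    "real \<Rightarrow> (real ^ 'n \<Rightarrow> real) \<Rightarrow> real \<Rightarrow> (real \<Rightarrow> real) \<Rightarrow> real \<Rightarrow> (real \<Rightarrow> real)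
      \<Rightarrow> (real \<Rightarrow> 'n functional) \<Rightarrow> 'n functional \<Rightarrow> (real \<Rightarrow> 'n functional) \<Rightarrow> bool" where
  "classical_solution h V T g s a f u0 u \<longleftrightarrow>
     u \<in> C_Sobolev h V (2 + s) {0..T}
     \<and> (\<exists>D\<in>C_Sobolev h V s {0..T}. \<forall>t\<in>{0<..T}. has_caputo_functional h V T g u (D t) t)
     \<and> solves_problem h V T g a f u0 u"

definition friedrichs_mollifier :: "real \<Rightarrow> (real \<Rightarrow> real) \<Rightarrow> bool" where
  "friedrichs_mollifier T \<psi> \<longleftrightarrow>
     (\<forall>m x. (deriv ^^ m) \<psi> field_differentiable at x)
     \<and> (\<forall>x. \<psi> x \<ge> 0) \<and> closure {x. \<psi> x \<noteq> 0} \<subseteq> {0..T} \<and> (LINT x|lborel. \<psi> x) = 1"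

definition regularizing_scale :: "(real \<Rightarrow> real) \<Rightarrow> bool" where
  "regularizing_scale \<omega> \<longleftrightarrow> (\<forall>\<epsilon>\<in>{0<..1}. \<omega> \<epsilon> > 0) \<and> (\<omega> \<longlongrightarrow> 0) (at_right 0)"

definition scaled_mollifier :: "(real \<Rightarrow> real) \<Rightarrow> real \<Rightarrow> real \<Rightarrow> real" where
  "scaled_mollifier \<psi> w t = \<psi> (t / w) / w"

text \<open>Convolution over the whole line requires the data on \<open>[0,T]\<close> to be extended; any
  continuous extension is allowed.\<close>

definition coeff_regularization ::
    "real \<Rightarrow> (real \<Rightarrow> real) \<Rightarrow> (real \<Rightarrow> real \<Rightarrow> real) \<Rightarrow> bool" where
  "coeff_regularization T a a_net \<longleftrightarrow>
     (\<exists>\<psi> \<omega> b. friedrichs_mollifier T \<psi> \<and> regularizing_scale \<omega>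
        \<and> continuous_on UNIV b \<and> (\<forall>t\<in>{0..T}. b t = a t)
        \<and> (\<forall>\<epsilon>\<in>{0<..1}. \<forall>t.
              a_net \<epsilon> t = (LINT \<tau>|lborel. b (t - \<tau>) * scaled_mollifier \<psi> (\<omega> \<epsilon>) \<tau>)))"

definition source_regularization ::
    "real \<Rightarrow> (real ^ 'n \<Rightarrow> real) \<Rightarrow> real \<Rightarrow> real \<Rightarrow> (real \<Rightarrow> 'n functional)
      \<Rightarrow> (real \<Rightarrow> real \<Rightarrow> 'n functional) \<Rightarrow> bool" where
  "source_regularization h V s T f f_net \<longleftrightarrow>
     (\<exists>\<psi> \<omega> F. friedrichs_mollifier T \<psi> \<and> regularizing_scale \<omega>
        \<and> F \<in> C_Sobolev h V s UNIV \<and> (\<forall>t\<in>{0..T}. F t = f t)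
        \<and> (\<forall>\<epsilon>\<in>{0<..1}. \<forall>t\<in>{0..T}.
              f_net \<epsilon> t = (\<lambda>\<phi>. LINT \<tau>|lborel. scaled_mollifier \<psi> (\<omega> \<epsilon>) \<tau> *\<^sub>R F (t - \<tau>) \<phi>)))"

definition C_moderate :: "(real \<Rightarrow> real \<Rightarrow> real) \<Rightarrow> bool" where
  "C_moderate a_net \<longleftrightarrow>
     (\<forall>\<epsilon>\<in>{0<..1}. continuous_on UNIV (a_net \<epsilon>))
     \<and> (\<forall>K. compact K \<longrightarrow> (\<exists>N :: nat. \<exists>c>0. \<forall>\<epsilon>\<in>{0<..1}. \<forall>t\<in>K. \<bar>a_net \<epsilon> t\<bar> \<le> c / \<epsilon> ^ N))"

definition C_Sobolev_moderate ::
    "real \<Rightarrow> (real ^ 'n \<Rightarrow> real) \<Rightarrow> real \<Rightarrow> real \<Rightarrow> (real \<Rightarrow> real \<Rightarrow> 'n functional) \<Rightarrow> bool" where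
  "C_Sobolev_moderate h V s T u_net \<longleftrightarrow>
     (\<forall>\<epsilon>\<in>{0<..1}. u_net \<epsilon> \<in> C_Sobolev h V s {0..T})
     \<and> (\<exists>N :: nat. \<exists>c>0. \<forall>\<epsilon>\<in>{0<..1}. C_Sobolev_norm h V s T (u_net \<epsilon>) \<le> c / \<epsilon> ^ N)"

text \<open>\<open>u_net\<close> is a very weak solution of order \<open>s\<close>, associated with the moderate
  regularizations \<open>a_net\<close> of \<open>a\<close> and \<open>f_net\<close> of \<open>f\<close>.\<close>

definition very_weak_solution ::
    "real \<Rightarrow> (real ^ 'n \<Rightarrow> real) \<Rightarrow> real \<Rightarrow> (real \<Rightarrow> real) \<Rightarrow> real \<Rightarrow> (real \<Rightarrow> real)
      \<Rightarrow> (real \<Rightarrow> 'n functional) \<Rightarrow> 'n functional \<Rightarrow> (real \<Rightarrow> real \<Rightarrow> real)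
      \<Rightarrow> (real \<Rightarrow> real \<Rightarrow> 'n functional) \<Rightarrow> (real \<Rightarrow> real \<Rightarrow> 'n functional) \<Rightarrow> bool" where
  "very_weak_solution h V T g s a f u0 a_net f_net u_net \<longleftrightarrow>
     coeff_regularization T a a_net \<and> C_moderate a_net
     \<and> source_regularization h V (2 + s) T f f_net \<and> C_Sobolev_moderate h V (2 + s) T f_net
     \<and> C_Sobolev_moderate h V (2 + s) T u_net
     \<and> (\<forall>\<epsilon>\<in>{0<..1}. solves_problem h V T g (a_net \<epsilon>) (f_net \<epsilon>) u0 (u_net \<epsilon>))"

end

theory Submission
  imports Defs
begin

text \<open>
  The Stieltjes representation makes \<open>g\<close> almost everywhere equal to a nonnegative decreasing kernel,
  for which the equation obeys a maximum principle: if \<open>D u + b H u = F\<close> and \<open>b H \<ge> \<kappa> > 0\<close>, then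
  \<open>\<parallel>u(t)\<parallel> \<le> max \<parallel>u(0)\<parallel> (sup \<parallel>F\<parallel> / \<kappa>)\<close> in every Hilbert norm that is diagonal in the eigenfunctions of \<open>H\<close>
  (test the equation with the value of \<open>u\<close> at a maximum of its norm).

  The difference \<open>w = u\<^sub>\<epsilon> - u\<close> solves the equation with coefficient \<open>a\<^sub>\<epsilon>\<close> and source
  \<open>(f\<^sub>\<epsilon> - f) + (a - a\<^sub>\<epsilon>) H u\<close>, whose last term is small only in \<open>H\<^sup>s\<close>, two orders too low. Hence the maximum
  principle is applied to \<open>w\<close> on finitely many modes only; on the remaining ones \<open>u\<^sub>\<epsilon>\<close> and \<open>u\<close> are
  small separately, uniformly in \<open>t\<close> and \<open>\<epsilon>\<close>, by compactness of the curves \<open>u\<close> and \<open>f\<close> and the maximum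
  principle for \<open>u\<^sub>\<epsilon>\<close>.
\<close>

text \<open>Solutions are only continuous in time, their Caputo derivative exists only after pairing
  with test functions, and k may be singular at 0, so neither u nor its norm can be differentiated
  at a maximum. This dictates three choices. The equation is integrated in time. Solutions are
  averaged over a time step before a maximum is taken, which makes them Lipschitz; the strict sign
  needed there comes from assuming that the bound fails by a positive amount. Pairing the vector
  with its own value at the maximum leaves one scalar function, since |y(t)| \<le> |y(t0)| gives
  y(t0) . y(t) \<le> |y(t0)|^2.

  All estimates are made for finite sets of eigenfunctions, uniformly in the set; Parseval turns
  them into Sobolev norms at the end. The constant \<kappa> is a0 / 2 times the lower bound V0 of
  the eigenvalues, where a0 / 2 leaves room for the regularized coefficient. The maximum principle
  contains no growth factor, so its bounds are uniform in \<epsilon>.\<close>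

section \<open>The kernel\<close>

text \<open>Under \<open>x = exp (- t)\<close> the Laplace transform at the integers becomes a moment sequence.\<close>

lemma exp_moments_zero_imp_integral_zero:
  fixes m :: "real \<Rightarrow> real"
  assumes m: "integrable lborel m" and m0: "\<And>t. t \<le> 0 \<Longrightarrow> m t = 0"
    and mom: "\<And>n::nat. (LINT t|lborel. m t * exp (- t) ^ n) = 0"
    and \<phi>: "continuous_on {0..1} \<phi>"
  shows "(LINT t|lborel. m t * \<phi> (if 0 < t then exp (- t) else 0)) = 0"
proof -
  \<comment> \<open>The value 0 on t \<le> 0, where \<open>m\<close> vanishes anyway, keeps
    \<open>X\<close> inside [0,1], the interval of Stone-Weierstrass.\<close>
  define X where "X = (\<lambda>t::real. if 0 < t then exp (- t) else 0)"
  have X01: "X t \<in> {0..1}" for t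
    by (auto simp: X_def)
  have [measurable]: "X \<in> borel_measurable borel"
    unfolding X_def by measurable
  have [measurable]: "m \<in> borel_measurable borel"
    using m by (simp add: borel_measurable_integrable)
  have bnd: "integrable lborel (\<lambda>t. m t * f (X t))"
    if "f \<in> borel_measurable borel" "\<And>x. x \<in> {0..1} \<Longrightarrow> \<bar>f x\<bar> \<le> C" for f and C :: real
  proof (rule Bochner_Integration.integrable_bound[where f = "\<lambda>t. C * m t"])
    show "(\<lambda>t. m t * f (X t)) \<in> borel_measurable lborel"
      using that(1) by measurable
    have "C \<ge> 0" using that(2)[of 0] by auto
    then show "AE x in lborel. norm (m x * f (X x)) \<le> norm (C * m x)"
      using mult_right_mono[OF that(2)[OF X01] abs_ge_zero] by (intro AE_I2) (simp add: abs_mult mult.commute)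
  qed (use m in auto)
  have pow: "integrable lborel (\<lambda>t. m t * X t ^ n) \<and> (LINT t|lborel. m t * X t ^ n) = 0" for n
  proof -
    have "(LINT t|lborel. m t * X t ^ n) = (LINT t|lborel. m t * exp (- t) ^ n)"
      by (intro Bochner_Integration.integral_cong) (auto simp: X_def m0)
    moreover have "integrable lborel (\<lambda>t. m t * (\<lambda>x. x ^ n) (X t))"
      by (rule bnd[where C = 1]) (auto simp: power_le_one)
    ultimately show ?thesis using mom by simp
  qed
  have poly: "(LINT t|lborel. m t * p (X t)) = 0" if p: "real_polynomial_function p" for p :: "real \<Rightarrow> real"
  proof -
    obtain a n where an: "p = (\<lambda>x. \<Sum>i\<le>n. a i * x ^ i)"
      using p unfolding real_polynomial_function_iff_sum by blast
    have "(LINT t|lborel. m t * p (X t)) = (LINT t|lborel. (\<Sum>i\<le>n. a i * (m t * X t ^ i)))"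
      by (simp add: an sum_distrib_left mult_ac)
    also have "\<dots> = (\<Sum>i\<le>n. (LINT t|lborel. a i * (m t * X t ^ i)))"
      by (rule Bochner_Integration.integral_sum) (use pow in auto)
    also have "\<dots> = 0" using pow by simp
    finally show ?thesis .
  qed
  \<comment> \<open>\<open>\<phi>\<close> is continuous on [0,1] only; its cut-off is Borel on the
    whole line and agrees with it along \<open>X\<close>.\<close>
  define \<phi>' where "\<phi>' = (\<lambda>x. indicator {0..1} x *\<^sub>R \<phi> x)"
  have \<phi>'m[measurable]: "\<phi>' \<in> borel_measurable borel"
    using borel_measurable_continuous_on_indicator[OF _ \<phi>] by (simp add: \<phi>'_def)
  have eq: "\<phi>' (X t) = \<phi> (X t)" for t
    using X01[of t] by (simp add: \<phi>'_def)
  have "bounded (\<phi> ` {0..1})"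
    by (intro compact_imp_bounded compact_continuous_image \<phi>) simp
  then obtain C where C: "\<And>x. x \<in> {0..1} \<Longrightarrow> \<bar>\<phi> x\<bar> \<le> C"
    unfolding bounded_iff by force
  have int: "integrable lborel (\<lambda>t. m t * \<phi> (X t))"
    using bnd[of \<phi>' C] C by (simp add: eq) (simp add: \<phi>'_def indicator_def)
  have "\<bar>LINT t|lborel. m t * \<phi> (X t)\<bar> \<le> e * (LINT t|lborel. \<bar>m t\<bar>)" if e: "e > 0" for e
  proof -
    obtain p where p: "real_polynomial_function p" "\<And>x. x \<in> {0..1} \<Longrightarrow> \<bar>\<phi> x - p x\<bar> < e"
      using Stone_Weierstrass_real_polynomial_function[OF _ \<phi> e] by auto
    have pc: "continuous_on S p" for S
      using continuous_real_polymonial_function[OF p(1)] by (simp add: continuous_at_imp_continuous_on)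
    have pm[measurable]: "p \<in> borel_measurable borel"
      using pc[of UNIV] by (rule borel_measurable_continuous_onI)
    have pint: "integrable lborel (\<lambda>t. m t * p (X t))"
    proof (rule bnd[where C = "C + e"])
      fix x :: real assume "x \<in> {0..1}"
      then show "\<bar>p x\<bar> \<le> C + e" using p(2)[of x] C[of x] by auto
    qed simp
    have "(LINT t|lborel. m t * \<phi> (X t)) = (LINT t|lborel. m t * \<phi> (X t) - m t * p (X t))"
      using int pint poly[OF p(1)] by simp
    also have "\<bar>\<dots>\<bar> \<le> (LINT t|lborel. e * \<bar>m t\<bar>)"
    proof (rule integral_abs_bound_integral)
      fix t
      have "\<bar>m t * \<phi> (X t) - m t * p (X t)\<bar> = \<bar>m t\<bar> * \<bar>\<phi> (X t) - p (X t)\<bar>"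
        by (simp add: abs_mult[symmetric] right_diff_distrib)
      also have "\<dots> \<le> \<bar>m t\<bar> * e"
        using p(2)[OF X01] by (intro mult_left_mono) (auto intro: less_imp_le)
      finally show "\<bar>m t * \<phi> (X t) - m t * p (X t)\<bar> \<le> e * \<bar>m t\<bar>" by (simp add: mult.commute)
    qed (use int pint m in auto)
    finally show ?thesis by simp
  qed
  then have "\<bar>LINT t|lborel. m t * \<phi> (X t)\<bar> \<le> 0 * (LINT t|lborel. \<bar>m t\<bar>)"
    by (intro tendsto_le[OF _ _ tendsto_const[of _ "at_right 0"],
          where f = "\<lambda>e. e * (LINT t|lborel. \<bar>m t\<bar>)"])
       (auto intro!: tendsto_eq_intros simp: eventually_at_filter)
  then show ?thesis by (simp add: X_def)
qed

text \<open>The positive and the negative part of \<open>m\<close> are densities of two finite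
  measures that agree on all half-lines (x,\<infinity>). Half-lines determine a finite measure and a
  measure determines its density almost everywhere, so the two parts coincide; as one of them is
  always 0, both vanish.\<close>

lemma integrable_AE_zero_if_tails_zero:
  fixes m :: "real \<Rightarrow> real"
  assumes m: "integrable lborel m" and tail: "\<And>x. (LINT t:{x<..}|lborel. m t) = 0"
  shows "AE t in lborel. m t = 0"
proof -
  have [measurable]: "m \<in> borel_measurable borel"
    using m by (simp add: borel_measurable_integrable)
  let ?p = "\<lambda>t. max 0 (m t)" and ?n = "\<lambda>t. max 0 (- m t)"
  have ip: "integrable lborel ?p" and "integrable lborel ?n"
    using m by (auto intro: integrable_max)
  have si: "set_integrable lborel {x<..} ?p" "set_integrable lborel {x<..} ?n" for x
    unfolding set_integrable_def using ip \<open>integrable lborel ?n\<close>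
    by (auto intro!: integrable_mult_indicator simp del: real_scaleR_def)
  have em: "emeasure (density lborel (\<lambda>t. ennreal (f t))) {x<..} = ennreal (LINT t:{x<..}|lborel. f t)"
    if "set_integrable lborel {x<..} f" "\<And>t. f t \<ge> 0" "f \<in> borel_measurable borel" for f and x :: real
  proof -
    have "emeasure (density lborel (\<lambda>t. ennreal (f t))) {x<..} = (\<integral>\<^sup>+t. ennreal (indicator {x<..} t *\<^sub>R f t) \<partial>lborel)"
      using that(3) by (subst emeasure_density) (auto intro!: nn_integral_cong simp: indicator_def)
    also have "\<dots> = ennreal (LINT t:{x<..}|lborel. f t)"
      unfolding set_lebesgue_integral_def
      using that by (intro nn_integral_eq_integral) (auto simp: set_integrable_def)
    finally show ?thesis .
  qed
  have "density lborel (\<lambda>t. ennreal (?p t)) = density lborel (\<lambda>t. ennreal (?n t))"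
  proof (rule measure_eqI_lessThan)
    fix x :: real
    have "(LINT t:{x<..}|lborel. m t) = (LINT t:{x<..}|lborel. ?p t - ?n t)"
      by (intro arg_cong[where f = "set_lebesgue_integral lborel {x<..}"]) auto
    also have "\<dots> = (LINT t:{x<..}|lborel. ?p t) - (LINT t:{x<..}|lborel. ?n t)"
      by (intro set_integral_diff si)
    finally have "(LINT t:{x<..}|lborel. ?p t) = (LINT t:{x<..}|lborel. ?n t)"
      using tail[of x] by simp
    then show "emeasure (density lborel (\<lambda>t. ennreal (?p t))) {x<..} = emeasure (density lborel (\<lambda>t. ennreal (?n t))) {x<..}"
      by (subst (1 2) em) (auto simp: si)
    show "emeasure (density lborel (\<lambda>t. ennreal (?p t))) {x<..} < \<infinity>"
      by (subst em) (auto simp: si)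
  qed auto
  then have "AE t in lborel. ennreal (?p t) = ennreal (?n t)"
    by (rule sigma_finite_measure.density_unique[OF sigma_finite_lborel, rotated 2]) auto
  then show ?thesis
    by eventually_elim (auto simp: max_def split: if_splits)
qed

text \<open>Injectivity of the Laplace transform from its values at the positive integers. The
  weight exp(-t) makes q integrable, and the n-th moment of the weighted function in the variable
  exp(-t) is the transform at n + 1.\<close>

lemma laplace_zero_imp_AE_zero:
  fixes q :: "real \<Rightarrow> real"
  assumes int: "set_integrable lborel {0<..} (\<lambda>t. exp (- t) * q t)"
    and zero: "\<And>n::nat. laplace q (real (Suc n)) = 0"
  shows "AE t in lborel. 0 < t \<longrightarrow> q t = 0"
proof -
  define m where "m = (\<lambda>t. indicator {0<..} t * (exp (- t) * q t))"
  have m: "integrable lborel m"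
    using int by (simp add: set_integrable_def m_def)
  have [measurable]: "m \<in> borel_measurable borel"
    using m by (simp add: borel_measurable_integrable)
  have m0: "m t = 0" if "t \<le> 0" for t
    using that by (simp add: m_def)
  have mom: "(LINT t|lborel. m t * exp (- t) ^ n) = 0" for n :: nat
  proof -
    have "exp (- t - real n * t) = exp (- t) * exp (- t) ^ n" for t :: real
      by (simp add: exp_of_nat_mult[symmetric] exp_add[symmetric] algebra_simps)
    then have "(LINT t|lborel. m t * exp (- t) ^ n) = laplace q (real (Suc n))"
      unfolding laplace_def set_lebesgue_integral_def m_def
      by (intro Bochner_Integration.integral_cong) (auto simp: algebra_simps)
    then show ?thesis by (simp only: zero)
  qed
  have "(LINT t:{x<..}|lborel. m t) = 0" for x
  proof (cases "x < 0")
    case True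
    have "(LINT t:{x<..}|lborel. m t) = (LINT t|lborel. m t * exp (- t) ^ 0)"
      unfolding set_lebesgue_integral_def using True m0
      by (intro Bochner_Integration.integral_cong) (auto simp: indicator_def)
    then show ?thesis using mom[of 0] by simp
  next
    case False
    define y where "y = exp (- x)"
    \<comment> \<open>Continuous ramps tending to the indicator of z < y. With y = exp(-x) this is
      the indicator of t > x along t > 0, so the limit of the vanishing integrals is a tail integral
      of \<open>m\<close>.\<close>
    define \<phi> where "\<phi> = (\<lambda>(n::nat) z. max 0 (min 1 (real n * (y - z))))"
    let ?X = "\<lambda>t::real. if 0 < t then exp (- t) else 0"
    have y: "0 < y" by (simp add: y_def)
    have lim: "(\<lambda>n. \<phi> n z) \<longlonglongrightarrow> (if z < y then 1 else 0)" for z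
    proof (cases "z < y")
      case True
      obtain N :: nat where N: "1 / (y - z) < real N" using reals_Archimedean2 by blast
      have "\<phi> n z = 1" if "n \<ge> N" for n
      proof -
        have "1 / (y - z) \<le> real n" using N that by linarith
        then have "1 \<le> real n * (y - z)" using True by (simp add: field_simps)
        then show ?thesis by (simp add: \<phi>_def)
      qed
      then have "\<forall>\<^sub>F n in sequentially. \<phi> n z = 1"
        unfolding eventually_sequentially by blast
      then show ?thesis using True by (simp add: tendsto_eventually)
    next
      case False
      then have le: "real n * (y - z) \<le> 0" for n by (intro mult_nonneg_nonpos) auto
      have "\<phi> n z = 0" for n using le[of n] by (simp add: \<phi>_def)
      then show ?thesis using False by simp
    qed
    have "(\<lambda>n. LINT t|lborel. m t * \<phi> n (?X t)) \<longlonglongrightarrow> (LINT t|lborel. m t * (if ?X t < y then 1 else 0))"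
    proof (rule integral_dominated_convergence[where w = "\<lambda>t. \<bar>m t\<bar>"])
      show "AE t in lborel. (\<lambda>n. m t * \<phi> n (?X t)) \<longlonglongrightarrow> m t * (if ?X t < y then 1 else 0)"
        by (intro AE_I2 tendsto_mult_left lim)
      show "AE t in lborel. norm (m t * \<phi> n (?X t)) \<le> \<bar>m t\<bar>" for n
        by (intro AE_I2) (auto simp: \<phi>_def abs_mult intro!: mult_left_le)
      show "(\<lambda>t. m t * \<phi> n (?X t)) \<in> borel_measurable lborel" for n
        unfolding \<phi>_def by measurable
    qed (use m in \<open>auto\<close>)
    moreover have "(LINT t|lborel. m t * \<phi> n (?X t)) = 0" for n
      unfolding \<phi>_def by (rule exp_moments_zero_imp_integral_zero[OF m m0 mom]) (auto intro!: continuous_intros)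
    ultimately have "(LINT t|lborel. m t * (if ?X t < y then 1 else 0)) = 0"
      by (simp add: LIMSEQ_const_iff)
    moreover have "(LINT t|lborel. m t * (if ?X t < y then 1 else 0)) = (LINT t:{x<..}|lborel. m t)"
      unfolding set_lebesgue_integral_def using False m0
      by (intro Bochner_Integration.integral_cong) (auto simp: indicator_def y_def)
    ultimately show ?thesis by simp
  qed
  then have "AE t in lborel. m t = 0"
    by (rule integrable_AE_zero_if_tails_zero[OF m])
  then show ?thesis by eventually_elim (auto simp: m_def)
qed

section \<open>The decreasing representative of the kernel\<close>

lemma measurable_lborel_pair_borel:
  assumes "(\<lambda>t. t) \<in> N \<rightarrow>\<^sub>M borel" "case_prod F \<in> (borel \<Otimes>\<^sub>M borel) \<rightarrow>\<^sub>M L"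
  shows "case_prod F \<in> (lborel \<Otimes>\<^sub>M N) \<rightarrow>\<^sub>M L"
proof -
  have "(\<lambda>p. (fst p, snd p)) \<in> (lborel \<Otimes>\<^sub>M N) \<rightarrow>\<^sub>M (borel \<Otimes>\<^sub>M borel)"
    by (intro measurable_Pair measurable_compose[OF measurable_snd assms(1)]) simp
  from measurable_compose[OF this assms(2)] show ?thesis by simp
qed

text \<open>1 / (p + x) is the Laplace transform of exp(-x t) at p, so the Stieltjes representation
  of the transform of g is the transform of a mixture of decreasing exponentials, apart from the
  constant \<beta>, which (g3) excludes. Injectivity of the transform identifies the mixture with g
  almost everywhere.\<close>

lemma admissible_kernel_AE_monotone:
  assumes g: "admissible_kernel g"
  obtains k where "k \<in> borel_measurable borel" "\<And>t. 0 \<le> k t"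
    "\<And>s t. 0 < s \<Longrightarrow> s \<le> t \<Longrightarrow> k t \<le> k s"
    "AE t in lborel. 0 < t \<longrightarrow> g t = k t"
proof -
  have gint: "set_integrable lborel {0<..} (\<lambda>t. exp (- p * t) * g t)" if "p > 0" for p
    using g that by (auto simp: admissible_kernel_def)
  obtain \<alpha> \<beta> and \<mu> :: "real measure" where ab: "\<alpha> \<ge> 0" "\<beta> \<ge> 0"
    and sets: "sets \<mu> = sets (restrict_space borel {0<..})"
    and int: "integrable \<mu> (\<lambda>t. 1 / (1 + t))"
    and repr: "\<And>p. p > 0 \<Longrightarrow> laplace g p = \<alpha> / p + \<beta> + (LINT t|\<mu>. 1 / (p + t))"
    using g unfolding admissible_kernel_def stieltjes_function_def by metis
  have space: "space \<mu> = {0<..}"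
    using sets_eq_imp_space_eq[OF sets] by (simp add: space_restrict_space)
  \<comment> \<open>\<open>\<mu>\<close> lives on the trace sigma-algebra of (0,\<infinity>), so
    Borel measurability has to be imported along the identity map.\<close>
  have idm: "(\<lambda>t. t) \<in> \<mu> \<rightarrow>\<^sub>M borel"
    by (subst measurable_cong_sets[OF sets refl]) (rule measurable_restrict_space1, simp)
  \<comment> \<open>\<open>\<mu>\<close> may be infinite; the weight 1 / (1 + x) makes it finite,
    which gives access to Tonelli. The factor 1 + x in later integrands undoes the weight.\<close>
  define \<nu> where "\<nu> = density \<mu> (\<lambda>t. ennreal (1 / (1 + t)))"
  have space\<nu>: "space \<nu> = {0<..}" by (simp add: \<nu>_def space)
  have id\<nu>: "(\<lambda>t. t) \<in> \<nu> \<rightarrow>\<^sub>M borel"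
    using idm by (simp add: \<nu>_def)
  have w[measurable]: "(\<lambda>t. 1 / (1 + t)) \<in> borel_measurable \<mu>"
    using idm by measurable
  have "emeasure \<nu> (space \<nu>) = (\<integral>\<^sup>+t. ennreal (1 / (1 + t)) \<partial>\<mu>)"
    unfolding \<nu>_def by (subst emeasure_density) (auto intro!: nn_integral_cong)
  also have "\<dots> = ennreal (LINT t|\<mu>. 1 / (1 + t))"
    by (intro nn_integral_eq_integral[OF int] AE_I2) (simp add: space)
  finally interpret \<nu>: finite_measure \<nu>
    by (intro finite_measureI) simp
  interpret P: pair_sigma_finite lborel \<nu> ..
  have bnd: "integrable \<nu> f" if "f \<in> borel_measurable borel" "\<And>t. t > 0 \<Longrightarrow> \<bar>f t\<bar> \<le> B" for f and B :: real
  proof (rule \<nu>.integrable_const_bound[where B = B])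
    show "f \<in> borel_measurable \<nu>" using that(1) id\<nu> by (rule measurable_compose[rotated])
  qed (use that in \<open>auto simp: space\<nu> intro!: AE_I2\<close>)
  have stie: "(LINT t|\<mu>. 1 / (p + t)) = (LINT t|\<nu>. (1 + t) / (p + t))" if "p > 0" for p
  proof -
    have "(LINT t|\<nu>. (1 + t) / (p + t)) = (LINT t|\<mu>. (1 / (1 + t)) *\<^sub>R ((1 + t) / (p + t)))"
      unfolding \<nu>_def using idm
      by (intro integral_density) (auto simp: space intro!: AE_I2)
    also have "\<dots> = (LINT t|\<mu>. 1 / (p + t))"
      by (intro Bochner_Integration.integral_cong) (auto simp: space)
    finally show ?thesis by simp
  qed
  \<comment> \<open>The transform of g tends to 0 at infinity and stays above \<beta>, so \<beta> =
    0. A positive \<beta> would be the transform of a point mass at t = 0, which is not a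
    function.\<close>
  have "((\<lambda>p. laplace g p) \<longlongrightarrow> 0) at_top"
    using g by (auto simp: admissible_kernel_def)
  moreover have "\<forall>\<^sub>F p in at_top. \<beta> \<le> laplace g p"
    using eventually_gt_at_top[of 0]
  proof eventually_elim
    case (elim p)
    have "0 \<le> (LINT t|\<mu>. 1 / (p + t))"
      by (intro integral_nonneg_AE AE_I2) (use elim in \<open>simp add: space\<close>)
    then show ?case using ab elim by (simp add: repr)
  qed
  ultimately have "\<beta> \<le> 0"
    by (intro tendsto_lowerbound[of "laplace g" 0 at_top]) auto
  with ab have \<beta>: "\<beta> = 0" by simp
  \<comment> \<open>The constant \<open>\<alpha>\<close> is the contribution of a mass at x = 0,
    whose exponential does not decay and whose transform is \<alpha> / p.\<close>
  define k where "k t = \<alpha> + (LINT x|\<nu>. (1 + x) * exp (- (t * x)))" for t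
  have exp_bd: "(1 + x) * exp (- (t * x)) \<le> 1 + 1 / t" if "t > 0" "x > 0" for t x :: real
  proof -
    have "1 + t * x \<le> exp (t * x)" by (rule exp_ge_add_one_self)
    moreover have "0 \<le> t * x" using that by simp
    ultimately have "t * x \<le> exp (t * x)" "1 \<le> exp (t * x)" by linarith+
    then have "x \<le> exp (t * x) / t" "1 \<le> exp (t * x)" using that by (simp_all only: field_simps)
    then have "1 + x \<le> exp (t * x) + exp (t * x) / t" by linarith
    then have "1 + x \<le> (1 + 1 / t) * exp (t * x)" by (simp add: distrib_right)
    then show ?thesis by (simp add: exp_minus field_simps)
  qed
  have kint: "integrable \<nu> (\<lambda>x. (1 + x) * exp (- (t * x)))" if "t > 0" for t
    by (rule bnd[where B = "1 + 1 / t"]) (use that exp_bd[OF that] in \<open>auto simp: abs_mult\<close>)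
  have km[measurable]: "k \<in> borel_measurable borel"
    unfolding k_def
    by (intro borel_measurable_add borel_measurable_const
          \<nu>.borel_measurable_lebesgue_integral[of _ lborel, simplified]
          measurable_lborel_pair_borel[OF id\<nu>]) measurable
  have k0: "0 \<le> k t" for t
    unfolding k_def using ab
    by (intro add_nonneg_nonneg integral_nonneg_AE AE_I2) (auto simp: space\<nu>)
  have kmono: "k t \<le> k s" if "0 < s" "s \<le> t" for s t
    unfolding k_def using that
    by (intro add_left_mono integral_mono_AE kint AE_I2)
       (auto simp: space\<nu> intro!: mult_left_mono mult_right_mono)
  have lap: "set_integrable lborel {0<..} (\<lambda>t. exp (- p * t) * k t) \<and> laplace k p = laplace g p"
    if p: "p > 0" for p
  proof -
    \<comment> \<open>All factors are nonnegative, so computing the integral in the extended reals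
      yields integrability and the value of the transform at once.\<close>
    let ?f = "\<lambda>t. indicator {0<..} t *\<^sub>R (exp (- p * t) * k t)"
    have expint: "(\<integral>\<^sup>+t. ennreal (indicator {0<..} t * (exp (- (c * t)))) \<partial>lborel) = ennreal (1 / c)"
      if "c > 0" for c :: real
    proof -
      have "(\<integral>\<^sup>+t. ennreal (exp (- c * t)) * indicator {0..} t \<partial>lborel) = ennreal (exp (- c * 0) / c)"
        by (rule nn_integral_has_integral_lebesgue'[OF _ has_integral_exp_minus_to_infinity[OF that]]) simp
      moreover have "(\<integral>\<^sup>+t. ennreal (exp (- c * t)) * indicator {0..} t \<partial>lborel) =
          (\<integral>\<^sup>+t. ennreal (indicator {0<..} t * (exp (- (c * t)))) \<partial>lborel)"
        by (intro nn_integral_cong_AE eventually_mono[OF AE_lborel_singleton[of 0]]) (auto simp: indicator_def)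
      ultimately show ?thesis by simp
    qed
    have "(\<integral>\<^sup>+t. ennreal (?f t) \<partial>lborel) =
        (\<integral>\<^sup>+t. (ennreal \<alpha> * ennreal (indicator {0<..} t * exp (- (p * t))) +
          (\<integral>\<^sup>+x. ennreal (1 + x) * ennreal (indicator {0<..} t * exp (- ((p + x) * t))) \<partial>\<nu>)) \<partial>lborel)"
    proof (rule nn_integral_cong)
      fix t :: real
      show "ennreal (?f t) = ennreal \<alpha> * ennreal (indicator {0<..} t * exp (- (p * t))) +
          (\<integral>\<^sup>+x. ennreal (1 + x) * ennreal (indicator {0<..} t * exp (- ((p + x) * t))) \<partial>\<nu>)"
      proof (cases "t > 0")
        case True
        have "(\<integral>\<^sup>+x. ennreal (1 + x) * ennreal (indicator {0<..} t * exp (- ((p + x) * t))) \<partial>\<nu>) =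
            (\<integral>\<^sup>+x. ennreal (exp (- (p * t)) * ((1 + x) * exp (- (t * x)))) \<partial>\<nu>)"
          using True
          by (intro nn_integral_cong)
             (auto simp: space\<nu> ennreal_mult[symmetric] exp_add[symmetric] algebra_simps)
        also have "\<dots> = ennreal (LINT x|\<nu>. exp (- (p * t)) * ((1 + x) * exp (- (t * x))))"
          by (intro nn_integral_eq_integral AE_I2 integrable_mult_right kint True) (simp add: space\<nu>)
        also have "\<dots> = ennreal (exp (- (p * t)) * (LINT x|\<nu>. (1 + x) * exp (- (t * x))))"
          by simp
        finally have eq: "(\<integral>\<^sup>+x. ennreal (1 + x) * ennreal (indicator {0<..} t * exp (- ((p + x) * t))) \<partial>\<nu>) =
            ennreal (exp (- (p * t)) * (LINT x|\<nu>. (1 + x) * exp (- (t * x))))" .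
        have nn: "0 \<le> (LINT x|\<nu>. (1 + x) * exp (- (t * x)))"
          by (intro integral_nonneg_AE AE_I2) (auto simp: space\<nu>)
        show ?thesis using True ab nn unfolding eq
          by (simp add: k_def ennreal_mult[symmetric] ennreal_plus[symmetric] algebra_simps del: ennreal_plus)
      qed simp
    qed
    also have "\<dots> = (\<integral>\<^sup>+t. ennreal \<alpha> * ennreal (indicator {0<..} t * exp (- (p * t))) \<partial>lborel) +
        (\<integral>\<^sup>+t. (\<integral>\<^sup>+x. ennreal (1 + x) * ennreal (indicator {0<..} t * exp (- ((p + x) * t))) \<partial>\<nu>) \<partial>lborel)"
    proof (rule nn_integral_add)
      show "(\<lambda>t. \<integral>\<^sup>+x. ennreal (1 + x) * ennreal (indicator {0<..} t * exp (- ((p + x) * t))) \<partial>\<nu>)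
          \<in> borel_measurable lborel"
        by (intro \<nu>.borel_measurable_nn_integral measurable_lborel_pair_borel[OF id\<nu>]) measurable
    qed measurable
    also have "(\<integral>\<^sup>+t. ennreal \<alpha> * ennreal (indicator {0<..} t * exp (- (p * t))) \<partial>lborel) = ennreal \<alpha> * ennreal (1 / p)"
      by (subst nn_integral_cmult) (auto simp: expint[OF p])
    also have "(\<integral>\<^sup>+t. (\<integral>\<^sup>+x. ennreal (1 + x) * ennreal (indicator {0<..} t * exp (- ((p + x) * t))) \<partial>\<nu>) \<partial>lborel)
       = (\<integral>\<^sup>+x. (\<integral>\<^sup>+t. ennreal (1 + x) * ennreal (indicator {0<..} t * exp (- ((p + x) * t))) \<partial>lborel) \<partial>\<nu>)"
      by (intro P.Fubini'[symmetric] measurable_lborel_pair_borel[OF id\<nu>]) measurable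
    also have "\<dots> = (\<integral>\<^sup>+x. ennreal ((1 + x) / (p + x)) \<partial>\<nu>)"
    proof (rule nn_integral_cong)
      fix x assume x: "x \<in> space \<nu>"
      have "(\<integral>\<^sup>+t. ennreal (1 + x) * ennreal (indicator {0<..} t * exp (- ((p + x) * t))) \<partial>lborel) =
          ennreal (1 + x) * ennreal (1 / (p + x))"
        using x p by (subst nn_integral_cmult) (auto simp: expint space\<nu>)
      then show "(\<integral>\<^sup>+t. ennreal (1 + x) * ennreal (indicator {0<..} t * exp (- ((p + x) * t))) \<partial>lborel) =
          ennreal ((1 + x) / (p + x))"
        using x p by (simp add: ennreal_mult[symmetric] space\<nu> del: ennreal_plus)
    qed
    also have "\<dots> = ennreal (LINT x|\<nu>. (1 + x) / (p + x))"
    proof (intro nn_integral_eq_integral AE_I2)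
      show "integrable \<nu> (\<lambda>x. (1 + x) / (p + x))"
        by (rule bnd[where B = "1 + 1 / p"])
           (use p in \<open>auto simp: field_simps abs_if intro: add_increasing2\<close>)
    qed (use p in \<open>auto simp: space\<nu>\<close>)
    also have "ennreal \<alpha> * ennreal (1 / p) + ennreal (LINT x|\<nu>. (1 + x) / (p + x)) = ennreal (laplace g p)"
    proof -
      have "0 \<le> (LINT x|\<nu>. (1 + x) / (p + x))"
        by (intro integral_nonneg_AE AE_I2) (use p in \<open>auto simp: space\<nu>\<close>)
      then show ?thesis using ab p
        by (simp add: repr \<beta> stie ennreal_mult[symmetric] ennreal_plus[symmetric] del: ennreal_plus)
    qed
    finally have nn: "(\<integral>\<^sup>+t. ennreal (?f t) \<partial>lborel) = ennreal (laplace g p)" .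
    have "0 \<le> laplace g p"
      using ab p by (simp add: repr stie) (intro add_nonneg_nonneg integral_nonneg_AE AE_I2; simp add: space\<nu>)
    then have "has_bochner_integral lborel ?f (laplace g p)"
      using nn k0 by (intro has_bochner_integral_nn_integral) auto
    then show ?thesis
      by (auto simp: set_integrable_def laplace_def set_lebesgue_integral_def has_bochner_integral_iff)
  qed
  have "AE t in lborel. 0 < t \<longrightarrow> g t - k t = 0"
  proof (rule laplace_zero_imp_AE_zero)
    show "set_integrable lborel {0<..} (\<lambda>t. exp (- t) * (g t - k t))"
      using set_integral_diff(1)[OF gint[of 1] conjunct1[OF lap[of 1]]] by (simp add: right_diff_distrib)
    fix n :: nat
    have "laplace (\<lambda>t. g t - k t) p = laplace g p - laplace k p" if "p > 0" for p
      unfolding laplace_def right_diff_distrib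
      by (rule set_integral_diff(2)[OF gint[OF that] conjunct1[OF lap[OF that]]])
    then show "laplace (\<lambda>t. g t - k t) (real (Suc n)) = 0" using lap[of "real (Suc n)"] by simp
  qed
  then have "AE t in lborel. 0 < t \<longrightarrow> g t = k t" by simp
  with km k0 kmono show ?thesis by (rule that)
qed

section \<open>The maximum principle\<close>

locale decreasing_kernel =
  fixes k :: "real \<Rightarrow> real"
  assumes kernel_measurable[measurable]: "k \<in> borel_measurable borel"
    and kernel_nonneg: "0 \<le> k t"
    and kernel_antimono: "0 < s \<Longrightarrow> s \<le> t \<Longrightarrow> k t \<le> k s"
    and kernel_integrable: "set_integrable lborel {0<..r} k"
begin

lemma kernel_mult_integrable:
  fixes f :: "real \<Rightarrow> real"
  assumes [measurable]: "f \<in> borel_measurable borel" and B: "\<And>s. s \<in> {0<..r} \<Longrightarrow> \<bar>f s\<bar> \<le> B"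
  shows "set_integrable lborel {0<..r} (\<lambda>s. k s * f s)"
  unfolding set_integrable_def
proof (rule Bochner_Integration.integrable_bound[where f = "\<lambda>s. B * (indicator {0<..r} s *\<^sub>R k s)"])
  show "integrable lborel (\<lambda>s. B * (indicator {0<..r} s *\<^sub>R k s))"
    using kernel_integrable[of r] by (auto simp: set_integrable_def)
  show "AE s in lborel. norm (indicator {0<..r} s *\<^sub>R (k s * f s)) \<le> norm (B * (indicator {0<..r} s *\<^sub>R k s))"
  proof (rule AE_I2)
    fix s
    have "k s * \<bar>f s\<bar> \<le> k s * \<bar>B\<bar>" if "s \<in> {0<..r}"
      using B[OF that] by (intro mult_left_mono kernel_nonneg) auto
    then show "norm (indicator {0<..r} s *\<^sub>R (k s * f s)) \<le> norm (B * (indicator {0<..r} s *\<^sub>R k s))"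
      by (auto simp: indicator_def abs_mult kernel_nonneg mult.commute)
  qed
qed measurable

lemma kernel_integral_tendsto_0:
  "((\<lambda>h. LINT s:{0<..h}|lborel. k s) \<longlongrightarrow> 0) (at_right 0)"
proof -
  have neg: "negligible {x \<in> {0<..h} - {0..h}. k x \<noteq> 0}" "negligible {x \<in> {0..h} - {0<..h}. k x \<noteq> 0}" for h :: real
    by (rule negligible_subset[of "{0}"]; force)+
  have eq: "(LINT s:{0<..h}|lborel. k s) = integral {0..h} k" if "h > 0" for h
  proof -
    have "(LINT s:{0<..h}|lborel. k s) = integral {0<..h} k"
      by (rule set_borel_integral_eq_integral(2)[OF kernel_integrable])
    also have "\<dots> = integral {0..h} k"
      by (rule integral_spike_set[OF neg])
    finally show ?thesis .
  qed
  have "k integrable_on {0<..(1::real)}"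
    by (rule set_borel_integral_eq_integral(1)[OF kernel_integrable])
  then have "k integrable_on {0..1}"
    by (rule integrable_spike_set[OF _ neg])
  then have "continuous_on {0..1} (\<lambda>h. integral {0..h} k)"
    by (rule indefinite_integral_continuous_1)
  then have "((\<lambda>h. integral {0..h} k) \<longlongrightarrow> integral {0..0} k) (at 0 within {0..1})"
    unfolding continuous_on_def by (rule bspec) simp
  then have "((\<lambda>h. integral {0..h} k) \<longlongrightarrow> 0) (at_right 0)"
    by (simp add: at_within_Icc_at_right)
  moreover have "\<forall>\<^sub>F h in at_right 0. integral {0..h} k = (LINT s:{0<..h}|lborel. k s)"
    using eventually_at_right_less[of 0] by eventually_elim (simp add: eq)
  ultimately show ?thesis by (rule Lim_transform_eventually)
qed

text \<open>Substituting s - h for s moves the increment from \<open>\<psi>\<close> to the kernel.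
  For h < s \<le> T the factor k(s - h) - k(s) is nonnegative by monotonicity, and beyond T only the
  nonnegative shifted term is left. Losses occur only on (0,h], where \<open>\<psi>\<close> is at
  most L h.\<close>

lemma convolution_increment_ge:
  assumes \<psi>[measurable]: "\<psi> \<in> borel_measurable borel"
    and nn: "\<And>s. 0 \<le> s \<Longrightarrow> 0 \<le> \<psi> s" and L: "\<And>s. 0 \<le> s \<Longrightarrow> \<psi> s \<le> L * s"
    and h: "0 < h"
  shows "- (L * h) * (LINT s:{0<..h}|lborel. k s) \<le> (LINT s:{0<..T}|lborel. k s * (\<psi> (s + h) - \<psi> s))"
proof -
  let ?I = "\<lambda>r s. indicator {0<..r} s :: real"
  have L0: "0 \<le> L" using nn[of 1] L[of 1] by simp
  have bd: "\<bar>\<psi> s\<bar> \<le> L * r" if "0 \<le> s" "s \<le> r" for s r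
    using nn[of s] L[of s] that L0 mult_left_mono[OF that(2) L0] by linarith
  have i1: "integrable lborel (\<lambda>s. ?I T s * (k s * \<psi> (s + h)))"
    using kernel_mult_integrable[of "\<lambda>s. \<psi> (s + h)" T "L * (T + h)"] bd[of _ "T + h"] h
    by (simp add: set_integrable_def)
  have i2: "integrable lborel (\<lambda>s. ?I T s * (k s * \<psi> s))"
    using kernel_mult_integrable[of "\<psi>" T "L * T"] bd[of _ "T"]
    by (simp add: set_integrable_def)
  have i3: "integrable lborel (\<lambda>s. L * h * (?I h s * k s))"
    using kernel_integrable[of h] by (simp add: set_integrable_def)
  have i1': "integrable lborel (\<lambda>s. ?I T (s - h) * (k (s - h) * \<psi> s))"
    using lborel_integrable_real_affine[OF i1, of 1 "- h"] by simp
  have shift: "(LINT s|lborel. ?I T s * (k s * \<psi> (s + h))) = (LINT s|lborel. ?I T (s - h) * (k (s - h) * \<psi> s))"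
    using lborel_integral_real_affine[of 1 "\<lambda>s. ?I T s * (k s * \<psi> (s + h))" "- h"] by simp
  have "(LINT s|lborel. ?I T s * (k s * \<psi> s) - ?I T (s - h) * (k (s - h) * \<psi> s)) \<le> (LINT s|lborel. L * h * (?I h s * k s))"
  proof (intro integral_mono Bochner_Integration.integrable_diff i1' i2 i3)
    fix s :: real
    consider "s \<le> 0" | "0 < s" "s \<le> h" | "h < s" "s \<le> T" | "h < s" "T < s" by linarith
    then show "?I T s * (k s * \<psi> s) - ?I T (s - h) * (k (s - h) * \<psi> s) \<le> L * h * (?I h s * k s)"
    proof cases
      case 2
      have "k s * \<psi> s \<le> k s * (L * h)"
        using 2 bd[of s h] by (intro mult_left_mono kernel_nonneg) auto
      moreover have "0 \<le> k s * (L * h)" using kernel_nonneg L0 h by simp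
      ultimately show ?thesis using 2 by (auto simp: indicator_def mult_ac)
    next
      case 3
      have "k s * \<psi> s \<le> k (s - h) * \<psi> s"
        using 3 h nn[of s] by (intro mult_right_mono kernel_antimono) auto
      then show ?thesis using 3 h by (auto simp: indicator_def)
    next
      case 4
      then show ?thesis using h nn[of s] kernel_nonneg by (auto simp: indicator_def)
    qed (use h in \<open>auto simp: indicator_def\<close>)
  qed
  then have "(LINT s|lborel. ?I T s * (k s * \<psi> s)) - (LINT s|lborel. ?I T s * (k s * \<psi> (s + h))) \<le> L * h * (LINT s|lborel. ?I h s * k s)"
    using i1' i2 by (simp add: shift)
  moreover have "(LINT s:{0<..T}|lborel. k s * (\<psi> (s + h) - \<psi> s)) =
      (LINT s|lborel. ?I T s * (k s * \<psi> (s + h)) - ?I T s * (k s * \<psi> s))"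
    unfolding set_lebesgue_integral_def by (simp add: algebra_simps)
  ultimately show ?thesis
    using i1 i2 by (simp add: set_lebesgue_integral_def)
qed

text \<open>The difference quotients of \<open>W\<close> are bounded by C and \<open>k\<close> is
  integrable on (0,T], so dominated convergence applies. \<open>V\<close> need not be continuous: it
  is measurable as a limit of difference quotients.\<close>

lemma convolution_has_derivative:
  fixes W V :: "real \<Rightarrow> real"
  assumes W: "\<And>x. (W has_real_derivative V x) (at x)"
    and C: "\<And>x. \<bar>V x\<bar> \<le> C"
  shows "((\<lambda>t. LINT s:{0<..T}|lborel. k s * W (t - s)) has_real_derivative
           (LINT s:{0<..T}|lborel. k s * V (t - s))) (at t)"
proof -
  have lip: "\<bar>W x - W y\<bar> \<le> C * \<bar>x - y\<bar>" for x y
    using field_differentiable_bound[of UNIV W V C x y] W C by (auto simp: has_field_derivative_at_within)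
  have Wc: "continuous_on UNIV W"
    using W by (auto intro: DERIV_isCont simp: continuous_on_eq_continuous_at)
  then have Wm[measurable]: "W \<in> borel_measurable borel" by (rule borel_measurable_continuous_onI)
  have int: "set_integrable lborel {0<..T} (\<lambda>s. k s * W (x - s))" for x
  proof (rule kernel_mult_integrable)
    fix s assume "s \<in> {0<..T}"
    moreover have "0 \<le> C" using C[of 0] by simp
    ultimately have "C * s \<le> C * T" by (intro mult_left_mono) auto
    then show "\<bar>W (x - s)\<bar> \<le> \<bar>W x\<bar> + C * T"
      using lip[of "x - s" x] \<open>s \<in> {0<..T}\<close> by auto
  qed measurable
  have lim: "(\<lambda>n. (LINT s:{0<..T}|lborel. k s * ((W (X n - s) - W (t - s)) / (X n - t))))
      \<longlonglongrightarrow> (LINT s:{0<..T}|lborel. k s * V (t - s))"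
    if X: "\<And>n. X n \<noteq> t" "X \<longlonglongrightarrow> t" for X
    unfolding set_lebesgue_integral_def
  proof (rule integral_dominated_convergence[where w = "\<lambda>s. C * (indicator {0<..T} s *\<^sub>R k s)"])
    show "integrable lborel (\<lambda>s. C * (indicator {0<..T} s *\<^sub>R k s))"
      using kernel_integrable[of T] by (simp add: set_integrable_def)
    have quot: "(\<lambda>n. (W (X n - s) - W (t - s)) / (X n - t)) \<longlonglongrightarrow> V (t - s)" for s
    proof -
      have "((\<lambda>y. (W y - W (t - s)) / (y - (t - s))) \<longlongrightarrow> V (t - s)) (at (t - s))"
        using W[of "t - s"] by (simp add: has_field_derivative_iff)
      moreover have "filterlim (\<lambda>n. X n - s) (at (t - s)) sequentially"
        using X by (auto intro!: filterlim_atI tendsto_intros)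
      ultimately have "(\<lambda>n. (W (X n - s) - W (t - s)) / (X n - s - (t - s))) \<longlonglongrightarrow> V (t - s)"
        by (rule filterlim_compose)
      then show ?thesis by (simp add: algebra_simps)
    qed
    show lims: "AE s in lborel. (\<lambda>n. indicator {0<..T} s *\<^sub>R (k s * ((W (X n - s) - W (t - s)) / (X n - t))))
        \<longlonglongrightarrow> indicator {0<..T} s *\<^sub>R (k s * V (t - s))"
      by (intro AE_I2 tendsto_intros quot)
    have "(\<lambda>s. V (t - s)) \<in> borel_measurable borel"
      by (rule borel_measurable_LIMSEQ_real[OF quot]) measurable
    then show "(\<lambda>s. indicator {0<..T} s *\<^sub>R (k s * V (t - s))) \<in> borel_measurable lborel"
      by measurable
    show "AE s in lborel. norm (indicator {0<..T} s *\<^sub>R (k s * ((W (X n - s) - W (t - s)) / (X n - t))))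
        \<le> C * (indicator {0<..T} s *\<^sub>R k s)" for n
    proof (rule AE_I2)
      fix s
      have "\<bar>(W (X n - s) - W (t - s)) / (X n - t)\<bar> \<le> C"
        using lip[of "X n - s" "t - s"] X(1)[of n] by (simp add: divide_le_eq)
      from mult_left_mono[OF this kernel_nonneg[of s]]
      show "norm (indicator {0<..T} s *\<^sub>R (k s * ((W (X n - s) - W (t - s)) / (X n - t))))
          \<le> C * (indicator {0<..T} s *\<^sub>R k s)"
        by (auto simp: indicator_def abs_mult kernel_nonneg mult.commute)
    qed
  qed measurable
  have "(\<lambda>x. (LINT s:{0<..T}|lborel. k s * W (x - s)) - (LINT s:{0<..T}|lborel. k s * W (t - s))) =
     (\<lambda>x. LINT s:{0<..T}|lborel. k s * (W (x - s) - W (t - s)))"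
    by (subst set_integral_diff(2)[symmetric, OF int int]) (simp add: right_diff_distrib)
  then have eq: "((LINT s:{0<..T}|lborel. k s * W (x - s)) - (LINT s:{0<..T}|lborel. k s * W (t - s))) / (x - t) =
     (LINT s:{0<..T}|lborel. k s * ((W (x - s) - W (t - s)) / (x - t)))" for x
    by (simp add: fun_eq_iff set_integral_mult_right[symmetric] divide_inverse mult_ac)
  show ?thesis
    unfolding has_field_derivative_iff eq
    unfolding tendsto_at_iff_sequentially comp_def using lim by auto
qed

text \<open>The time average \<open>y\<close> of \<open>U\<close> is Lipschitz, so that near a maximum the singularity of the
  kernel only contributes \<open>o(h)\<close> to the increment of its convolution.\<close>

lemma averaged_max_contradiction:
  fixes W U :: "real \<Rightarrow> real"
  defines "y \<equiv> \<lambda>\<delta> t. (W t - W (t - \<delta>)) / \<delta>"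
  assumes W: "\<And>x. (W has_real_derivative U x) (at x)" and C: "\<And>x. \<bar>U x\<bar> \<le> C"
    and \<delta>: "0 < \<delta>" and c: "0 < c"
    and max: "\<And>t. t \<le> t0 \<Longrightarrow> y \<delta> t \<le> y \<delta> t0"
    and dec: "\<And>\<xi>. t0 - \<delta> \<le> \<xi> \<Longrightarrow> \<xi> \<le> t0 \<Longrightarrow>
      (LINT s:{0<..T}|lborel. k s * (U (\<xi> - s) - u0)) - (LINT s:{0<..T}|lborel. k s * (U (\<xi> - \<delta> - s) - u0)) \<le> - c * \<delta>"
  shows False
proof -
  have C0: "0 \<le> C" using C[of 0] by simp
  \<comment> \<open>Subtracting the linear function turns the derivative U into U - u0, the
    integrand of the integrated Caputo equation; in differences over \<open>\<delta>\<close> it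
    merely subtracts u0.\<close>
  define W0 where "W0 x = W x - u0 * x" for x
  have W0: "(W0 has_real_derivative U x - u0) (at x)" for x
    unfolding W0_def by (auto intro!: derivative_eq_intros W)
  have C': "\<bar>U x - u0\<bar> \<le> C + \<bar>u0\<bar>" for x
    using C[of x] by linarith
  define G where "G t = (LINT s:{0<..T}|lborel. k s * (U (t - s) - u0))" for t
  define D where "D t = (LINT s:{0<..T}|lborel. k s * W0 (t - s))" for t
  have D: "(D has_real_derivative G t) (at t)" for t
    unfolding D_def G_def by (rule convolution_has_derivative[OF W0 C'])
  have lip: "\<bar>W x - W z\<bar> \<le> C * \<bar>x - z\<bar>" for x z
    using field_differentiable_bound[of UNIV W U C x z] W C by (auto simp: has_field_derivative_at_within)
  have Wc: "continuous_on UNIV W"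
    using W by (auto intro: DERIV_isCont simp: continuous_on_eq_continuous_at)
  then have Wm[measurable]: "W \<in> borel_measurable borel" by (rule borel_measurable_continuous_onI)
  have intW0: "set_integrable lborel {0<..T} (\<lambda>s. k s * W0 (x - s))" for x
  proof (rule kernel_mult_integrable)
    fix s assume "s \<in> {0<..T}"
    moreover have "W0 (x - s) = W (x - s) - W x + W x - u0 * x + u0 * s" by (simp add: W0_def algebra_simps)
    moreover have "C * s \<le> C * T" "\<bar>u0\<bar> * s \<le> \<bar>u0\<bar> * T" if "s \<le> T"
      using that C0 by (auto intro: mult_left_mono)
    moreover have "\<bar>u0 * s\<bar> = \<bar>u0\<bar> * \<bar>s\<bar>" by (simp add: abs_mult)
    ultimately show "\<bar>W0 (x - s)\<bar> \<le> \<bar>W x - u0 * x\<bar> + C * T + \<bar>u0\<bar> * T"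
      using lip[of "x - s" x] by auto
  qed (simp add: W0_def)
  \<comment> \<open>Lipschitz constant of the average: two increments of \<open>W\<close>, each with
    constant C, divided by \<open>\<delta>\<close>. It blows up for small \<open>\<delta>\<close>,
    but \<open>\<delta>\<close> stays fixed while h tends to 0.\<close>
  define L where "L = 2 * C / \<delta>"
  have main: "c \<le> L * (LINT s:{0<..h}|lborel. k s)" if h: "0 < h" "h \<le> \<delta>" for h
  proof -
    define \<psi> where "\<psi> s = y \<delta> t0 - y \<delta> (t0 - s)" for s
    \<comment> \<open>Averaging and convolving commute, so \<open>E\<close> is also the convolution
      of \<open>k\<close> with y - u0. Its derivative is the difference quotient of \<open>G\<close>
      over \<open>\<delta>\<close>, hence \<open>dec\<close> and the mean value theorem make it drop
      by at least c h over [t0 - h, t0].\<close>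
    define E where "E t = (D t - D (t - \<delta>)) / \<delta>" for t
    have "\<exists>\<xi>. t0 - h < \<xi> \<and> \<xi> < t0 \<and> E t0 - E (t0 - h) = (t0 - (t0 - h)) * ((G \<xi> - G (\<xi> - \<delta>)) / \<delta>)"
    proof (rule MVT2)
      fix x
      show "(E has_real_derivative (G x - G (x - \<delta>)) / \<delta>) (at x)"
      proof -
        have "((\<lambda>x. x - \<delta>) has_real_derivative 1) (at x)" by (auto intro!: derivative_eq_intros)
        from DERIV_chain2[OF D this] show ?thesis
          unfolding E_def using \<delta> by (auto intro!: derivative_eq_intros D)
      qed
    qed (use h in simp)
    then obtain \<xi> where \<xi>: "t0 - h < \<xi>" "\<xi> < t0" and E\<xi>: "E t0 - E (t0 - h) = h * ((G \<xi> - G (\<xi> - \<delta>)) / \<delta>)"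
      by auto
    have "(G \<xi> - G (\<xi> - \<delta>)) / \<delta> \<le> - c"
      using dec[of \<xi>] \<xi> h \<delta> unfolding G_def by (simp add: field_simps)
    then have up: "E t0 - E (t0 - h) \<le> - c * h"
      unfolding E\<xi> using h mult_left_mono[of "(G \<xi> - G (\<xi> - \<delta>)) / \<delta>" "- c" h] by (simp add: mult.commute)
    have ylip: "\<bar>y \<delta> x - y \<delta> z\<bar> \<le> L * \<bar>x - z\<bar>" for x z
    proof -
      have "y \<delta> x - y \<delta> z = ((W x - W z) - (W (x - \<delta>) - W (z - \<delta>))) / \<delta>"
        using \<delta> by (simp add: y_def field_simps)
      moreover have "\<bar>(W x - W z) - (W (x - \<delta>) - W (z - \<delta>))\<bar> \<le> 2 * C * \<bar>x - z\<bar>"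
        using lip[of x z] lip[of "x - \<delta>" "z - \<delta>"] by simp
      ultimately show ?thesis using \<delta> by (simp add: L_def divide_right_mono)
    qed
    have ED: "E x = (LINT s:{0<..T}|lborel. k s * (y \<delta> (x - s) - u0))" for x
    proof -
      have "D x - D (x - \<delta>) = (LINT s:{0<..T}|lborel. k s * W0 (x - s) - k s * W0 (x - \<delta> - s))"
        unfolding D_def by (subst set_integral_diff[OF intW0 intW0]) simp
      also have "\<dots> = (LINT s:{0<..T}|lborel. \<delta> * (k s * (y \<delta> (x - s) - u0)))"
        using \<delta> by (intro arg_cong[where f = "set_lebesgue_integral lborel {0<..T}"] ext)
                 (simp add: W0_def y_def field_simps)
      finally show ?thesis using \<delta> by (simp add: E_def)
    qed
    have ym: "(\<lambda>s. y \<delta> (x - s)) \<in> borel_measurable borel" for x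
      unfolding y_def by measurable
    have yint: "set_integrable lborel {0<..T} (\<lambda>s. k s * (y \<delta> (x - s) - u0))" for x
    proof (rule kernel_mult_integrable)
      fix s assume "s \<in> {0<..T}"
      moreover have "0 \<le> L" using C0 \<delta> by (simp add: L_def)
      ultimately have "L * s \<le> L * T" by (intro mult_left_mono) auto
      then show "\<bar>y \<delta> (x - s) - u0\<bar> \<le> \<bar>y \<delta> x\<bar> + L * T + \<bar>u0\<bar>"
        using ylip[of "x - s" x] \<open>s \<in> {0<..T}\<close> by auto
    qed (use ym in measurable)
    \<comment> \<open>Since t0 is a maximum, \<open>\<psi>\<close> is nonnegative and grows at most
      linearly, so the convolution can drop by no more than L h times the kernel mass of (0,h].
      Against the drop c h this leaves c \<le> L times that mass, which tends to 0.\<close>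
    have "- (L * h) * (LINT s:{0<..h}|lborel. k s) \<le> (LINT s:{0<..T}|lborel. k s * (\<psi> (s + h) - \<psi> s))"
    proof (rule convolution_increment_ge)
      show "\<psi> \<in> borel_measurable borel" unfolding \<psi>_def using ym[of t0] by measurable
      show "0 \<le> \<psi> s" if "0 \<le> s" for s using max[of "t0 - s"] that by (simp add: \<psi>_def)
      show "\<psi> s \<le> L * s" if "0 \<le> s" for s using ylip[of t0 "t0 - s"] that by (simp add: \<psi>_def)
    qed (use h in auto)
    also have "(LINT s:{0<..T}|lborel. k s * (\<psi> (s + h) - \<psi> s)) =
        (LINT s:{0<..T}|lborel. k s * (y \<delta> (t0 - s) - u0) - k s * (y \<delta> (t0 - h - s) - u0))"
      by (intro arg_cong[where f = "set_lebesgue_integral lborel {0<..T}"] ext)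
         (simp add: \<psi>_def algebra_simps)
    also have "\<dots> = E t0 - E (t0 - h)"
      unfolding ED by (rule set_integral_diff[OF yint yint])
    also note up
    finally have "h * c \<le> h * (L * (LINT s:{0<..h}|lborel. k s))" by (simp add: mult_ac)
    then show ?thesis using h by simp
  qed
  have "((\<lambda>h. L * (LINT s:{0<..h}|lborel. k s)) \<longlongrightarrow> L * 0) (at_right 0)"
    by (intro tendsto_intros kernel_integral_tendsto_0)
  moreover have "\<forall>\<^sub>F h in at_right 0. c \<le> L * (LINT s:{0<..h}|lborel. k s)"
    using eventually_at_right_real[OF \<delta>] by eventually_elim (use main in auto)
  ultimately have "c \<le> L * 0" by (rule tendsto_lowerbound) simp
  with c show False by simp
qed

end

lemma uniformly_continuous_on_clamp:
  fixes v :: "real \<Rightarrow> real"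
  assumes T: "0 \<le> T" and v: "continuous_on {0..T} v" and \<rho>: "0 < \<rho>"
  shows "\<exists>d>0. \<forall>x y. \<bar>x - y\<bar> < d \<longrightarrow> \<bar>v (max 0 (min T x)) - v (max 0 (min T y))\<bar> < \<rho>"
proof -
  have "uniformly_continuous_on {0..T} v"
    by (rule compact_uniformly_continuous[OF v]) simp
  then obtain d where d: "d > 0" "\<And>x y. x \<in> {0..T} \<Longrightarrow> y \<in> {0..T} \<Longrightarrow> dist y x < d \<Longrightarrow> dist (v y) (v x) < \<rho>"
    using \<rho> unfolding uniformly_continuous_on_def by metis
  have "\<bar>v (max 0 (min T x)) - v (max 0 (min T y))\<bar> < \<rho>" if "\<bar>x - y\<bar> < d" for x y
    using d(2)[of "max 0 (min T y)" "max 0 (min T x)"] T that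
    by (auto simp: dist_real_def max_def min_def split: if_splits)
  with d(1) show ?thesis by blast
qed

lemma continuous_on_interval_bounded_finite:
  fixes v :: "'i \<Rightarrow> real \<Rightarrow> real"
  assumes "finite S" "\<And>i. i \<in> S \<Longrightarrow> continuous_on {a..b} (v i)"
  shows "\<exists>C>0. \<forall>i\<in>S. \<forall>x\<in>{a..b}. \<bar>v i x\<bar> \<le> C"
proof -
  have "\<exists>C. \<forall>x\<in>{a..b}. \<bar>v i x\<bar> \<le> C" if "i \<in> S" for i
  proof -
    have "bounded (v i ` {a..b})"
      by (intro compact_imp_bounded compact_continuous_image assms(2) that) simp
    then show ?thesis unfolding bounded_iff by force
  qed
  then obtain C where C: "\<And>i x. i \<in> S \<Longrightarrow> x \<in> {a..b} \<Longrightarrow> \<bar>v i x\<bar> \<le> C i" by metis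
  have "\<bar>v i x\<bar> \<le> 1 + (\<Sum>i\<in>S. \<bar>C i\<bar>)" if "i \<in> S" "x \<in> {a..b}" for i x
    using C[OF that] member_le_sum[OF that(1), of "\<lambda>i. \<bar>C i\<bar>"] assms(1) by auto
  moreover have "0 < 1 + (\<Sum>i\<in>S. \<bar>C i\<bar>)" by (simp add: add_pos_nonneg sum_nonneg)
  ultimately show ?thesis by blast
qed

lemma abs_power2_diff_le:
  fixes a b :: real
  assumes "\<bar>a\<bar> \<le> C" "\<bar>b\<bar> \<le> C" "\<bar>a - b\<bar> \<le> \<rho>"
  shows "\<bar>a\<^sup>2 - b\<^sup>2\<bar> \<le> 2 * C * \<rho>"
proof -
  have "a\<^sup>2 - b\<^sup>2 = (a + b) * (a - b)" by (simp add: power2_eq_square algebra_simps)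
  then have "\<bar>a\<^sup>2 - b\<^sup>2\<bar> = \<bar>a + b\<bar> * \<bar>a - b\<bar>" by (simp add: abs_mult)
  also have "\<dots> \<le> (2 * C) * \<rho>" using assms by (intro mult_mono) auto
  finally show ?thesis .
qed

section \<open>The maximum principle for finitely many real modes\<close>

context decreasing_kernel
begin

text \<open>The equation is assumed in integrated form because \<open>v\<close> is merely
  continuous. Extending \<open>v\<close> into the past by its initial value makes v - v(0) vanish
  for s > t, so all times share the window (0,T]. If the bound fails, the right-hand side paired
  with the maximal average is strictly negative on a whole interval before the maximum, which
  \<open>averaged_max_contradiction\<close> excludes.\<close>

lemma maximum_principle:
  fixes v F :: "'i \<Rightarrow> real \<Rightarrow> real"
  assumes S: "finite S" and T: "0 < T" and \<kappa>: "0 < \<kappa>"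
    and vc: "\<And>i. i \<in> S \<Longrightarrow> continuous_on {0..T} (v i)"
    and Fc: "\<And>i. i \<in> S \<Longrightarrow> continuous_on {0..T} (F i)"
    and bc: "continuous_on {0..T} b"
    and low: "\<And>i t. i \<in> S \<Longrightarrow> t \<in> {0..T} \<Longrightarrow> \<kappa> \<le> b t * l i"
    and eq: "\<And>i t. i \<in> S \<Longrightarrow> t \<in> {0..T} \<Longrightarrow>
      (LINT s:{0<..T}|lborel. k s * (v i (max 0 (t - s)) - v i 0)) = integral {0..t} (\<lambda>\<tau>. F i \<tau> - b \<tau> * l i * v i \<tau>)"
    and init: "(\<Sum>i\<in>S. (v i 0)\<^sup>2) \<le> B"
    and source: "\<And>t. t \<in> {0..T} \<Longrightarrow> (\<Sum>i\<in>S. (F i t)\<^sup>2) \<le> \<kappa>\<^sup>2 * B"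
    and t: "t \<in> {0..T}"
  shows "(\<Sum>i\<in>S. (v i t)\<^sup>2) \<le> B"
proof (rule ccontr)
  assume neg: "\<not> (\<Sum>i\<in>S. (v i t)\<^sup>2) \<le> B"
  \<comment> \<open>The excess over B; every tolerance below is a fixed fraction of it, so that a
    definite negative amount survives the approximations.\<close>
  define \<gamma> where "\<gamma> = (\<Sum>i\<in>S. (v i t)\<^sup>2) - B"
  have \<gamma>: "0 < \<gamma>" using neg by (simp add: \<gamma>_def)
  \<comment> \<open>Clamping extends \<open>v\<close> continuously to the whole line, so that
    antiderivatives and averages exist without boundary cases.\<close>
  define V where "V i x = v i (max 0 (min T x))" for i x
  define r where "r i \<tau> = F i \<tau> - b \<tau> * l i * v i \<tau>" for i \<tau>
  define n where "n = real (card S)"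
  have n0: "0 \<le> n" by (simp add: n_def)
  have cl: "max 0 (min T x) \<in> {0..T}" for x using T by auto
  have Vv: "V i x = v i x" if "x \<in> {0..T}" for i x using that by (simp add: V_def)
  have rc: "continuous_on {0..T} (r i)" if "i \<in> S" for i
    unfolding r_def by (intro continuous_intros vc Fc bc that)
  obtain C where C: "C > 0" and Cv: "\<And>i x. i \<in> S \<Longrightarrow> x \<in> {0..T} \<Longrightarrow> \<bar>v i x\<bar> \<le> C"
    using continuous_on_interval_bounded_finite[OF S, where a = 0 and b = T and v = v] vc by blast
  have VC: "\<bar>V i x\<bar> \<le> C" if "i \<in> S" for i x
    unfolding V_def by (rule Cv[OF that cl])
  obtain K where K: "K > 0" and Kr: "\<And>i x. i \<in> S \<Longrightarrow> x \<in> {0..T} \<Longrightarrow> \<bar>r i x\<bar> \<le> K"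
    using continuous_on_interval_bounded_finite[OF S, where a = 0 and b = T and v = r] rc by blast
  define A where "A = n * (2 * C)"
  have A: "0 \<le> A" using n0 C by (simp add: A_def)
  \<comment> \<open>The first entry keeps the error A \<rho> of replacing the squared norm of
    \<open>V\<close> by that of its average below \<gamma> / 4. The second keeps the error n \<rho>
    K of the same replacement in the pairing with the right-hand side \<open>r\<close> below
    \<kappa> \<gamma> / 8.\<close>
  define \<rho> where "\<rho> = min (\<gamma> / (4 * A + 4)) (\<kappa> * \<gamma> / (8 * n * K + 8))"
  have nK: "0 \<le> n * K" using n0 K by simp
  have \<rho>: "0 < \<rho>" using \<gamma> \<kappa> A nK by (simp add: \<rho>_def add_nonneg_pos mult.assoc)
  have "\<rho> * (4 * A + 4) \<le> \<gamma>"
    using A \<gamma> unfolding \<rho>_def by (subst pos_le_divide_eq[symmetric]) auto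
  then have \<rho>A: "2 * (A * \<rho>) \<le> \<gamma> / 2" using \<rho> by (simp add: algebra_simps)
  have "\<rho> * (8 * n * K + 8) \<le> \<kappa> * \<gamma>"
    using nK \<gamma> \<kappa> unfolding \<rho>_def by (subst pos_le_divide_eq[symmetric]) (auto simp: mult.assoc)
  then have \<rho>K: "n * (\<rho> * K) \<le> \<kappa> * \<gamma> / 8" using \<rho> by (simp add: algebra_simps)
  have "\<exists>d>0. \<forall>x y. \<bar>x - y\<bar> < d \<longrightarrow> \<bar>V i x - V i y\<bar> < \<rho>" if "i \<in> S" for i
    unfolding V_def by (rule uniformly_continuous_on_clamp[OF less_imp_le[OF T] vc[OF that] \<rho>])
  then obtain d where d: "\<And>i. i \<in> S \<Longrightarrow> d i > 0"
    "\<And>i x y. i \<in> S \<Longrightarrow> \<bar>x - y\<bar> < d i \<Longrightarrow> \<bar>V i x - V i y\<bar> < \<rho>" by metis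
  \<comment> \<open>The equation will be used at times up to 2 \<delta> before the maximum: a step
    back from t0, then an average over another step. Dividing by 3 makes 2 \<delta> smaller than
    every modulus; the inserted 1 covers an empty S.\<close>
  define \<delta> where "\<delta> = Min (insert 1 (d ` S)) / 3"
  have \<delta>: "0 < \<delta>" using d(1) S by (simp add: \<delta>_def)
  have \<delta>d: "\<bar>V i x - V i y\<bar> < \<rho>" if "i \<in> S" "\<bar>x - y\<bar> \<le> 2 * \<delta>" for i x y
  proof (rule d(2)[OF that(1)])
    have "Min (insert 1 (d ` S)) \<le> d i" using S that(1) by (intro Min_le) auto
    then show "\<bar>x - y\<bar> < d i" using that(2) \<delta> by (simp add: \<delta>_def)
  qed
  have Vcont: "isCont (V i) x" if "i \<in> S" for i x
  proof -
    have "continuous_on UNIV (\<lambda>x. v i (max 0 (min T x)))"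
      by (rule continuous_on_compose2[OF vc[OF that]]) (use T in \<open>auto intro!: continuous_intros\<close>)
    then show ?thesis by (simp add: V_def[abs_def] continuous_on_eq_continuous_at)
  qed
  have "\<exists>W. \<forall>x. (W has_real_derivative V i x) (at x)" if "i \<in> S" for i
    using einterval_antiderivative[of "- \<infinity>" "\<infinity>" "V i"] Vcont[OF that]
    by (auto simp: has_real_derivative_iff_has_vector_derivative)
  then obtain W where W: "\<And>i x. i \<in> S \<Longrightarrow> (W i has_real_derivative V i x) (at x)" by metis
  define y where "y i t = (W i t - W i (t - \<delta>)) / \<delta>" for i t
  have mvt: "\<exists>\<xi>. x - \<delta> < \<xi> \<and> \<xi> < x \<and> y i x = V i \<xi>" if i: "i \<in> S" for i x
  proof -
    have "\<exists>\<xi>. x - \<delta> < \<xi> \<and> \<xi> < x \<and> W i x - W i (x - \<delta>) = (x - (x - \<delta>)) * V i \<xi>"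
      by (rule MVT2) (use \<delta> W[OF i] in auto)
    then show ?thesis using \<delta> by (auto simp: y_def)
  qed
  have yV: "\<bar>y i x - V i z\<bar> \<le> \<rho>" if iS: "i \<in> S" and z: "z \<in> {x - 2 * \<delta>..x}" for i x z
  proof -
    obtain \<xi> where \<xi>: "x - \<delta> < \<xi>" "\<xi> < x" "y i x = V i \<xi>" using mvt[OF iS] by blast
    have "\<bar>\<xi> - z\<bar> \<le> 2 * \<delta>" using \<xi>(1,2) z by (auto simp: abs_le_iff)
    then show ?thesis using \<delta>d[OF iS, of \<xi> z] \<xi>(3) by simp
  qed
  have yC: "\<bar>y i x\<bar> \<le> C" if "i \<in> S" for i x
    using mvt[OF that, of x] VC[OF that] by auto
  have y0: "y i x = v i 0" if "i \<in> S" "x \<le> 0" for i x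
    using mvt[OF that(1), of x] that(2) T by (auto simp: V_def)
  define Nd where "Nd x = (\<Sum>i\<in>S. (y i x)\<^sup>2)" for x
  define N where "N x = (\<Sum>i\<in>S. (V i x)\<^sup>2)" for x
  have NdN: "\<bar>Nd x - N z\<bar> \<le> A * \<rho>" if "z \<in> {x - 2 * \<delta>..x}" for x z
  proof -
    have "\<bar>Nd x - N z\<bar> \<le> (\<Sum>i\<in>S. \<bar>(y i x)\<^sup>2 - (V i z)\<^sup>2\<bar>)"
      unfolding Nd_def N_def sum_subtractf[symmetric] by (rule sum_abs)
    also have "\<dots> \<le> (\<Sum>i\<in>S. 2 * C * \<rho>)"
      by (intro sum_mono abs_power2_diff_le yC VC yV that)
    finally show ?thesis by (simp add: A_def n_def mult_ac)
  qed
  have "continuous_on UNIV (W i)" if "i \<in> S" for i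
    using W[OF that] by (auto intro: DERIV_isCont simp: continuous_on_eq_continuous_at)
  note Wcont = this
  have "continuous_on {0..T} (y i)" if i: "i \<in> S" for i
  proof -
    have "continuous_on {0..T} (\<lambda>x. W i (x - \<delta>))"
      by (rule continuous_on_compose2[OF Wcont[OF i]]) (auto intro!: continuous_intros)
    moreover have "continuous_on {0..T} (W i)" by (rule continuous_on_subset[OF Wcont[OF i]]) simp
    ultimately show ?thesis unfolding y_def using \<delta> by (intro continuous_intros) auto
  qed
  then have "continuous_on {0..T} Nd"
    unfolding Nd_def by (intro continuous_intros)
  then obtain t0 where t0: "t0 \<in> {0..T}" and t0max: "\<And>x. x \<in> {0..T} \<Longrightarrow> Nd x \<le> Nd t0"
    using continuous_attains_sup[of "{0..T}" Nd] T by auto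
  have Ndmax: "Nd x \<le> Nd t0" if "x \<le> t0" for x
  proof (cases "x \<le> 0")
    case True
    then have "Nd x = Nd 0" using y0 by (simp add: Nd_def)
    then show ?thesis using t0max[of 0] T by simp
  qed (use that t0 t0max in auto)
  have N_t: "N t = B + \<gamma>" using t by (simp add: N_def Vv \<gamma>_def)
  \<comment> \<open>Three comparisons: from N to Nd at t, from Nd at t to its maximum, and from
    there back to N at z. The first and the last cost A \<rho> each, together at most \<gamma> /
    2.\<close>
  have Nlow: "B + \<gamma> / 2 \<le> N z" if "z \<in> {t0 - 2 * \<delta>..t0}" for z
    using NdN[of t t] NdN[OF that] t0max[OF t] N_t \<rho>A \<delta> by auto
  \<comment> \<open>Otherwise the left end of the window would lie at or before time 0, where
    \<open>V\<close> has its initial value and a squared norm of at most B. Hence the window lies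
    where the equation holds.\<close>
  have t0pos: "0 < t0 - 2 * \<delta>"
  proof (rule ccontr)
    assume "\<not> 0 < t0 - 2 * \<delta>"
    then have "N (t0 - 2 * \<delta>) = (\<Sum>i\<in>S. (v i 0)\<^sup>2)" using T by (simp add: N_def V_def)
    then show False using Nlow[of "t0 - 2 * \<delta>"] init \<gamma> \<delta> by simp
  qed
  \<comment> \<open>With the value of \<open>V\<close> at the same time in place of the average, F V
    \<le> \<kappa>/2 V^2 + F^2/(2 \<kappa>) leaves at most \<kappa>/2 (B - (B + \<gamma>/2)) = -
    \<kappa> \<gamma> / 4; the replacement gives back at most \<kappa> \<gamma> / 8.\<close>
  have rneg: "(\<Sum>i\<in>S. y i t0 * r i \<tau>) \<le> - (\<kappa> * \<gamma> / 8)" if \<tau>: "\<tau> \<in> {t0 - 2 * \<delta>..t0}" for \<tau>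
  proof -
    have \<tau>T: "\<tau> \<in> {0..T}" using \<tau> t0pos t0 by auto
    have "(\<Sum>i\<in>S. y i t0 * r i \<tau>) \<le> (\<Sum>i\<in>S. \<kappa> / 2 * ((F i \<tau>)\<^sup>2 / \<kappa>\<^sup>2 - (V i \<tau>)\<^sup>2) + \<rho> * K)"
    proof (rule sum_mono)
      fix i assume i: "i \<in> S"
      have "(y i t0 - V i \<tau>) * r i \<tau> \<le> \<bar>y i t0 - V i \<tau>\<bar> * \<bar>r i \<tau>\<bar>"
        by (simp add: abs_mult[symmetric])
      also have "\<dots> \<le> \<rho> * K" using yV[OF i \<tau>] Kr[OF i \<tau>T] \<rho> by (intro mult_mono) auto
      finally have 1: "y i t0 * r i \<tau> \<le> V i \<tau> * r i \<tau> + \<rho> * K" by (simp add: algebra_simps)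
      have "\<kappa> * (V i \<tau>)\<^sup>2 \<le> b \<tau> * l i * (V i \<tau>)\<^sup>2"
        by (intro mult_right_mono low i \<tau>T) simp
      then have "V i \<tau> * r i \<tau> \<le> V i \<tau> * F i \<tau> - \<kappa> * (V i \<tau>)\<^sup>2"
        using \<tau>T by (simp add: r_def Vv algebra_simps power2_eq_square)
      moreover have "V i \<tau> * F i \<tau> \<le> \<kappa> / 2 * (V i \<tau>)\<^sup>2 + \<kappa> / 2 * ((F i \<tau>)\<^sup>2 / \<kappa>\<^sup>2)"
      proof -
        have "0 \<le> \<kappa> / 2 * (V i \<tau> - F i \<tau> / \<kappa>)\<^sup>2" using \<kappa> by simp
        also have "\<dots> = \<kappa> / 2 * (V i \<tau>)\<^sup>2 + \<kappa> / 2 * ((F i \<tau>)\<^sup>2 / \<kappa>\<^sup>2) - V i \<tau> * F i \<tau>"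
          using \<kappa> by (simp add: power2_eq_square field_simps)
        finally show ?thesis by simp
      qed
      ultimately show "y i t0 * r i \<tau> \<le> \<kappa> / 2 * ((F i \<tau>)\<^sup>2 / \<kappa>\<^sup>2 - (V i \<tau>)\<^sup>2) + \<rho> * K"
        using 1 by (simp add: right_diff_distrib)
    qed
    also have "\<dots> = \<kappa> / 2 * ((\<Sum>i\<in>S. (F i \<tau>)\<^sup>2) / \<kappa>\<^sup>2 - N \<tau>) + n * (\<rho> * K)"
      by (simp add: sum.distrib sum_distrib_left[symmetric] sum_subtractf sum_divide_distrib[symmetric] N_def n_def)
    also have "\<dots> \<le> \<kappa> / 2 * (B - (B + \<gamma> / 2)) + \<kappa> * \<gamma> / 8"
      using \<kappa> source[OF \<tau>T] Nlow[OF \<tau>] \<rho>K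
      by (intro add_mono mult_left_mono diff_mono) (auto simp: divide_le_eq mult.commute)
    finally show ?thesis by (simp add: mult.commute)
  qed
  have Wc: "((\<lambda>x. \<Sum>i\<in>S. y i t0 * W i x) has_real_derivative (\<Sum>i\<in>S. y i t0 * V i x)) (at x)" for x
    by (intro DERIV_sum DERIV_cmult W)
  have avg: "((\<Sum>i\<in>S. y i t0 * W i x) - (\<Sum>i\<in>S. y i t0 * W i (x - \<delta>))) / \<delta> = (\<Sum>i\<in>S. y i t0 * y i x)" for x
    by (simp add: y_def[of _ x] sum_subtractf[symmetric] sum_divide_distrib right_diff_distrib)
  show False
  proof (rule averaged_max_contradiction[OF Wc _ \<delta>, where c = "\<kappa> * \<gamma> / 8" and C = "n * (C * C)" and ?t0.0 = t0
        and T = T and ?u0.0 = "\<Sum>i\<in>S. y i t0 * v i 0"])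
    show "0 < \<kappa> * \<gamma> / 8" using \<kappa> \<gamma> by simp
    show "\<bar>\<Sum>i\<in>S. y i t0 * V i x\<bar> \<le> n * (C * C)" for x
    proof -
      have "\<bar>\<Sum>i\<in>S. y i t0 * V i x\<bar> \<le> (\<Sum>i\<in>S. \<bar>y i t0 * V i x\<bar>)" by (rule sum_abs)
      also have "\<dots> \<le> (\<Sum>i\<in>S. C * C)"
        unfolding abs_mult using C by (intro sum_mono mult_mono yC VC) auto
      finally show ?thesis by (simp add: n_def)
    qed
    \<comment> \<open>The norm of the average is maximal at t0 among all earlier times, negative
      ones included since the average is constant there. The inequality 2 p q \<le> p^2 + q^2
      transfers this to the pairing with the fixed vector y(t0).\<close>
    show "((\<Sum>i\<in>S. y i t0 * W i x) - (\<Sum>i\<in>S. y i t0 * W i (x - \<delta>))) / \<delta>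
        \<le> ((\<Sum>i\<in>S. y i t0 * W i t0) - (\<Sum>i\<in>S. y i t0 * W i (t0 - \<delta>))) / \<delta>" if "x \<le> t0" for x
    proof -
      have "(\<Sum>i\<in>S. y i t0 * y i x) \<le> (\<Sum>i\<in>S. ((y i t0)\<^sup>2 + (y i x)\<^sup>2) / 2)"
      proof (rule sum_mono)
        fix i
        show "y i t0 * y i x \<le> ((y i t0)\<^sup>2 + (y i x)\<^sup>2) / 2"
          using sum_squares_bound[of "y i t0" "y i x"] by simp
      qed
      also have "\<dots> = (Nd t0 + Nd x) / 2" by (simp add: Nd_def sum.distrib sum_divide_distrib[symmetric])
      also have "\<dots> \<le> Nd t0" using Ndmax[OF that] by simp
      also have "\<dots> = (\<Sum>i\<in>S. y i t0 * y i t0)" by (simp add: Nd_def power2_eq_square)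
      finally show ?thesis unfolding avg .
    qed
    fix \<xi> assume \<xi>: "t0 - \<delta> \<le> \<xi>" "\<xi> \<le> t0"
    have conv: "(LINT s:{0<..T}|lborel. k s * ((\<Sum>i\<in>S. y i t0 * V i (x - s)) - (\<Sum>i\<in>S. y i t0 * v i 0)))
        = (\<Sum>i\<in>S. y i t0 * integral {0..x} (r i))" if x: "x \<in> {0..T}" for x
    proof -
      have Vm: "V i \<in> borel_measurable borel" if "i \<in> S" for i
        using Vcont[OF that] by (intro borel_measurable_continuous_onI) (simp add: continuous_on_eq_continuous_at)
      have int: "set_integrable lborel {0<..T} (\<lambda>s. k s * (V i (x - s) - v i 0))" if "i \<in> S" for i
      proof (rule kernel_mult_integrable)
        show "(\<lambda>s. V i (x - s) - v i 0) \<in> borel_measurable borel" using Vm[OF that] by measurable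
        show "\<bar>V i (x - s) - v i 0\<bar> \<le> C + \<bar>v i 0\<bar>" for s using VC[OF that, of "x - s"] by linarith
      qed
      have "(LINT s:{0<..T}|lborel. k s * ((\<Sum>i\<in>S. y i t0 * V i (x - s)) - (\<Sum>i\<in>S. y i t0 * v i 0)))
        = (LINT s:{0<..T}|lborel. (\<Sum>i\<in>S. y i t0 * (k s * (V i (x - s) - v i 0))))"
        by (intro arg_cong[where f = "set_lebesgue_integral lborel {0<..T}"] ext)
           (simp add: sum_subtractf[symmetric] sum_distrib_left algebra_simps)
      also have "\<dots> = (\<Sum>i\<in>S. (LINT s:{0<..T}|lborel. y i t0 * (k s * (V i (x - s) - v i 0))))"
        unfolding set_lebesgue_integral_def scaleR_sum_right
      proof (rule Bochner_Integration.integral_sum)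
        fix i assume i: "i \<in> S"
        show "integrable lborel (\<lambda>s. indicator {0<..T} s *\<^sub>R (y i t0 * (k s * (V i (x - s) - v i 0))))"
          using integrable_mult_right[OF int[OF i, unfolded set_integrable_def], of "y i t0"]
          by (simp add: mult_ac)
      qed
      also have "\<dots> = (\<Sum>i\<in>S. y i t0 * (LINT s:{0<..T}|lborel. k s * (V i (x - s) - v i 0)))"
        by simp
      also have "\<dots> = (\<Sum>i\<in>S. y i t0 * integral {0..x} (r i))"
      proof (rule sum.cong[OF refl])
        fix i assume i: "i \<in> S"
        have "(LINT s:{0<..T}|lborel. k s * (V i (x - s) - v i 0)) = (LINT s:{0<..T}|lborel. k s * (v i (max 0 (x - s)) - v i 0))"
          using x by (intro set_lebesgue_integral_cong) (auto simp: V_def)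
        then show "y i t0 * (LINT s:{0<..T}|lborel. k s * (V i (x - s) - v i 0)) = y i t0 * integral {0..x} (r i)"
          using eq[OF i x] by (simp add: r_def[abs_def])
      qed
      finally show ?thesis .
    qed
    have x1: "\<xi> \<in> {0..T}" and x2: "\<xi> - \<delta> \<in> {0..T}" using \<xi> t0 t0pos \<delta> by auto
    have rint: "r i integrable_on {0..\<xi>}" "r i integrable_on {\<xi> - \<delta>..\<xi>}" if "i \<in> S" for i
      using x1 x2 by (auto intro!: integrable_continuous_interval continuous_on_subset[OF rc[OF that]])
    have "(\<Sum>i\<in>S. y i t0 * integral {0..\<xi>} (r i)) - (\<Sum>i\<in>S. y i t0 * integral {0..\<xi> - \<delta>} (r i))
        = (\<Sum>i\<in>S. y i t0 * integral {\<xi> - \<delta>..\<xi>} (r i))"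
    proof -
      have "integral {0..\<xi>} (r i) = integral {0..\<xi> - \<delta>} (r i) + integral {\<xi> - \<delta>..\<xi>} (r i)" if "i \<in> S" for i
        using x2 \<delta> rint(1)[OF that]
        by (intro Henstock_Kurzweil_Integration.integral_combine[symmetric]) auto
      then show ?thesis by (simp add: sum_subtractf[symmetric] algebra_simps)
    qed
    also have "\<dots> = integral {\<xi> - \<delta>..\<xi>} (\<lambda>\<tau>. \<Sum>i\<in>S. y i t0 * r i \<tau>)"
      using S rint(2) by (subst integral_sum) (auto intro!: integrable_on_mult_right)
    also have "\<dots> \<le> integral {\<xi> - \<delta>..\<xi>} (\<lambda>\<tau>. - (\<kappa> * \<gamma> / 8))"
      using S rint(2) \<xi> \<delta>
      by (intro integral_le integrable_sum integrable_on_mult_right rneg) auto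
    also have "\<dots> = - (\<kappa> * \<gamma> / 8) * \<delta>" using \<delta> by simp
    finally show "(LINT s:{0<..T}|lborel. k s * ((\<Sum>i\<in>S. y i t0 * V i (\<xi> - s)) - (\<Sum>i\<in>S. y i t0 * v i 0))) -
          (LINT s:{0<..T}|lborel. k s * ((\<Sum>i\<in>S. y i t0 * V i (\<xi> - \<delta> - s)) - (\<Sum>i\<in>S. y i t0 * v i 0)))
        \<le> - (\<kappa> * \<gamma> / 8) * \<delta>"
      using conv[OF x1] conv[OF x2] by (simp add: diff_diff_eq)
  qed
qed

end

section \<open>The Caputo-type derivative as an integral equation\<close>

text \<open>The compact sets in \<open>admissible_kernel\<close> stay away from 0, so integrability
  up to 0 comes from the Laplace integrand at p = 1, whose weight exp(-t) is undone by exp(t) \<le>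
  exp(r).\<close>

lemma admissible_kernel_integrable:
  assumes g: "admissible_kernel g"
  shows "set_integrable lborel {0<..r} g"
proof -
  have "\<forall>p>0. set_integrable lborel {0<..} (\<lambda>t. exp (- p * t) * g t)"
    using g unfolding admissible_kernel_def by (elim conjE)
  from this[rule_format, of 1] have "set_integrable lborel {0<..} (\<lambda>t. exp (- t) * g t)" by simp
  then have e: "set_integrable lborel {0<..r} (\<lambda>t. exp (- t) * g t)"
    by (rule set_integrable_subset) auto
  let ?e = "\<lambda>t. indicator {0<..r} t *\<^sub>R (exp (- t) * g t)"
  have em[measurable]: "?e \<in> borel_measurable borel"
    using e by (simp add: set_integrable_def borel_measurable_integrable)
  have eq: "indicator {0<..r} t *\<^sub>R g t = exp t * ?e t" for t
    by (simp add: exp_minus)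
  show ?thesis
    unfolding set_integrable_def eq
  proof (rule Bochner_Integration.integrable_bound[where f = "\<lambda>t. exp r * ?e t"])
    show "integrable lborel (\<lambda>t. exp r * ?e t)"
      using e by (auto simp: set_integrable_def)
    show "AE t in lborel. norm (exp t * ?e t) \<le> norm (exp r * ?e t)"
    proof (rule AE_I2)
      fix t
      show "norm (exp t * ?e t) \<le> norm (exp r * ?e t)"
      proof (cases "t \<le> r")
        case True
        then show ?thesis
          unfolding norm_mult by (intro mult_right_mono) auto
      qed (simp add: indicator_def)
    qed
  qed measurable
qed

lemma admissible_kernel_decreasing_kernel:
  assumes g: "admissible_kernel g"
  obtains k where "decreasing_kernel k" "AE t in lborel. 0 < t \<longrightarrow> g t = k t"
proof -
  obtain k where k: "k \<in> borel_measurable borel" "\<And>t. 0 \<le> k t"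
    "\<And>s t. 0 < s \<Longrightarrow> s \<le> t \<Longrightarrow> k t \<le> k s" and ae: "AE t in lborel. 0 < t \<longrightarrow> g t = k t"
    by (rule admissible_kernel_AE_monotone[OF g]) blast
  have "set_integrable lborel {0<..r} k" for r
    unfolding set_integrable_def
  proof (rule Bochner_Integration.integrable_cong_AE_imp)
    show "integrable lborel (\<lambda>t. indicator {0<..r} t *\<^sub>R g t)"
      using admissible_kernel_integrable[OF g, of r] by (simp add: set_integrable_def)
    show "AE t in lborel. indicator {0<..r} t *\<^sub>R g t = indicator {0<..r} t *\<^sub>R k t"
      using ae by eventually_elim (auto simp: indicator_def)
  qed (use k(1) in measurable)
  with k have "decreasing_kernel k" by unfold_locales auto
  then show ?thesis using ae by (rule that)
qed

lemma set_integrable_scaleR_bounded: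
  fixes g :: "real \<Rightarrow> real" and f :: "real \<Rightarrow> complex"
  assumes g: "set_integrable lborel {0<..r} g"
    and [measurable]: "f \<in> borel_measurable borel" and B: "\<And>s. norm (f s) \<le> B"
  shows "set_integrable lborel {0..r} (\<lambda>s. g s *\<^sub>R f s)"
    and "norm (LINT s:{0..r}|lborel. g s *\<^sub>R f s) \<le> B * (LINT s:{0<..r}|lborel. \<bar>g s\<bar>)"
proof -
  let ?g = "\<lambda>s. indicator {0<..r} s *\<^sub>R g s"
  have gi: "integrable lborel ?g" using g by (simp add: set_integrable_def)
  then have gm[measurable]: "?g \<in> borel_measurable borel" by (simp add: borel_measurable_integrable)
  have i: "integrable lborel (\<lambda>s. ?g s *\<^sub>R f s)"
  proof (rule Bochner_Integration.integrable_bound[where f = "\<lambda>s. B * ?g s"])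
    show "integrable lborel (\<lambda>s. B * ?g s)"
      by (rule integrable_mult_right[OF gi])
    show "AE s in lborel. norm (?g s *\<^sub>R f s) \<le> norm (B * ?g s)"
    proof (rule AE_I2)
      fix s
      have "norm (?g s *\<^sub>R f s) = \<bar>?g s\<bar> * norm (f s)" by simp
      also have "\<dots> \<le> \<bar>?g s\<bar> * \<bar>B\<bar>" using B[of s] by (intro mult_left_mono) auto
      finally show "norm (?g s *\<^sub>R f s) \<le> norm (B * ?g s)" by (simp add: abs_mult mult_ac)
    qed
  qed measurable
  have ae: "AE s in lborel. ?g s *\<^sub>R f s = indicator {0..r} s *\<^sub>R (g s *\<^sub>R f s)"
    using AE_lborel_singleton[of 0] by eventually_elim (auto simp: indicator_def)
  \<comment> \<open>The value of \<open>g\<close> at 0 is arbitrary and \<open>g\<close> is known to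
    be measurable only on (0,r]. Adding the point 0 as an explicit null function gives measurability
    on the closed interval.\<close>
  have "integrable lborel (\<lambda>s. ?g s *\<^sub>R f s + indicator {0} s *\<^sub>R (if 0 \<le> r then g 0 *\<^sub>R f 0 else 0))"
    by (intro Bochner_Integration.integrable_add i) simp
  moreover have "(\<lambda>s. ?g s *\<^sub>R f s + indicator {0} s *\<^sub>R (if 0 \<le> r then g 0 *\<^sub>R f 0 else 0)) =
      (\<lambda>s. indicator {0..r} s *\<^sub>R (g s *\<^sub>R f s))"
    by (auto simp: fun_eq_iff indicator_def)
  ultimately have si: "integrable lborel (\<lambda>s. indicator {0..r} s *\<^sub>R (g s *\<^sub>R f s))" by simp
  then show "set_integrable lborel {0..r} (\<lambda>s. g s *\<^sub>R f s)" by (simp add: set_integrable_def)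
  have "(LINT s:{0..r}|lborel. g s *\<^sub>R f s) = (LINT s|lborel. ?g s *\<^sub>R f s)"
    unfolding set_lebesgue_integral_def using ae si i
    by (intro integral_cong_AE) (auto simp: borel_measurable_integrable)
  also have "norm \<dots> \<le> (LINT s|lborel. norm (?g s *\<^sub>R f s))"
    by (rule integral_norm_bound)
  also have "\<dots> \<le> (LINT s|lborel. B * norm (?g s))"
  proof (intro integral_mono integrable_norm i integrable_mult_right gi)
    fix s
    show "norm (?g s *\<^sub>R f s) \<le> B * norm (?g s)"
      using mult_left_mono[OF B[of s], of "\<bar>?g s\<bar>"] by (simp add: mult.commute)
  qed
  also have "\<dots> = B * (LINT s:{0<..r}|lborel. \<bar>g s\<bar>)"
    by (simp add: set_lebesgue_integral_def abs_mult)
  finally show "norm (LINT s:{0..r}|lborel. g s *\<^sub>R f s) \<le> B * (LINT s:{0<..r}|lborel. \<bar>g s\<bar>)" .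
qed

text \<open>Only the values of \<open>g\<close> up to a null set survive the integration of the equation.\<close>

lemma caputo_integral_equation:
  fixes v R :: "real \<Rightarrow> complex"
  assumes T: "0 < T" and g: "admissible_kernel g"
    and k: "decreasing_kernel k" and ae: "AE t in lborel. 0 < t \<longrightarrow> g t = k t"
    and vc: "continuous_on {0..T} v"
    and caputo: "\<And>t. t \<in> {0<..T} \<Longrightarrow> has_caputo T g v (R t) t"
    and t: "t \<in> {0..T}"
  shows "(LINT s:{0<..T}|lborel. k s *\<^sub>R (v (max 0 (t - s)) - v 0)) = integral {0..t} R"
    and "R integrable_on {0..t}"
proof -
  interpret decreasing_kernel k by (rule k)
  have gi: "set_integrable lborel {0<..r} g" for r
    by (rule admissible_kernel_integrable[OF g])
  define v' where "v' x = v (max 0 (min T x))" for x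
  have v'c: "continuous_on UNIV v'"
    unfolding v'_def by (rule continuous_on_compose2[OF vc]) (use T in \<open>auto intro!: continuous_intros\<close>)
  then have v'm[measurable]: "v' \<in> borel_measurable borel" by (rule borel_measurable_continuous_onI)
  have "bounded (v ` {0..T})"
    by (intro compact_imp_bounded compact_continuous_image vc) simp
  then obtain C where "\<And>x. x \<in> {0..T} \<Longrightarrow> norm (v x) \<le> C"
    unfolding bounded_iff by force
  then have C: "norm (v' x) \<le> C" for x using T by (simp add: v'_def)
  have C0: "0 \<le> C" using C[of 0] norm_ge_zero order_trans by blast
  define \<Gamma> where "\<Gamma> r = (LINT \<tau>:{0..r}|lborel. g (r - \<tau>) *\<^sub>R v \<tau>)" for r
  have \<Gamma>: "\<Gamma> r = (LINT s:{0..r}|lborel. g s *\<^sub>R v' (r - s))" if "r \<le> T" for r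
  proof -
    have "\<Gamma> r = (LINT s|lborel. indicator {0..r} (r - s) *\<^sub>R (g s *\<^sub>R v (r - s)))"
      using lborel_integral_real_affine[of "- 1" "\<lambda>\<tau>. indicator {0..r} \<tau> *\<^sub>R (g (r - \<tau>) *\<^sub>R v \<tau>)" r]
      by (simp add: \<Gamma>_def set_lebesgue_integral_def)
    also have "\<dots> = (LINT s:{0..r}|lborel. g s *\<^sub>R v' (r - s))"
      unfolding set_lebesgue_integral_def using that
      by (intro Bochner_Integration.integral_cong) (auto simp: indicator_def v'_def)
    finally show ?thesis .
  qed
  have deriv: "(\<Gamma> has_vector_derivative R x + g x *\<^sub>R v 0) (at x within {0..T})" if "x \<in> {0<..T}" for x
    using caputo[OF that] unfolding has_caputo_def \<Gamma>_def by auto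
  have \<Gamma>0: "\<Gamma> 0 = 0"
  proof -
    have "norm (\<Gamma> 0) \<le> C * (LINT s:{0<..0}|lborel. \<bar>g s\<bar>)"
      using set_integrable_scaleR_bounded(2)[OF gi, of "\<lambda>s. v' (0 - s)" C 0] C T by (simp add: \<Gamma>)
    then show ?thesis by (simp add: set_lebesgue_integral_def)
  qed
  \<comment> \<open>On (0,T] continuity follows from the derivative. No derivative is available at
    0, where the bound of \<open>\<Gamma>\<close> by C times the kernel mass of (0,r] takes over;
    this is what allows the fundamental theorem of calculus down to 0.\<close>
  have "continuous_on {0..T} \<Gamma>"
    unfolding continuous_on_eq_continuous_within
  proof
    fix x assume x: "x \<in> {0..T}"
    show "continuous (at x within {0..T}) \<Gamma>"
    proof (cases "x = 0")
      case False
      then show ?thesis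
        using deriv[of x] x has_vector_derivative_continuous by fastforce
    next
      case True
      have "((\<lambda>r. C * (LINT s:{0<..r}|lborel. k s)) \<longlongrightarrow> C * 0) (at_right 0)"
        by (intro tendsto_intros kernel_integral_tendsto_0)
      moreover have "\<forall>\<^sub>F r in at_right 0. norm (\<Gamma> r) \<le> C * (LINT s:{0<..r}|lborel. k s)"
        using eventually_at_right_real[OF T]
      proof eventually_elim
        case (elim r)
        have "norm (\<Gamma> r) \<le> C * (LINT s:{0<..r}|lborel. \<bar>g s\<bar>)"
          using set_integrable_scaleR_bounded(2)[OF gi, of "\<lambda>s. v' (r - s)" C r] C elim
          by (simp add: \<Gamma>)
        also have "(LINT s:{0<..r}|lborel. \<bar>g s\<bar>) = (LINT s:{0<..r}|lborel. k s)"
          unfolding set_lebesgue_integral_def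
        proof (rule integral_cong_AE)
          show "AE s in lborel. indicator {0<..r} s *\<^sub>R \<bar>g s\<bar> = indicator {0<..r} s *\<^sub>R k s"
            using ae by eventually_elim (auto simp: indicator_def kernel_nonneg)
          show "(\<lambda>s. indicator {0<..r} s *\<^sub>R \<bar>g s\<bar>) \<in> borel_measurable lborel"
            using set_integrable_abs[OF gi] by (auto simp: set_integrable_def)
        qed measurable
        finally show ?case .
      qed
      ultimately have "(\<Gamma> \<longlongrightarrow> 0) (at_right 0)"
        by (simp add: Lim_null_comparison)
      then show ?thesis
        using True T by (simp add: continuous_within \<Gamma>0 at_within_Icc_at_right)
    qed
  qed
  then have \<Gamma>c: "continuous_on {0..t} \<Gamma>"
    by (rule continuous_on_subset) (use t in auto)
  have "((\<lambda>x. R x + g x *\<^sub>R v 0) has_integral (\<Gamma> t - \<Gamma> 0)) {0..t}"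
  proof (rule fundamental_theorem_of_calculus_interior[OF _ \<Gamma>c])
    fix x assume "x \<in> {0<..<t}"
    then have "x \<in> {0<..T}" "x \<in> interior {0..T}" using t by auto
    then show "(\<Gamma> has_vector_derivative R x + g x *\<^sub>R v 0) (at x)"
      using deriv[of x] by (metis at_within_interior)
  qed (use t in auto)
  note int\<Gamma> = this
  have gint: "set_integrable lborel {0..t} (\<lambda>s. g s *\<^sub>R v 0)"
    by (rule set_integrable_scaleR_bounded(1)[OF gi, where B = "norm (v 0)"]) simp_all
  have "((\<lambda>s. g s *\<^sub>R v 0) has_integral (LINT s:{0..t}|lborel. g s *\<^sub>R v 0)) {0..t}"
    unfolding set_borel_integral_eq_integral(2)[OF gint]
    by (rule integrable_integral[OF set_borel_integral_eq_integral(1)[OF gint]])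
  from has_integral_diff[OF int\<Gamma> this]
  have R: "(R has_integral (\<Gamma> t - (LINT s:{0..t}|lborel. g s *\<^sub>R v 0))) {0..t}"
    by (simp add: \<Gamma>0)
  then show "R integrable_on {0..t}" by (rule has_integral_integrable)
  have gint': "set_integrable lborel {0..t} (\<lambda>s. g s *\<^sub>R v' (t - s))"
    by (rule set_integrable_scaleR_bounded(1)[OF gi, where B = C]) (simp_all add: C)
  have "integral {0..t} R = \<Gamma> t - (LINT s:{0..t}|lborel. g s *\<^sub>R v 0)"
    using R by (rule integral_unique)
  also have "\<dots> = (LINT s:{0..t}|lborel. g s *\<^sub>R v' (t - s) - g s *\<^sub>R v 0)"
    using t by (simp add: \<Gamma> set_integral_diff(2)[OF gint' gint])
  \<comment> \<open>For t < s \<le> T the clamped argument is 0 and the integrand vanishes, so [0,t]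
    may be enlarged to a window independent of t.\<close>
  also have "\<dots> = (LINT s:{0<..T}|lborel. k s *\<^sub>R (v (max 0 (t - s)) - v 0))"
    unfolding set_lebesgue_integral_def
  proof (rule integral_cong_AE)
    show "(\<lambda>s. indicator {0..t} s *\<^sub>R (g s *\<^sub>R v' (t - s) - g s *\<^sub>R v 0)) \<in> borel_measurable lborel"
      using set_integral_diff(1)[OF gint' gint] by (simp add: set_integrable_def borel_measurable_integrable)
    have eq: "indicator {0<..T} s *\<^sub>R (k s *\<^sub>R (v (max 0 (t - s)) - v 0)) =
        indicator {0<..T} s *\<^sub>R (k s *\<^sub>R (v' (t - s) - v 0))" for s
      using t by (cases "s \<in> {0<..T}") (simp_all add: v'_def)
    show "(\<lambda>s. indicator {0<..T} s *\<^sub>R (k s *\<^sub>R (v (max 0 (t - s)) - v 0))) \<in> borel_measurable lborel"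
      unfolding eq by measurable
    show "AE s in lborel. indicator {0..t} s *\<^sub>R (g s *\<^sub>R v' (t - s) - g s *\<^sub>R v 0) =
        indicator {0<..T} s *\<^sub>R (k s *\<^sub>R (v (max 0 (t - s)) - v 0))"
      using ae AE_lborel_singleton[of 0]
    proof eventually_elim
      case (elim s)
      consider "s < 0" | "0 < s" "s \<le> t" | "t < s" using elim by linarith
      then show ?case
      proof cases
        case 2
        then have "g s = k s" "v' (t - s) = v (max 0 (t - s))" "s \<in> {0..t}" "s \<in> {0<..T}"
          using elim t by (simp_all add: v'_def)
        then show ?thesis by (simp add: scaleR_diff_right)
      qed (use t in simp_all)
    qed
  qed
  finally show "(LINT s:{0<..T}|lborel. k s *\<^sub>R (v (max 0 (t - s)) - v 0)) = integral {0..t} R" by simp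
qed

section \<open>Square summable functions on the lattice\<close>

lemma ell2_vanishes: "u \<in> ell2 h \<Longrightarrow> x \<notin> lattice h \<Longrightarrow> u x = 0"
  by (simp add: ell2_def)

lemma ell2_summable: "u \<in> ell2 h \<Longrightarrow> (\<lambda>x. (cmod (u x))\<^sup>2) summable_on lattice h"
  by (simp add: ell2_def)

lemma ell2_zero: "(\<lambda>x. 0) \<in> ell2 h"
  by (simp add: ell2_def)

lemma ell2_scale:
  assumes "u \<in> ell2 h"
  shows "(\<lambda>x. c * u x) \<in> ell2 h"
  using assms summable_on_cmult_right[of "\<lambda>x. (cmod (u x))\<^sup>2" "lattice h" "(cmod c)\<^sup>2"]
  by (simp add: ell2_def norm_mult power_mult_distrib)

lemma norm_add_power2_le:
  fixes a b :: "'a::real_normed_vector"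
  shows "(norm (a + b))\<^sup>2 \<le> 2 * (norm a)\<^sup>2 + 2 * (norm b)\<^sup>2"
proof -
  have "(norm (a + b))\<^sup>2 \<le> (norm a + norm b)\<^sup>2"
    by (intro power_mono norm_triangle_ineq) simp
  also have "\<dots> \<le> 2 * (norm a)\<^sup>2 + 2 * (norm b)\<^sup>2"
    using sum_squares_bound[of "norm a" "norm b"] by (simp add: power2_sum)
  finally show ?thesis .
qed

lemma ell2_add:
  assumes "u \<in> ell2 h" "v \<in> ell2 h"
  shows "(\<lambda>x. u x + v x) \<in> ell2 h"
proof -
  have "(\<lambda>x. 2 * (cmod (u x))\<^sup>2 + 2 * (cmod (v x))\<^sup>2) summable_on lattice h"
    using assms by (intro summable_on_add summable_on_cmult_right ell2_summable)
  then have "(\<lambda>x. (cmod (u x + v x))\<^sup>2) summable_on lattice h"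
    by (rule summable_on_comparison_test) (auto intro: norm_add_power2_le)
  with assms show ?thesis by (simp add: ell2_def)
qed

lemma ell2_uminus: "u \<in> ell2 h \<Longrightarrow> (\<lambda>x. - u x) \<in> ell2 h"
  by (simp add: ell2_def)

lemma ell2_diff: "u \<in> ell2 h \<Longrightarrow> v \<in> ell2 h \<Longrightarrow> (\<lambda>x. u x - v x) \<in> ell2 h"
  using ell2_add[OF _ ell2_uminus, of u h v] by simp

lemma ell2_cnj: "u \<in> ell2 h \<Longrightarrow> (\<lambda>x. cnj (u x)) \<in> ell2 h"
  by (simp add: ell2_def)

lemma ell2_sum:
  assumes "\<And>i. i \<in> F \<Longrightarrow> u i \<in> ell2 h"
  shows "(\<lambda>x. \<Sum>i\<in>F. u i x) \<in> ell2 h"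
  using assms by (induction F rule: infinite_finite_induct) (auto intro: ell2_zero ell2_add)

lemma ell2_mult_abs_summable:
  assumes "u \<in> ell2 h" "v \<in> ell2 h"
  shows "(\<lambda>x. norm (u x * v x)) summable_on lattice h"
proof -
  have "(\<lambda>x. (cmod (u x))\<^sup>2 + (cmod (v x))\<^sup>2) summable_on lattice h"
    using assms by (intro summable_on_add ell2_summable)
  then show ?thesis
  proof (rule summable_on_comparison_test)
    fix x
    have "norm (u x * v x) \<le> 2 * (cmod (u x) * cmod (v x))" by (simp add: norm_mult)
    also have "\<dots> \<le> (cmod (u x))\<^sup>2 + (cmod (v x))\<^sup>2"
      using sum_squares_bound[of "cmod (u x)" "cmod (v x)"] by (simp add: mult.assoc)
    finally show "norm (u x * v x) \<le> (cmod (u x))\<^sup>2 + (cmod (v x))\<^sup>2" .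
  qed auto
qed

lemma ell2_mult_summable:
  assumes "u \<in> ell2 h" "v \<in> ell2 h"
  shows "(\<lambda>x. u x * v x) summable_on lattice h"
  using ell2_mult_abs_summable[OF assms] by (rule abs_summable_summable)

lemma ell2_inner_summable:
  assumes "u \<in> ell2 h" "v \<in> ell2 h"
  shows "(\<lambda>x. u x * cnj (v x)) summable_on lattice h"
  using ell2_mult_summable[OF assms(1) ell2_cnj[OF assms(2)]] .

lemma ell2_inner_add_left:
  assumes "u \<in> ell2 h" "u' \<in> ell2 h" "v \<in> ell2 h"
  shows "ell2_inner h (\<lambda>x. u x + u' x) v = ell2_inner h u v + ell2_inner h u' v"
  using assms by (simp add: ell2_inner_def distrib_right infsum_add ell2_inner_summable)

lemma ell2_inner_scale_left: "ell2_inner h (\<lambda>x. c * u x) v = c * ell2_inner h u v"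
  by (simp add: ell2_inner_def mult.assoc infsum_cmult_right')

lemma ell2_inner_commute: "ell2_inner h v u = cnj (ell2_inner h u v)"
  by (simp add: ell2_inner_def infsum_cnj[symmetric] mult.commute)

lemma ell2_inner_diff_left:
  assumes "u \<in> ell2 h" "u' \<in> ell2 h" "v \<in> ell2 h"
  shows "ell2_inner h (\<lambda>x. u x - u' x) v = ell2_inner h u v - ell2_inner h u' v"
proof -
  have "(\<lambda>x. - 1 * u' x) \<in> ell2 h" by (rule ell2_scale[OF assms(2)])
  from ell2_inner_add_left[OF assms(1) this assms(3)] show ?thesis
    using ell2_inner_scale_left[of h "- 1" u' v] by simp
qed

lemma ell2_inner_zero_left [simp]: "ell2_inner h (\<lambda>x. 0) v = 0"
  by (simp add: ell2_inner_def)

lemma ell2_inner_sum_left: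
  assumes "\<And>i. i \<in> F \<Longrightarrow> u i \<in> ell2 h" "v \<in> ell2 h"
  shows "ell2_inner h (\<lambda>x. \<Sum>i\<in>F. u i x) v = (\<Sum>i\<in>F. ell2_inner h (u i) v)"
  using assms
  by (induction F rule: infinite_finite_induct) (simp_all add: ell2_inner_add_left ell2_sum)

lemma ell2_norm_power2: "(ell2_norm h u)\<^sup>2 = (\<Sum>\<^sub>\<infinity>x\<in>lattice h. (cmod (u x))\<^sup>2)"
  by (simp add: ell2_norm_def infsum_nonneg)

lemma ell2_norm_nonneg: "0 \<le> ell2_norm h u"
  by (simp add: ell2_norm_def infsum_nonneg)

lemma ell2_inner_self:
  assumes "u \<in> ell2 h"
  shows "ell2_inner h u u = of_real ((ell2_norm h u)\<^sup>2)"
proof -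
  have "((\<lambda>x. (cmod (u x))\<^sup>2) has_sum (ell2_norm h u)\<^sup>2) (lattice h)"
    unfolding ell2_norm_power2 by (rule has_sum_infsum[OF ell2_summable[OF assms]])
  then have "((\<lambda>x. complex_of_real ((cmod (u x))\<^sup>2)) has_sum of_real ((ell2_norm h u)\<^sup>2)) (lattice h)"
    by (rule has_sum_of_real)
  then show ?thesis
    unfolding ell2_inner_def complex_norm_square by (rule infsumI)
qed

lemma ell2_norm_eq_0:
  assumes "u \<in> ell2 h" "ell2_norm h u = 0"
  shows "u = (\<lambda>x. 0)"
proof
  fix x
  show "u x = 0"
  proof (cases "x \<in> lattice h")
    case True
    have "infsum (\<lambda>x. (cmod (u x))\<^sup>2) (lattice h) = 0"
      using assms(2) ell2_norm_power2[of h u] by simp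
    with ell2_summable[OF assms(1)] have "(cmod (u x))\<^sup>2 = 0"
      using True by (intro nonneg_infsum_le_0D[of "\<lambda>x. (cmod (u x))\<^sup>2" "lattice h"]) auto
    then show ?thesis by simp
  qed (use assms in \<open>simp add: ell2_vanishes\<close>)
qed

lemma ell2_norm_scale: "ell2_norm h (\<lambda>x. c * u x) = cmod c * ell2_norm h u"
  by (simp add: ell2_norm_def norm_mult power_mult_distrib infsum_cmult_right' real_sqrt_mult)

section \<open>Orthonormal families and Bessel's inequality\<close>

definition orthonormal :: "real \<Rightarrow> ('n::finite) lfun set \<Rightarrow> bool" where
  "orthonormal h E \<longleftrightarrow> E \<subseteq> ell2 h \<and> (\<forall>e\<in>E. \<forall>e'\<in>E. ell2_inner h e e' = (if e = e' then 1 else 0))"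

lemma orthonormal_subset: "orthonormal h E \<Longrightarrow> F \<subseteq> E \<Longrightarrow> orthonormal h F"
  unfolding orthonormal_def by blast

lemma orthonormal_ell2: "orthonormal h E \<Longrightarrow> e \<in> E \<Longrightarrow> e \<in> ell2 h"
  unfolding orthonormal_def by blast

lemma ell2_combination:
  assumes "orthonormal h E"
  shows "(\<lambda>x. \<Sum>e\<in>E. c e * e x) \<in> ell2 h"
  using assms by (intro ell2_sum ell2_scale) (rule orthonormal_ell2)

lemma ell2_inner_combination:
  assumes E: "orthonormal h E" and u: "u \<in> ell2 h"
  shows "ell2_inner h (\<lambda>x. \<Sum>e\<in>E. c e * e x) u = (\<Sum>e\<in>E. c e * ell2_inner h e u)"
  using E u by (subst ell2_inner_sum_left)
    (auto intro: ell2_scale orthonormal_ell2 simp: ell2_inner_scale_left)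

lemma orthonormal_coefficient:
  assumes E: "orthonormal h E" "finite E" and e: "e \<in> E"
  shows "ell2_inner h (\<lambda>x. \<Sum>e\<in>E. c e * e x) e = c e"
proof -
  have "ell2_inner h (\<lambda>x. \<Sum>e\<in>E. c e * e x) e = (\<Sum>e'\<in>E. c e' * ell2_inner h e' e)"
    by (rule ell2_inner_combination[OF E(1) orthonormal_ell2[OF E(1) e]])
  also have "\<dots> = (\<Sum>e'\<in>E. if e' = e then c e' else 0)"
    by (rule sum.cong) (use E(1) e in \<open>auto simp: orthonormal_def\<close>)
  finally show ?thesis using E(2) e by simp
qed

lemma ell2_norm_combination:
  assumes E: "orthonormal h E" "finite E"
  shows "(ell2_norm h (\<lambda>x. \<Sum>e\<in>E. c e * e x))\<^sup>2 = (\<Sum>e\<in>E. (cmod (c e))\<^sup>2)"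
proof -
  let ?s = "\<lambda>x. \<Sum>e\<in>E. c e * e x"
  have se: "ell2_inner h ?s e = c e" if "e \<in> E" for e
    by (rule orthonormal_coefficient[OF E that])
  have "ell2_inner h ?s ?s = (\<Sum>e\<in>E. c e * ell2_inner h e ?s)"
    by (rule ell2_inner_combination[OF E(1) ell2_combination[OF E(1)]])
  also have "\<dots> = (\<Sum>e\<in>E. of_real ((cmod (c e))\<^sup>2))"
    by (intro sum.cong refl) (subst ell2_inner_commute, simp add: se complex_norm_square del: of_real_power)
  finally have "complex_of_real ((ell2_norm h ?s)\<^sup>2) = of_real (\<Sum>e\<in>E. (cmod (c e))\<^sup>2)"
    by (simp add: ell2_inner_self[OF ell2_combination[OF E(1)]])
  then show ?thesis by (simp only: of_real_eq_iff)
qed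

text \<open>Pythagoras: u splits into its projection s onto the span of E and a remainder w
  orthogonal to s, and the squared norm of s is the sum of the squared coefficients.\<close>

lemma bessel_finite:
  assumes E: "orthonormal h E" "finite E" and u: "u \<in> ell2 h"
  shows "(\<Sum>e\<in>E. (cmod (ell2_inner h u e))\<^sup>2) \<le> (ell2_norm h u)\<^sup>2"
proof -
  let ?c = "\<lambda>e. ell2_inner h u e"
  define s where "s x = (\<Sum>e\<in>E. ?c e * e x)" for x
  define w where "w x = u x - s x" for x
  have s: "s \<in> ell2 h" unfolding s_def using ell2_combination[OF E(1)] .
  have w: "w \<in> ell2 h" unfolding w_def by (rule ell2_diff[OF u s])
  have se: "ell2_inner h s e = ?c e" if "e \<in> E" for e
    unfolding s_def by (rule orthonormal_coefficient[OF E that])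
  have we: "ell2_inner h w e = 0" if "e \<in> E" for e
    unfolding w_def using that se E u s by (subst ell2_inner_diff_left) (auto dest: orthonormal_ell2)
  have "ell2_inner h s w = (\<Sum>e\<in>E. ?c e * ell2_inner h e w)"
    unfolding s_def by (rule ell2_inner_combination[OF E(1) w])
  also have "\<dots> = 0"
    by (intro sum.neutral ballI) (subst ell2_inner_commute, simp add: we)
  finally have sw: "ell2_inner h s w = 0" .
  then have ws: "ell2_inner h w s = 0" by (subst ell2_inner_commute) simp
  have u_eq: "u = (\<lambda>x. w x + s x)" by (simp add: w_def)
  have "ell2_inner h u u = ell2_inner h w u + ell2_inner h s u"
    by (subst (1) u_eq) (rule ell2_inner_add_left[OF w s u])
  also have "ell2_inner h w u = cnj (ell2_inner h w w + ell2_inner h s w)"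
    by (subst ell2_inner_commute, subst (1) u_eq, subst ell2_inner_add_left[OF w s w]) simp
  also have "ell2_inner h s u = cnj (ell2_inner h w s + ell2_inner h s s)"
    by (subst ell2_inner_commute, subst (1) u_eq, subst ell2_inner_add_left[OF w s s]) simp
  finally have "complex_of_real ((ell2_norm h u)\<^sup>2) = of_real ((ell2_norm h w)\<^sup>2 + (ell2_norm h s)\<^sup>2)"
    by (simp add: sw ws ell2_inner_self u s w)
  then have "(ell2_norm h u)\<^sup>2 = (ell2_norm h w)\<^sup>2 + (ell2_norm h s)\<^sup>2"
    by (simp only: of_real_eq_iff)
  moreover have "(ell2_norm h s)\<^sup>2 = (\<Sum>e\<in>E. (cmod (?c e))\<^sup>2)"
    unfolding s_def by (rule ell2_norm_combination[OF E])
  ultimately show ?thesis by simp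
qed

text \<open>This is Bessel's inequality for the single normalized vector v / |v|.\<close>

lemma ell2_Cauchy_Schwarz:
  assumes u: "u \<in> ell2 h" and v: "v \<in> ell2 h"
  shows "cmod (ell2_inner h u v) \<le> ell2_norm h u * ell2_norm h v"
proof (cases "ell2_norm h v = 0")
  case True
  then have "v = (\<lambda>x. 0)" by (rule ell2_norm_eq_0[OF v])
  then show ?thesis by (simp add: ell2_inner_def ell2_norm_nonneg)
next
  case False
  define N where "N = ell2_norm h v"
  have N: "0 < N" using False ell2_norm_nonneg[of h v] by (simp add: N_def)
  define e where "e x = complex_of_real (1 / N) * v x" for x
  have e: "e \<in> ell2 h" unfolding e_def by (rule ell2_scale[OF v])
  have "ell2_norm h e = 1"
    unfolding e_def ell2_norm_scale using N by (simp add: N_def norm_divide)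
  then have "orthonormal h {e}" using e by (simp add: orthonormal_def ell2_inner_self)
  from bessel_finite[OF this _ u] have "(cmod (ell2_inner h u e))\<^sup>2 \<le> (ell2_norm h u)\<^sup>2" by simp
  then have le: "cmod (ell2_inner h u e) \<le> ell2_norm h u"
    by (rule power2_le_imp_le[OF _ ell2_norm_nonneg])
  have "v = (\<lambda>x. complex_of_real N * e x)" using N by (simp add: e_def fun_eq_iff)
  then have "ell2_inner h u v = cnj (complex_of_real N * ell2_inner h e u)"
    by (subst ell2_inner_commute) (metis ell2_inner_scale_left)
  also have "\<dots> = complex_of_real N * ell2_inner h u e"
    by (subst (2) ell2_inner_commute) simp
  finally have "cmod (ell2_inner h u v) = N * cmod (ell2_inner h u e)"
    using N by (simp add: norm_mult)
  then show ?thesis using le N by (simp add: N_def mult.commute mult_left_mono)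
qed

lemma bessel:
  assumes E: "orthonormal h E" and u: "u \<in> ell2 h"
  shows "(\<lambda>e. (cmod (ell2_inner h u e))\<^sup>2) summable_on E"
    and "(\<Sum>\<^sub>\<infinity>e\<in>E. (cmod (ell2_inner h u e))\<^sup>2) \<le> (ell2_norm h u)\<^sup>2"
proof -
  have le: "(\<Sum>e\<in>F. (cmod (ell2_inner h u e))\<^sup>2) \<le> (ell2_norm h u)\<^sup>2" if "finite F" "F \<subseteq> E" for F
    using bessel_finite[OF orthonormal_subset[OF E that(2)] that(1) u] .
  show s: "(\<lambda>e. (cmod (ell2_inner h u e))\<^sup>2) summable_on E"
    by (rule nonneg_bdd_above_summable_on) (auto intro!: bdd_aboveI2 le)
  show "(\<Sum>\<^sub>\<infinity>e\<in>E. (cmod (ell2_inner h u e))\<^sup>2) \<le> (ell2_norm h u)\<^sup>2"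
    by (rule infsum_le_finite_sums[OF s le])
qed

section \<open>Point masses and infinite orthonormal series\<close>

definition delta :: "real ^ 'n \<Rightarrow> ('n::finite) lfun" where
  "delta k x = (if x = k then 1 else 0)"

lemma delta_ell2:
  assumes "k \<in> lattice h"
  shows "delta k \<in> ell2 h"
proof -
  have "(\<lambda>x. (cmod (delta k x))\<^sup>2) summable_on lattice h"
    by (subst summable_on_cong_neutral[where T = "{k}" and g = "\<lambda>x. (cmod (delta k x))\<^sup>2"])
       (use assms in \<open>auto simp: delta_def\<close>)
  then show ?thesis using assms by (auto simp: ell2_def delta_def)
qed

lemma ell2_inner_delta_right:
  assumes "k \<in> lattice h"
  shows "ell2_inner h u (delta k) = u k"
proof -
  have "ell2_inner h u (delta k) = (\<Sum>\<^sub>\<infinity>x\<in>{k}. u x * cnj (delta k x))"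
    unfolding ell2_inner_def by (rule infsum_cong_neutral) (use assms in \<open>auto simp: delta_def\<close>)
  then show ?thesis by (simp add: delta_def)
qed

lemma ell2_inner_delta_left:
  assumes "k \<in> lattice h"
  shows "ell2_inner h (delta k) u = cnj (u k)"
  using ell2_inner_delta_right[OF assms] by (subst ell2_inner_commute) simp

text \<open>At a lattice point this is Bessel's inequality for the point mass there, whose
  coefficients are the conjugated values of the family at that point.\<close>

lemma orthonormal_point_summable:
  assumes E: "orthonormal h E"
  shows "(\<lambda>e. (cmod (e x))\<^sup>2) summable_on E"
proof (cases "x \<in> lattice h")
  case True
  then show ?thesis
    using bessel(1)[OF E delta_ell2[OF True]] by (simp add: ell2_inner_delta_left)
next
  case False
  then have "(\<lambda>e. (cmod (e x))\<^sup>2) summable_on E \<longleftrightarrow> (\<lambda>e. 0::real) summable_on E"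
    using E by (intro summable_on_cong) (auto dest: orthonormal_ell2 simp: ell2_vanishes)
  then show ?thesis by simp
qed

lemma orthonormal_series_abs_summable:
  assumes E: "orthonormal h E" and c: "(\<lambda>e. (cmod (c e))\<^sup>2) summable_on E"
  shows "(\<lambda>e. norm (c e * e x)) summable_on E"
proof -
  have "(\<lambda>e. (cmod (c e))\<^sup>2 + (cmod (e x))\<^sup>2) summable_on E"
    by (intro summable_on_add c orthonormal_point_summable[OF E])
  then show ?thesis
  proof (rule summable_on_comparison_test)
    fix e
    have "norm (c e * e x) \<le> 2 * (cmod (c e) * cmod (e x))" by (simp add: norm_mult)
    also have "\<dots> \<le> (cmod (c e))\<^sup>2 + (cmod (e x))\<^sup>2"
      using sum_squares_bound[of "cmod (c e)" "cmod (e x)"] by (simp add: mult.assoc)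
    finally show "norm (c e * e x) \<le> (cmod (c e))\<^sup>2 + (cmod (e x))\<^sup>2" .
  qed auto
qed

text \<open>The sum is taken pointwise, which suits an operator that only looks at neighbouring
  points. Square summability and the inner products of the sum are recovered separately.\<close>

definition orthonormal_series :: "('n::finite) lfun set \<Rightarrow> ('n lfun \<Rightarrow> complex) \<Rightarrow> 'n lfun" where
  "orthonormal_series E c x = (\<Sum>\<^sub>\<infinity>e\<in>E. c e * e x)"

lemma orthonormal_series_has_sum:
  assumes E: "orthonormal h E" and c: "(\<lambda>e. (cmod (c e))\<^sup>2) summable_on E"
  shows "((\<lambda>e. c e * e x) has_sum orthonormal_series E c x) E"
  unfolding orthonormal_series_def
  by (rule has_sum_infsum[OF abs_summable_summable[OF orthonormal_series_abs_summable[OF E c]]])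

text \<open>A Fatou argument: on finitely many lattice points the finite partial sums are bounded by
  the sum of the squared coefficients, and both the pointwise limit and the growth of the point set
  preserve the bound.\<close>

lemma orthonormal_series_ell2:
  assumes E: "orthonormal h E" and c: "(\<lambda>e. (cmod (c e))\<^sup>2) summable_on E"
  shows "orthonormal_series E c \<in> ell2 h"
    and "(ell2_norm h (orthonormal_series E c))\<^sup>2 \<le> (\<Sum>\<^sub>\<infinity>e\<in>E. (cmod (c e))\<^sup>2)"
proof -
  let ?y = "orthonormal_series E c"
  have le: "(\<Sum>x\<in>A. (cmod (?y x))\<^sup>2) \<le> (\<Sum>\<^sub>\<infinity>e\<in>E. (cmod (c e))\<^sup>2)" if A: "finite A" "A \<subseteq> lattice h" for A
  proof -
    have "((\<lambda>F. \<Sum>x\<in>A. (cmod (\<Sum>e\<in>F. c e * e x))\<^sup>2) \<longlongrightarrow> (\<Sum>x\<in>A. (cmod (?y x))\<^sup>2)) (finite_subsets_at_top E)"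
      by (intro tendsto_intros orthonormal_series_has_sum[OF E c, unfolded has_sum_def])
    moreover have "\<forall>\<^sub>F F in finite_subsets_at_top E. (\<Sum>x\<in>A. (cmod (\<Sum>e\<in>F. c e * e x))\<^sup>2) \<le> (\<Sum>\<^sub>\<infinity>e\<in>E. (cmod (c e))\<^sup>2)"
    proof (rule eventually_finite_subsets_at_top_weakI)
      fix F assume F: "finite F" "F \<subseteq> E"
      have oF: "orthonormal h F" by (rule orthonormal_subset[OF E F(2)])
      have "(\<Sum>x\<in>A. (cmod (\<Sum>e\<in>F. c e * e x))\<^sup>2) \<le> (\<Sum>\<^sub>\<infinity>x\<in>lattice h. (cmod (\<Sum>e\<in>F. c e * e x))\<^sup>2)"
        by (rule finite_sum_le_infsum[OF ell2_summable[OF ell2_combination[OF oF]] A]) simp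
      also have "\<dots> = (\<Sum>e\<in>F. (cmod (c e))\<^sup>2)"
        using ell2_norm_combination[OF oF F(1)] by (simp add: ell2_norm_power2)
      also have "\<dots> \<le> (\<Sum>\<^sub>\<infinity>e\<in>E. (cmod (c e))\<^sup>2)"
        by (rule finite_sum_le_infsum[OF c F]) simp
      finally show "(\<Sum>x\<in>A. (cmod (\<Sum>e\<in>F. c e * e x))\<^sup>2) \<le> (\<Sum>\<^sub>\<infinity>e\<in>E. (cmod (c e))\<^sup>2)" .
    qed
    ultimately show ?thesis by (rule tendsto_upperbound) simp
  qed
  have s: "(\<lambda>x. (cmod (?y x))\<^sup>2) summable_on lattice h"
    by (rule nonneg_bdd_above_summable_on) (auto intro!: bdd_aboveI2 le)
  have "?y x = 0" if "x \<notin> lattice h" for x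
    unfolding orthonormal_series_def
    by (rule infsum_0) (use E that in \<open>auto dest: orthonormal_ell2 simp: ell2_vanishes\<close>)
  with s show "?y \<in> ell2 h" by (simp add: ell2_def)
  show "(ell2_norm h ?y)\<^sup>2 \<le> (\<Sum>\<^sub>\<infinity>e\<in>E. (cmod (c e))\<^sup>2)"
    unfolding ell2_norm_power2 by (rule infsum_le_finite_sums[OF s le])
qed

text \<open>The remainder after a finite set F is itself the orthonormal series over E - F.
  Cauchy-Schwarz bounds its inner product with u by the square root of the tail of the coefficients,
  which tends to 0.\<close>

lemma orthonormal_series_inner:
  assumes E: "orthonormal h E" and c: "(\<lambda>e. (cmod (c e))\<^sup>2) summable_on E" and u: "u \<in> ell2 h"
  shows "((\<lambda>e. c e * ell2_inner h e u) has_sum ell2_inner h (orthonormal_series E c) u) E"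
proof -
  let ?y = "orthonormal_series E c" and ?C = "\<Sum>\<^sub>\<infinity>e\<in>E. (cmod (c e))\<^sup>2"
  have "norm ((\<Sum>e\<in>F. c e * ell2_inner h e u) - ell2_inner h ?y u)
      \<le> sqrt (?C - (\<Sum>e\<in>F. (cmod (c e))\<^sup>2)) * ell2_norm h u" if F: "finite F" "F \<subseteq> E" for F
  proof -
    have oF: "orthonormal h F" and oD: "orthonormal h (E - F)"
      using orthonormal_subset[OF E] F by auto
    have cD: "(\<lambda>e. (cmod (c e))\<^sup>2) summable_on (E - F)"
      using c by (rule summable_on_subset) auto
    have "orthonormal_series (E - F) c = (\<lambda>x. ?y x - (\<Sum>e\<in>F. c e * e x))"
    proof
      fix x
      have "(\<lambda>e. c e * e x) summable_on E"
        by (rule abs_summable_summable[OF orthonormal_series_abs_summable[OF E c]])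
      then show "orthonormal_series (E - F) c x = ?y x - (\<Sum>e\<in>F. c e * e x)"
        unfolding orthonormal_series_def using F by (subst infsum_Diff) auto
    qed
    then have "ell2_inner h (orthonormal_series (E - F) c) u = ell2_inner h ?y u - (\<Sum>e\<in>F. c e * ell2_inner h e u)"
      using ell2_inner_diff_left[OF orthonormal_series_ell2(1)[OF E c] ell2_combination[OF oF] u]
        ell2_inner_combination[OF oF u] by simp
    then have "norm ((\<Sum>e\<in>F. c e * ell2_inner h e u) - ell2_inner h ?y u) =
        cmod (ell2_inner h (orthonormal_series (E - F) c) u)"
      by (simp add: norm_minus_commute)
    also have "\<dots> \<le> ell2_norm h (orthonormal_series (E - F) c) * ell2_norm h u"
      by (rule ell2_Cauchy_Schwarz[OF orthonormal_series_ell2(1)[OF oD cD] u])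
    also have "\<dots> \<le> sqrt (\<Sum>\<^sub>\<infinity>e\<in>E - F. (cmod (c e))\<^sup>2) * ell2_norm h u"
      using orthonormal_series_ell2(2)[OF oD cD]
      by (intro mult_right_mono real_le_rsqrt ell2_norm_nonneg)
    also have "(\<Sum>\<^sub>\<infinity>e\<in>E - F. (cmod (c e))\<^sup>2) = ?C - (\<Sum>e\<in>F. (cmod (c e))\<^sup>2)"
      using F c by (subst infsum_Diff) auto
    finally show ?thesis .
  qed
  then have "\<forall>\<^sub>F F in finite_subsets_at_top E. norm ((\<Sum>e\<in>F. c e * ell2_inner h e u) - ell2_inner h ?y u)
      \<le> sqrt (?C - (\<Sum>e\<in>F. (cmod (c e))\<^sup>2)) * ell2_norm h u"
    by (intro eventually_finite_subsets_at_top_weakI)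
  moreover have "((\<lambda>F. sqrt (?C - (\<Sum>e\<in>F. (cmod (c e))\<^sup>2)) * ell2_norm h u) \<longlongrightarrow> sqrt (?C - ?C) * ell2_norm h u)
      (finite_subsets_at_top E)"
    by (intro tendsto_intros has_sum_infsum[OF c, unfolded has_sum_def])
  ultimately have "((\<lambda>F. (\<Sum>e\<in>F. c e * ell2_inner h e u) - ell2_inner h ?y u) \<longlongrightarrow> 0) (finite_subsets_at_top E)"
    by (simp add: Lim_null_comparison)
  then show ?thesis
    unfolding has_sum_def by (rule Lim_null[THEN iffD2])
qed

section \<open>The discrete Schroedinger operator\<close>

lemma lattice_shift_iff:
  "x + h *\<^sub>R axis j 1 \<in> lattice h \<longleftrightarrow> x \<in> lattice h"
  "x - h *\<^sub>R axis j 1 \<in> lattice h \<longleftrightarrow> x \<in> lattice h"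
proof -
  have add: "x + h *\<^sub>R axis j (of_int k) \<in> lattice h" if x: "x \<in> lattice h" for x and k :: int
  proof -
    obtain m where m: "x = (\<chi> i. h * of_int (m $ i))" using x by (auto simp: lattice_def)
    have "x + h *\<^sub>R axis j (of_int k) = (\<chi> i. h * of_int ((m + axis j k) $ i))"
      by (auto simp: m vec_eq_iff axis_def distrib_left)
    then show ?thesis unfolding lattice_def by (rule image_eqI) simp
  qed
  have plus: "x + h *\<^sub>R axis j 1 \<in> lattice h" if "x \<in> lattice h" for x
    using add[OF that, of 1] by simp
  have minus: "x - h *\<^sub>R axis j 1 \<in> lattice h" if "x \<in> lattice h" for x
  proof -
    have "axis j (- 1) = - axis j (1::real)" by (simp add: vec_eq_iff axis_def)
    then show ?thesis using add[OF that, of "- 1"] by simp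
  qed
  show "x + h *\<^sub>R axis j 1 \<in> lattice h \<longleftrightarrow> x \<in> lattice h"
    using plus[of x] minus[of "x + h *\<^sub>R axis j 1"] by auto
  show "x - h *\<^sub>R axis j 1 \<in> lattice h \<longleftrightarrow> x \<in> lattice h"
    using minus[of x] plus[of "x - h *\<^sub>R axis j 1"] by auto
qed

lemma lattice_shift_uminus_iff: "x + - (h *\<^sub>R axis j 1) \<in> lattice h \<longleftrightarrow> x \<in> lattice h"
  using lattice_shift_iff(2)[of x h j] by simp

lemma bij_betw_shift:
  fixes A :: "'a::ab_group_add set"
  assumes "\<And>x. x + a \<in> A \<longleftrightarrow> x \<in> A"
  shows "bij_betw (\<lambda>x. x + a) A A"
proof (rule bij_betwI[where g = "\<lambda>x. x - a"])
  show "(\<lambda>x. x - a) \<in> A \<rightarrow> A" using assms[of "_ - a"] by auto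
qed (use assms in auto)

lemma ell2_shift:
  assumes a: "\<And>x. x + a \<in> lattice h \<longleftrightarrow> x \<in> lattice h" and u: "u \<in> ell2 h"
  shows "(\<lambda>x. u (x + a)) \<in> ell2 h" and "ell2_norm h (\<lambda>x. u (x + a)) = ell2_norm h u"
proof -
  note bij = bij_betw_shift[OF a]
  show "(\<lambda>x. u (x + a)) \<in> ell2 h"
    using summable_on_reindex_bij_betw[OF bij, of "\<lambda>x. (cmod (u x))\<^sup>2"] u a by (simp add: ell2_def)
  show "ell2_norm h (\<lambda>x. u (x + a)) = ell2_norm h u"
    using infsum_reindex_bij_betw[OF bij, of "\<lambda>x. (cmod (u x))\<^sup>2"] by (simp add: ell2_norm_def)
qed

lemma ell2_inner_shift:
  assumes a: "\<And>x. x + a \<in> lattice h \<longleftrightarrow> x \<in> lattice h"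
  shows "ell2_inner h (\<lambda>x. u (x + a)) w = ell2_inner h u (\<lambda>x. w (x - a))"
  using infsum_reindex_bij_betw[OF bij_betw_shift[OF a], of "\<lambda>x. u x * cnj (w (x - a))"]
  by (simp add: ell2_inner_def)

lemma ell2_neighbours:
  assumes "u \<in> ell2 h"
  shows "(\<lambda>x. u (x + h *\<^sub>R axis j 1)) \<in> ell2 h" "(\<lambda>x. u (x - h *\<^sub>R axis j 1)) \<in> ell2 h"
    and "ell2_norm h (\<lambda>x. u (x + h *\<^sub>R axis j 1)) = ell2_norm h u"
    and "ell2_norm h (\<lambda>x. u (x - h *\<^sub>R axis j 1)) = ell2_norm h u"
  using ell2_shift[OF lattice_shift_iff(1) assms]
    ell2_shift[OF lattice_shift_uminus_iff assms] by simp_all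

lemma ell2_laplacian:
  fixes u :: "('n::finite) lfun"
  assumes "u \<in> ell2 h"
  shows "discrete_laplacian h u \<in> ell2 h"
proof -
  have "(\<lambda>x. (\<Sum>j\<in>(UNIV::'n set). u (x + h *\<^sub>R axis j 1) + u (x - h *\<^sub>R axis j 1)) - (2 * of_nat CARD('n)) * u x) \<in> ell2 h"
    by (intro ell2_diff ell2_sum ell2_add ell2_scale ell2_neighbours assms)
  then show ?thesis by (simp add: discrete_laplacian_def[abs_def])
qed

lemma ell2_inner_laplacian:
  fixes u :: "('n::finite) lfun"
  assumes u: "u \<in> ell2 h" and w: "w \<in> ell2 h"
  shows "ell2_inner h (discrete_laplacian h u) w =
    (\<Sum>j\<in>(UNIV::'n set). ell2_inner h (\<lambda>x. u (x + h *\<^sub>R axis j 1)) w + ell2_inner h (\<lambda>x. u (x - h *\<^sub>R axis j 1)) w)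
      - 2 * of_nat CARD('n) * ell2_inner h u w"
proof -
  have "ell2_inner h (discrete_laplacian h u) w =
    ell2_inner h (\<lambda>x. (\<Sum>j\<in>(UNIV::'n set). u (x + h *\<^sub>R axis j 1) + u (x - h *\<^sub>R axis j 1)) - (2 * of_nat CARD('n)) * u x) w"
    by (simp add: discrete_laplacian_def[abs_def])
  also have "\<dots> = ell2_inner h (\<lambda>x. \<Sum>j\<in>(UNIV::'n set). u (x + h *\<^sub>R axis j 1) + u (x - h *\<^sub>R axis j 1)) w
      - ell2_inner h (\<lambda>x. (2 * of_nat CARD('n)) * u x) w"
    by (intro ell2_inner_diff_left ell2_sum ell2_add ell2_scale ell2_neighbours u w)
  also have "\<dots> = (\<Sum>j\<in>(UNIV::'n set). ell2_inner h (\<lambda>x. u (x + h *\<^sub>R axis j 1)) w + ell2_inner h (\<lambda>x. u (x - h *\<^sub>R axis j 1)) w)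
      - 2 * of_nat CARD('n) * ell2_inner h u w"
    by (simp add: ell2_inner_sum_left ell2_add ell2_neighbours u w ell2_inner_add_left ell2_inner_scale_left)
  finally show ?thesis .
qed

text \<open>The shifts by + and - h in one direction are bijections of the lattice and adjoint to
  each other; the Laplacian contains both with the same weight.\<close>

lemma laplacian_symmetric:
  fixes u :: "('n::finite) lfun"
  assumes u: "u \<in> ell2 h" and w: "w \<in> ell2 h"
  shows "ell2_inner h (discrete_laplacian h u) w = ell2_inner h u (discrete_laplacian h w)"
proof -
  have 1: "ell2_inner h (\<lambda>x. u (x + h *\<^sub>R axis j 1)) w = cnj (ell2_inner h (\<lambda>x. w (x - h *\<^sub>R axis j 1)) u)" for j
    by (subst ell2_inner_shift[OF lattice_shift_iff(1)]) (rule ell2_inner_commute)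
  have 2: "ell2_inner h (\<lambda>x. u (x - h *\<^sub>R axis j 1)) w = cnj (ell2_inner h (\<lambda>x. w (x + h *\<^sub>R axis j 1)) u)" for j
    using ell2_inner_shift[OF lattice_shift_uminus_iff, of h u j w] ell2_inner_commute[of h u]
    by simp
  have "ell2_inner h u (discrete_laplacian h w) = cnj (ell2_inner h (discrete_laplacian h w) u)"
    by (rule ell2_inner_commute)
  also have "\<dots> = ell2_inner h (discrete_laplacian h u) w"
    unfolding ell2_inner_laplacian[OF u w] ell2_inner_laplacian[OF w u] 1 2
    using ell2_inner_commute[of h u w] by (simp add: add.commute)
  finally show ?thesis by simp
qed

text \<open>Shifts are isometries, so by Cauchy-Schwarz each of the 2 n shift terms is at most the
  squared norm of u, and exactly 2 n copies of it are subtracted.\<close>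

lemma laplacian_nonpos:
  fixes u :: "('n::finite) lfun"
  assumes u: "u \<in> ell2 h"
  shows "Re (ell2_inner h (discrete_laplacian h u) u) \<le> 0"
proof -
  have le: "Re (ell2_inner h w u) \<le> (ell2_norm h u)\<^sup>2" if "w \<in> ell2 h" "ell2_norm h w = ell2_norm h u" for w
    using complex_Re_le_cmod[of "ell2_inner h w u"] ell2_Cauchy_Schwarz[OF that(1) u] that(2)
    by (simp add: power2_eq_square)
  have "Re (ell2_inner h (discrete_laplacian h u) u) =
      (\<Sum>j\<in>(UNIV::'n set). Re (ell2_inner h (\<lambda>x. u (x + h *\<^sub>R axis j 1)) u) + Re (ell2_inner h (\<lambda>x. u (x - h *\<^sub>R axis j 1)) u))
      - 2 * CARD('n) * (ell2_norm h u)\<^sup>2"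
    unfolding ell2_inner_laplacian[OF u u] ell2_inner_self[OF u] by simp
  also have "\<dots> \<le> (\<Sum>j\<in>(UNIV::'n set). (ell2_norm h u)\<^sup>2 + (ell2_norm h u)\<^sup>2) - 2 * CARD('n) * (ell2_norm h u)\<^sup>2"
    by (intro diff_right_mono sum_mono add_mono le ell2_neighbours u)
  finally show ?thesis by simp
qed

lemma schroedinger_ell2_eq:
  assumes "u \<in> ell2 h"
  shows "schroedinger h V u x = - complex_of_real (1 / h\<^sup>2) * discrete_laplacian h u x + complex_of_real (V x) * u x"
  using ell2_vanishes[OF assms] ell2_vanishes[OF ell2_laplacian[OF assms]] by (simp add: schroedinger_def)

lemma schroedinger_scale: "schroedinger h V (\<lambda>x. c * u x) = (\<lambda>x. c * schroedinger h V u x)"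
  by (auto simp: schroedinger_def discrete_laplacian_def fun_eq_iff algebra_simps sum_distrib_left sum_distrib_right)

lemma schroedinger_add: "schroedinger h V (\<lambda>x. u x + w x) = (\<lambda>x. schroedinger h V u x + schroedinger h V w x)"
  by (auto simp: schroedinger_def discrete_laplacian_def fun_eq_iff algebra_simps sum.distrib)

lemma schroedinger_diff: "schroedinger h V (\<lambda>x. u x - w x) = (\<lambda>x. schroedinger h V u x - schroedinger h V w x)"
  using schroedinger_add[of h V u "\<lambda>x. - 1 * w x"] by (simp only: schroedinger_scale) simp

lemma schroedinger_zero: "schroedinger h V (\<lambda>x. 0) = (\<lambda>x. 0)"
  by (auto simp: schroedinger_def discrete_laplacian_def fun_eq_iff)

lemma schroedinger_sum: "schroedinger h V (\<lambda>x. \<Sum>i\<in>F. u i x) = (\<lambda>x. \<Sum>i\<in>F. schroedinger h V (u i) x)"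
  by (induction F rule: infinite_finite_induct) (simp_all add: schroedinger_zero schroedinger_add)

lemma schroedinger_cnj: "schroedinger h V (\<lambda>x. cnj (u x)) = (\<lambda>x. cnj (schroedinger h V u x))"
  by (auto simp: schroedinger_def discrete_laplacian_def fun_eq_iff)

text \<open>The Laplacian maps \<open>ell2\<close> to itself, so in the maximal domain the potential
  term is square summable by itself. This permits splitting inner products with H u into their two
  parts.\<close>

lemma potential_ell2:
  assumes u: "u \<in> ell2 h" and Hu: "schroedinger h V u \<in> ell2 h"
  shows "(\<lambda>x. complex_of_real (V x) * u x) \<in> ell2 h"
proof -
  have "(\<lambda>x. schroedinger h V u x + complex_of_real (1 / h\<^sup>2) * discrete_laplacian h u x) \<in> ell2 h"
    by (intro ell2_add ell2_scale Hu ell2_laplacian u)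
  then show ?thesis by (simp add: schroedinger_ell2_eq[OF u])
qed

lemma ell2_inner_schroedinger:
  assumes u: "u \<in> ell2 h" and Hu: "schroedinger h V u \<in> ell2 h" and w: "w \<in> ell2 h"
  shows "ell2_inner h (schroedinger h V u) w =
    - complex_of_real (1 / h\<^sup>2) * ell2_inner h (discrete_laplacian h u) w + ell2_inner h (\<lambda>x. complex_of_real (V x) * u x) w"
proof -
  have "schroedinger h V u = (\<lambda>x. - complex_of_real (1 / h\<^sup>2) * discrete_laplacian h u x + complex_of_real (V x) * u x)"
    using schroedinger_ell2_eq[OF u] by blast
  then have "ell2_inner h (schroedinger h V u) w =
      ell2_inner h (\<lambda>x. - complex_of_real (1 / h\<^sup>2) * discrete_laplacian h u x) w + ell2_inner h (\<lambda>x. complex_of_real (V x) * u x) w"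
    using ell2_inner_add_left[OF ell2_scale[OF ell2_laplacian[OF u], of "- complex_of_real (1 / h\<^sup>2)"] potential_ell2[OF u Hu] w]
    by (simp only:)
  then show ?thesis by (simp only: ell2_inner_scale_left)
qed

lemma schroedinger_symmetric:
  assumes u: "u \<in> ell2 h" "schroedinger h V u \<in> ell2 h" and w: "w \<in> ell2 h" "schroedinger h V w \<in> ell2 h"
  shows "ell2_inner h (schroedinger h V u) w = ell2_inner h u (schroedinger h V w)"
proof -
  have V: "ell2_inner h (\<lambda>x. complex_of_real (V x) * u x) w = cnj (ell2_inner h (\<lambda>x. complex_of_real (V x) * w x) u)"
    by (simp add: ell2_inner_def infsum_cnj[symmetric] mult_ac)
  have L: "ell2_inner h (discrete_laplacian h u) w = cnj (ell2_inner h (discrete_laplacian h w) u)"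
    unfolding laplacian_symmetric[OF u(1) w(1)] by (rule ell2_inner_commute)
  have "ell2_inner h u (schroedinger h V w) = cnj (ell2_inner h (schroedinger h V w) u)"
    by (rule ell2_inner_commute)
  then show ?thesis
    unfolding ell2_inner_schroedinger[OF u w(1)] ell2_inner_schroedinger[OF w u(1)] V L by simp
qed

text \<open>The kinetic part contributes a nonnegative amount to the quadratic form, and the
  potential part is compared with V0 point by point.\<close>

lemma schroedinger_lower_bound:
  fixes u :: "('n::finite) lfun"
  assumes V: "\<And>k. k \<in> lattice h \<Longrightarrow> V k \<ge> V0"
    and u: "u \<in> ell2 h" "schroedinger h V u \<in> ell2 h"
  shows "V0 * (ell2_norm h u)\<^sup>2 \<le> Re (ell2_inner h (schroedinger h V u) u)"
proof -
  have vs: "((\<lambda>x. complex_of_real (V x) * u x * cnj (u x)) has_sum ell2_inner h (\<lambda>x. complex_of_real (V x) * u x) u) (lattice h)"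
    unfolding ell2_inner_def by (rule has_sum_infsum[OF ell2_inner_summable[OF potential_ell2[OF u] u(1)]])
  have ns: "((\<lambda>x. V0 * (cmod (u x))\<^sup>2) has_sum V0 * (ell2_norm h u)\<^sup>2) (lattice h)"
    unfolding ell2_norm_power2 by (rule has_sum_cmult_right[OF has_sum_infsum[OF ell2_summable[OF u(1)]]])
  have "V0 * (ell2_norm h u)\<^sup>2 \<le> Re (ell2_inner h (\<lambda>x. complex_of_real (V x) * u x) u)"
  proof (rule has_sum_mono[OF ns has_sum_Re[OF vs]])
    fix x :: "real ^ 'n" assume "x \<in> lattice h"
    then have "V0 * (cmod (u x))\<^sup>2 \<le> V x * (cmod (u x))\<^sup>2" by (intro mult_right_mono V) auto
    also have "\<dots> = Re (complex_of_real (V x) * u x * cnj (u x))"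
      by (simp add: mult.assoc complex_mult_cnj cmod_power2)
    finally show "V0 * (cmod (u x))\<^sup>2 \<le> Re (complex_of_real (V x) * u x * cnj (u x))" .
  qed
  moreover have "0 \<le> - (1 / h\<^sup>2) * Re (ell2_inner h (discrete_laplacian h u) u)"
    using laplacian_nonpos[OF u(1)] by (intro mult_nonpos_nonpos) auto
  moreover have "Re (- complex_of_real c * z + w) = - c * Re z + Re w" for c z w by simp
  ultimately show ?thesis
    unfolding ell2_inner_schroedinger[OF u u(1)] by simp
qed

section \<open>The spectral representation of the Sobolev norms\<close>

lemma eigenspace_iff:
  "e \<in> eigenspace h V l \<longleftrightarrow> e \<in> ell2 h \<and> schroedinger h V e = (\<lambda>x. complex_of_real l * e x)"
proof -
  have "e \<in> dom_pow h V 1 \<longleftrightarrow> e \<in> ell2 h \<and> schroedinger h V e \<in> ell2 h"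
    unfolding dom_pow_def mem_Collect_eq One_nat_def le_Suc_eq le_0_eq by (simp add: all_conj_distrib imp_disjL)
  moreover have "(\<forall>x. schroedinger h V e x = complex_of_real l * e x) \<longleftrightarrow> schroedinger h V e = (\<lambda>x. complex_of_real l * e x)"
    by (simp only: fun_eq_iff)
  moreover have "(\<lambda>x. complex_of_real l * e x) \<in> ell2 h" if "e \<in> ell2 h" by (rule ell2_scale[OF that])
  ultimately show ?thesis unfolding eigenspace_def mem_Collect_eq by metis
qed

lemma H_inf_iff: "\<phi> \<in> H_inf h V \<longleftrightarrow> (\<forall>j. (schroedinger h V ^^ j) \<phi> \<in> ell2 h)"
proof
  assume \<phi>: "\<phi> \<in> H_inf h V"
  show "\<forall>j. (schroedinger h V ^^ j) \<phi> \<in> ell2 h"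
  proof
    fix j
    have "\<phi> \<in> dom_pow h V (Suc j)"
      by (rule INT_D[OF \<phi>[unfolded H_inf_def]]) simp
    then show "(schroedinger h V ^^ j) \<phi> \<in> ell2 h" unfolding dom_pow_def mem_Collect_eq by (elim allE[of _ j]) simp
  qed
next
  assume "\<forall>j. (schroedinger h V ^^ j) \<phi> \<in> ell2 h"
  then have "\<phi> \<in> dom_pow h V m" for m unfolding dom_pow_def mem_Collect_eq by simp
  then show "\<phi> \<in> H_inf h V" unfolding H_inf_def by (rule INT_I)
qed

lemma H_inf_ell2: "\<phi> \<in> H_inf h V \<Longrightarrow> \<phi> \<in> ell2 h"
  unfolding H_inf_iff by (drule spec[of _ 0]) simp

lemma H_inf_diff:
  assumes "\<phi> \<in> H_inf h V" "\<psi> \<in> H_inf h V"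
  shows "(\<lambda>x. \<phi> x - \<psi> x) \<in> H_inf h V"
proof -
  have "(schroedinger h V ^^ j) (\<lambda>x. \<phi> x - \<psi> x) = (\<lambda>x. (schroedinger h V ^^ j) \<phi> x - (schroedinger h V ^^ j) \<psi> x)" for j
    by (induction j) (simp_all add: schroedinger_diff)
  then show ?thesis using assms by (simp add: H_inf_iff ell2_diff)
qed

lemma H_inf_cnj:
  assumes "\<phi> \<in> H_inf h V"
  shows "(\<lambda>x. cnj (\<phi> x)) \<in> H_inf h V"
proof -
  have "(schroedinger h V ^^ j) (\<lambda>x. cnj (\<phi> x)) = (\<lambda>x. cnj ((schroedinger h V ^^ j) \<phi> x))" for j
    by (induction j) (simp_all add: schroedinger_cnj)
  then show ?thesis using assms by (simp add: H_inf_iff ell2_cnj)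
qed

lemma eigenspace_H_inf:
  assumes "e \<in> eigenspace h V l"
  shows "e \<in> H_inf h V"
proof -
  have "(schroedinger h V ^^ j) e = (\<lambda>x. complex_of_real (l ^ j) * e x)" for j
  proof (induction j)
    case (Suc j)
    have "(schroedinger h V ^^ Suc j) e = schroedinger h V (\<lambda>x. complex_of_real (l ^ j) * e x)"
      by (simp add: Suc)
    also have "\<dots> = (\<lambda>x. complex_of_real (l ^ j) * (complex_of_real l * e x))"
      using assms unfolding schroedinger_scale eigenspace_iff by simp
    finally show ?case by (simp add: mult_ac)
  qed simp
  then show ?thesis using assms by (simp only: H_inf_iff) (simp add: eigenspace_iff ell2_scale)
qed

lemma eigenspace_ell2: "e \<in> eigenspace h V l \<Longrightarrow> e \<in> ell2 h"
  by (simp add: eigenspace_iff)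

lemma eigenspace_schroedinger_ell2: "e \<in> eigenspace h V l \<Longrightarrow> schroedinger h V e \<in> ell2 h"
  by (simp add: eigenspace_iff ell2_scale)

lemma eigenspace_scale: "e \<in> eigenspace h V l \<Longrightarrow> (\<lambda>x. c * e x) \<in> eigenspace h V l"
  by (simp add: eigenspace_iff schroedinger_scale ell2_scale mult.left_commute)

lemma eigenspace_diff: "e \<in> eigenspace h V l \<Longrightarrow> e' \<in> eigenspace h V l \<Longrightarrow> (\<lambda>x. e x - e' x) \<in> eigenspace h V l"
  by (simp add: eigenspace_iff schroedinger_diff ell2_diff right_diff_distrib)

lemma eigenspace_cnj: "e \<in> eigenspace h V l \<Longrightarrow> (\<lambda>x. cnj (e x)) \<in> eigenspace h V l"
  by (simp add: eigenspace_iff schroedinger_cnj ell2_cnj)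

lemma eigenspace_orthogonal:
  assumes e: "e \<in> eigenspace h V l" and e': "e' \<in> eigenspace h V l'" and ne: "l \<noteq> l'"
  shows "ell2_inner h e e' = 0"
proof -
  have "ell2_inner h (schroedinger h V e) e' = ell2_inner h e (schroedinger h V e')"
    by (rule schroedinger_symmetric[OF eigenspace_ell2[OF e] eigenspace_schroedinger_ell2[OF e]
          eigenspace_ell2[OF e'] eigenspace_schroedinger_ell2[OF e']])
  also have "\<dots> = cnj (ell2_inner h (schroedinger h V e') e)" by (rule ell2_inner_commute)
  finally have "complex_of_real l * ell2_inner h e e' = complex_of_real l' * ell2_inner h e e'"
    using e e' ell2_inner_commute[of h e e'] by (simp add: eigenspace_iff ell2_inner_scale_left)
  then show ?thesis using ne by simp
qed

lemma eigenvalue_lower_bound: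
  assumes V: "\<And>k. k \<in> lattice h \<Longrightarrow> V k \<ge> V0"
    and e: "e \<in> eigenspace h V l" "e \<noteq> (\<lambda>x. 0)"
  shows "V0 \<le> l"
proof -
  have "ell2_norm h e \<noteq> 0" using ell2_norm_eq_0[OF eigenspace_ell2[OF e(1)]] e(2) by blast
  then have pos: "0 < (ell2_norm h e)\<^sup>2" by simp
  have "V0 * (ell2_norm h e)\<^sup>2 \<le> Re (ell2_inner h (schroedinger h V e) e)"
    by (rule schroedinger_lower_bound[OF V eigenspace_ell2[OF e(1)] eigenspace_schroedinger_ell2[OF e(1)]])
  also have "\<dots> = l * (ell2_norm h e)\<^sup>2"
    using e(1) by (simp add: eigenspace_iff ell2_inner_scale_left ell2_inner_self)
  finally show ?thesis using pos by simp
qed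

text \<open>Two candidates differ by an element of the eigenspace orthogonal to itself. With
  uniqueness settled, the definite description can be evaluated by exhibiting any candidate.\<close>

lemma spectral_proj_eqI:
  assumes u: "u \<in> ell2 h" and v: "v \<in> eigenspace h V l"
    and orth: "\<And>e. e \<in> eigenspace h V l \<Longrightarrow> ell2_inner h (\<lambda>x. u x - v x) e = 0"
  shows "spectral_proj h V l u = v"
  unfolding spectral_proj_def
proof (rule the_equality)
  fix w assume w: "w \<in> eigenspace h V l \<and> (\<forall>e\<in>eigenspace h V l. ell2_inner h (\<lambda>x. u x - w x) e = 0)"
  define d where "d x = w x - v x" for x
  have d: "d \<in> eigenspace h V l" unfolding d_def using w v by (intro eigenspace_diff) auto
  have "ell2_inner h (\<lambda>x. (u x - v x) - (u x - w x)) d = 0"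
    using orth[OF d] w d u v
    by (subst ell2_inner_diff_left) (auto intro!: ell2_diff dest: eigenspace_ell2)
  then have "ell2_norm h d = 0"
    using ell2_inner_self[OF eigenspace_ell2[OF d]] by (simp add: d_def[abs_def])
  then have "d = (\<lambda>x. 0)" by (rule ell2_norm_eq_0[OF eigenspace_ell2[OF d]])
  then show "w = v" by (auto simp: d_def fun_eq_iff)
qed (use v orth in auto)

lemma zero_eigenspace: "(\<lambda>x. 0) \<in> eigenspace h V l"
  by (simp add: eigenspace_iff ell2_zero schroedinger_zero)

lemma one_plus_H_powr_eigenspace:
  assumes e: "e \<in> eigenspace h V l" "e \<noteq> (\<lambda>x. 0)"
  shows "one_plus_H_powr h V r e = (\<lambda>x. complex_of_real ((1 + l) powr r) * e x)"
proof
  fix x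
  have p: "spectral_proj h V l e = e"
    by (rule spectral_proj_eqI[OF eigenspace_ell2[OF e(1)] e(1)]) simp
  have p0: "spectral_proj h V l' e = (\<lambda>x. 0)" if "l' \<noteq> l" for l'
    by (rule spectral_proj_eqI[OF eigenspace_ell2[OF e(1)] zero_eigenspace])
       (use eigenspace_orthogonal[OF e(1)] that in simp)
  have l: "l \<in> eigenvalues h V" using e by (auto simp: eigenvalues_def)
  have "one_plus_H_powr h V r e x = (\<Sum>\<^sub>\<infinity>l'\<in>{l}. complex_of_real ((1 + l') powr r) * spectral_proj h V l' e x)"
    unfolding one_plus_H_powr_def by (rule infsum_cong_neutral) (use l p0 in auto)
  then show "one_plus_H_powr h V r e x = complex_of_real ((1 + l) powr r) * e x" by (simp add: p)
qed

lemma one_plus_H_powr_eq_0: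
  assumes u: "u \<in> ell2 h" and orth: "\<And>l e. e \<in> eigenspace h V l \<Longrightarrow> ell2_inner h u e = 0"
  shows "one_plus_H_powr h V r u = (\<lambda>x. 0)"
proof
  fix x
  have "spectral_proj h V l u = (\<lambda>x. 0)" for l
    by (rule spectral_proj_eqI[OF u zero_eigenspace]) (use orth in simp)
  then show "one_plus_H_powr h V r u x = 0" by (simp add: one_plus_H_powr_def)
qed

lemma finite_support_ell2:
  assumes "finite {x. u x \<noteq> 0}" "\<And>x. x \<notin> lattice h \<Longrightarrow> u x = 0"
  shows "u \<in> ell2 h"
proof -
  have "(\<lambda>x. (cmod (u x))\<^sup>2) summable_on lattice h \<longleftrightarrow> (\<lambda>x. (cmod (u x))\<^sup>2) summable_on {x. u x \<noteq> 0}"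
    by (rule summable_on_cong_neutral) (use assms(2) in auto)
  then show ?thesis using assms by (simp add: ell2_def)
qed

text \<open>Each application of H enlarges the support by nearest neighbours only, so all powers
  applied to a point mass have finite support on the lattice.\<close>

lemma delta_H_inf:
  fixes k :: "real ^ 'n::finite"
  assumes k: "k \<in> lattice h"
  shows "delta k \<in> H_inf h V"
proof -
  have "finite {x. (schroedinger h V ^^ j) (delta k) x \<noteq> 0} \<and>
      (\<forall>x. x \<notin> lattice h \<longrightarrow> (schroedinger h V ^^ j) (delta k) x = 0)" for j
  proof (induction j)
    case 0
    have "{x. delta k x \<noteq> 0} \<subseteq> {k}" by (auto simp: delta_def)
    then have "finite {x. delta k x \<noteq> 0}" by (rule finite_subset) simp
    then show ?case using k by (auto simp: delta_def)
  next
    case (Suc j)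
    define u where "u = (schroedinger h V ^^ j) (delta k)"
    define S where "S = {x. u x \<noteq> 0}"
    have S: "finite S" using Suc by (simp add: S_def u_def)
    have "{x. schroedinger h V u x \<noteq> 0} \<subseteq>
        S \<union> (\<Union>j\<in>(UNIV::'n set). (\<lambda>x. x - h *\<^sub>R axis j 1) ` S \<union> (\<lambda>x. x + h *\<^sub>R axis j 1) ` S)"
    proof
      fix x assume x: "x \<in> {x. schroedinger h V u x \<noteq> 0}"
      show "x \<in> S \<union> (\<Union>j\<in>(UNIV::'n set). (\<lambda>x. x - h *\<^sub>R axis j 1) ` S \<union> (\<lambda>x. x + h *\<^sub>R axis j 1) ` S)"
      proof (rule ccontr)
        assume out: "x \<notin> S \<union> (\<Union>j\<in>(UNIV::'n set). (\<lambda>x. x - h *\<^sub>R axis j 1) ` S \<union> (\<lambda>x. x + h *\<^sub>R axis j 1) ` S)"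
        have "u (x + h *\<^sub>R axis j 1) = 0" for j
        proof (rule ccontr)
          assume "u (x + h *\<^sub>R axis j 1) \<noteq> 0"
          then have "x \<in> (\<lambda>x. x - h *\<^sub>R axis j 1) ` S"
            by (intro image_eqI[where x = "x + h *\<^sub>R axis j 1"]) (auto simp: S_def)
          then show False using out by blast
        qed
        moreover have "u (x - h *\<^sub>R axis j 1) = 0" for j
        proof (rule ccontr)
          assume "u (x - h *\<^sub>R axis j 1) \<noteq> 0"
          then have "x \<in> (\<lambda>x. x + h *\<^sub>R axis j 1) ` S"
            by (intro image_eqI[where x = "x - h *\<^sub>R axis j 1"]) (auto simp: S_def)
          then show False using out by blast
        qed
        moreover have "u x = 0" using out by (simp add: S_def)
        ultimately show False using x by (simp add: schroedinger_def discrete_laplacian_def split: if_splits)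
      qed
    qed
    then have "finite {x. schroedinger h V u x \<noteq> 0}"
      by (rule finite_subset) (use S in simp)
    moreover have "\<forall>x. x \<notin> lattice h \<longrightarrow> schroedinger h V u x = 0" by (simp add: schroedinger_def)
    ultimately show ?case by (simp add: u_def)
  qed
  then show ?thesis by (simp add: H_inf_iff finite_support_ell2)
qed

text \<open>The value of H u at a point involves finitely many values of u, so H passes through
  pointwise limits of the partial sums.\<close>

lemma schroedinger_orthonormal_series:
  assumes E: "orthonormal h E" and c: "(\<lambda>e. (cmod (c e))\<^sup>2) summable_on E"
  shows "((\<lambda>e. c e * schroedinger h V e x) has_sum schroedinger h V (orthonormal_series E c) x) E"
proof -
  let ?y = "orthonormal_series E c"
  have lim: "((\<lambda>F. \<Sum>e\<in>F. c e * e x) \<longlongrightarrow> ?y x) (finite_subsets_at_top E)" for x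
    using orthonormal_series_has_sum[OF E c] unfolding has_sum_def .
  have "((\<lambda>F. schroedinger h V (\<lambda>x. \<Sum>e\<in>F. c e * e x) x) \<longlongrightarrow> schroedinger h V ?y x) (finite_subsets_at_top E)"
    unfolding schroedinger_def discrete_laplacian_def
    by (cases "x \<in> lattice h") (simp_all only: if_True if_False, intro tendsto_intros lim, rule tendsto_const)
  moreover have "schroedinger h V (\<lambda>x. \<Sum>e\<in>F. c e * e x) x = (\<Sum>e\<in>F. c e * schroedinger h V e x)" for F
    by (simp add: schroedinger_sum schroedinger_scale)
  ultimately show ?thesis unfolding has_sum_def by simp
qed

section \<open>Maximal orthonormal families of eigenfunctions\<close>

definition eigenbasis :: "real \<Rightarrow> (real ^ 'n \<Rightarrow> real) \<Rightarrow> ('n::finite) lfun set \<Rightarrow> bool" where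
  "eigenbasis h V E \<longleftrightarrow> orthonormal h E \<and> (\<forall>e\<in>E. \<exists>l. e \<in> eigenspace h V l)
     \<and> (\<forall>l. \<forall>e\<in>eigenspace h V l. (\<forall>e'\<in>E. ell2_inner h e e' = 0) \<longrightarrow> e = (\<lambda>x. 0))"

text \<open>Zorn's lemma applies because orthonormality concerns two elements at a time and a chain
  contains any two of them in a common member. An eigenfunction orthogonal to a maximal family could
  be normalized and added. Maximality is claimed among eigenfunctions only.\<close>

lemma eigenbasis_exists: "\<exists>E. eigenbasis h V E"
proof -
  let ?\<A> = "{E. orthonormal h E \<and> (\<forall>e\<in>E. \<exists>l. e \<in> eigenspace h V l)}"
  have "\<forall>C\<in>chains ?\<A>. \<Union>C \<in> ?\<A>"
  proof
    fix C assume C: "C \<in> chains ?\<A>"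
    then have sub: "\<And>X. X \<in> C \<Longrightarrow> X \<in> ?\<A>" by (simp add: chains_def subset_iff)
    have lin: "X \<subseteq> Y \<or> Y \<subseteq> X" if "X \<in> C" "Y \<in> C" for X Y
      using C that unfolding chains_def chain_subset_def by blast
    have inner: "ell2_inner h e e' = (if e = e' then 1 else 0)" if e: "e \<in> \<Union>C" "e' \<in> \<Union>C" for e e'
    proof -
      obtain X Y where XY: "X \<in> C" "e \<in> X" "Y \<in> C" "e' \<in> Y" using e by blast
      obtain Z where "Z \<in> C" "e \<in> Z" "e' \<in> Z"
        using lin[OF XY(1,3)] XY by blast
      then show ?thesis using sub[of Z] unfolding orthonormal_def by blast
    qed
    have 1: "e \<in> ell2 h" and 2: "\<exists>l. e \<in> eigenspace h V l" if eC: "e \<in> \<Union>C" for e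
    proof -
      obtain X where X: "X \<in> C" "e \<in> X" using eC by blast
      then show "e \<in> ell2 h" "\<exists>l. e \<in> eigenspace h V l"
        using sub[OF X(1)] by (auto dest: orthonormal_ell2)
    qed
    show "\<Union>C \<in> ?\<A>"
      unfolding mem_Collect_eq orthonormal_def using inner 1 2 by blast
  qed
  from Zorn_Lemma[OF this] obtain E where E': "E \<in> ?\<A>" and max': "\<forall>X\<in>?\<A>. E \<subseteq> X \<longrightarrow> X = E" ..
  have E: "orthonormal h E" "\<forall>e\<in>E. \<exists>l. e \<in> eigenspace h V l" using E' by auto
  have "e = (\<lambda>x. 0)" if e: "e \<in> eigenspace h V l" and orth: "\<forall>e'\<in>E. ell2_inner h e e' = 0" for l e
  proof (rule ccontr)
    assume "e \<noteq> (\<lambda>x. 0)"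
    then have N: "ell2_norm h e \<noteq> 0" using ell2_norm_eq_0[OF eigenspace_ell2[OF e]] by blast
    define d where "d x = complex_of_real (1 / ell2_norm h e) * e x" for x
    have d: "d \<in> eigenspace h V l" unfolding d_def by (rule eigenspace_scale[OF e])
    have "ell2_norm h d = 1"
      unfolding d_def ell2_norm_scale using N ell2_norm_nonneg[of h e] by (simp add: norm_divide)
    then have dd: "ell2_inner h d d = 1" using ell2_inner_self[OF eigenspace_ell2[OF d]] by simp
    have de: "ell2_inner h d e' = 0" if "e' \<in> E" for e'
      unfolding d_def ell2_inner_scale_left using orth that by simp
    then have ed: "ell2_inner h e' d = 0" if "e' \<in> E" for e'
      using that by (subst ell2_inner_commute) simp
    have dE: "d \<notin> E" using de[of d] dd by auto
    have "ell2_inner h e1 e2 = (if e1 = e2 then 1 else 0)" if "e1 \<in> insert d E" "e2 \<in> insert d E" for e1 e2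
      using that E(1) dE dd de ed unfolding orthonormal_def by (cases "e1 = d"; cases "e2 = d") auto
    then have "orthonormal h (insert d E)"
      using E(1) eigenspace_ell2[OF d] unfolding orthonormal_def by blast
    then have "insert d E \<in> ?\<A>" using E(2) d by blast
    with max' have "insert d E = E" by blast
    with dE show False by blast
  qed
  with E show ?thesis unfolding eigenbasis_def by blast
qed

text \<open>The coefficients of e at basis functions of other eigenvalues vanish, so the sum of its
  series is again in the eigenspace of l. The difference from e is then an eigenfunction orthogonal
  to the whole family, and maximality makes it 0.\<close>

lemma eigenbasis_expansion:
  assumes E: "eigenbasis h V E" and e: "e \<in> eigenspace h V l"
  shows "e = orthonormal_series E (\<lambda>e'. ell2_inner h e e')"
proof -
  have oE: "orthonormal h E" using E by (simp add: eigenbasis_def)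
  define c where "c e' = ell2_inner h e e'" for e'
  have cs: "(\<lambda>e'. (cmod (c e'))\<^sup>2) summable_on E"
    unfolding c_def by (rule bessel(1)[OF oE eigenspace_ell2[OF e]])
  let ?y = "orthonormal_series E c"
  have y: "?y \<in> ell2 h" by (rule orthonormal_series_ell2(1)[OF oE cs])
  have "schroedinger h V ?y x = complex_of_real l * ?y x" for x
  proof (rule has_sum_unique)
    show "((\<lambda>e'. c e' * schroedinger h V e' x) has_sum schroedinger h V ?y x) E"
      by (rule schroedinger_orthonormal_series[OF oE cs])
    have cong: "c e' * schroedinger h V e' x = complex_of_real l * (c e' * e' x)" if e': "e' \<in> E" for e'
    proof -
      obtain l' where l': "e' \<in> eigenspace h V l'" using E e' unfolding eigenbasis_def by blast
      have "c e' = 0 \<or> l = l'" using eigenspace_orthogonal[OF e l'] by (auto simp: c_def)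
      then show ?thesis using l' by (auto simp: eigenspace_iff)
    qed
    show "((\<lambda>e'. c e' * schroedinger h V e' x) has_sum complex_of_real l * ?y x) E"
      by (subst has_sum_cong[OF cong], assumption)
         (intro has_sum_cmult_right orthonormal_series_has_sum[OF oE cs])
  qed
  then have ye: "?y \<in> eigenspace h V l" using y by (auto simp: eigenspace_iff)
  have "ell2_inner h (\<lambda>x. e x - ?y x) e' = 0" if e': "e' \<in> E" for e'
  proof -
    have e'2: "e' \<in> ell2 h" by (rule orthonormal_ell2[OF oE e'])
    have "((\<lambda>e''. c e'' * ell2_inner h e'' e') has_sum ell2_inner h ?y e') E"
      by (rule orthonormal_series_inner[OF oE cs e'2])
    moreover have "((\<lambda>e''. c e'' * ell2_inner h e'' e') has_sum c e') E"
    proof (rule has_sum_finite_neutralI[where B = "{e'}"])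
      show "c e' = (\<Sum>e''\<in>{e'}. c e'' * ell2_inner h e'' e')" using oE e' by (simp add: orthonormal_def)
    qed (use oE e' in \<open>auto simp: orthonormal_def\<close>)
    ultimately have "ell2_inner h ?y e' = c e'" by (rule has_sum_unique)
    then show ?thesis
      using ell2_inner_diff_left[OF eigenspace_ell2[OF e] y e'2] by (simp add: c_def)
  qed
  then have "(\<lambda>x. e x - ?y x) = (\<lambda>x. 0)"
    using E eigenspace_diff[OF e ye] unfolding eigenbasis_def by blast
  then have "e x - ?y x = 0" for x by (rule fun_cong)
  then have "e = ?y" by (simp add: fun_eq_iff)
  then show ?thesis unfolding c_def .
qed

text \<open>By symmetry H multiplies the coefficient at e by its eigenvalue, as it does with e
  itself, so H commutes with the projection onto the closed span of the eigenfunctions. Each power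
  of H of the projection is then the projection of an element of \<open>ell2\<close>.\<close>

lemma eigen_projection_H_inf:
  assumes E: "eigenbasis h V E" and \<phi>: "\<phi> \<in> H_inf h V"
  shows "orthonormal_series E (ell2_inner h \<phi>) \<in> H_inf h V"
proof -
  have oE: "orthonormal h E" using E by (simp add: eigenbasis_def)
  have commute: "schroedinger h V (orthonormal_series E (ell2_inner h u)) = orthonormal_series E (ell2_inner h (schroedinger h V u))"
    if u: "u \<in> ell2 h" "schroedinger h V u \<in> ell2 h" for u
  proof
    fix x
    have "((\<lambda>e. ell2_inner h u e * schroedinger h V e x) has_sum schroedinger h V (orthonormal_series E (ell2_inner h u)) x) E"
      by (rule schroedinger_orthonormal_series[OF oE bessel(1)[OF oE u(1)]])
    moreover have "((\<lambda>e. ell2_inner h (schroedinger h V u) e * e x) has_sum orthonormal_series E (ell2_inner h (schroedinger h V u)) x) E"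
      by (rule orthonormal_series_has_sum[OF oE bessel(1)[OF oE u(2)]])
    moreover have "ell2_inner h (schroedinger h V u) e * e x = ell2_inner h u e * schroedinger h V e x" if e: "e \<in> E" for e
    proof -
      obtain l where l: "e \<in> eigenspace h V l" using E e unfolding eigenbasis_def by blast
      have "ell2_inner h (schroedinger h V u) e = ell2_inner h u (schroedinger h V e)"
        by (rule schroedinger_symmetric[OF u eigenspace_ell2[OF l] eigenspace_schroedinger_ell2[OF l]])
      also have "\<dots> = cnj (complex_of_real l * ell2_inner h e u)"
        using l by (subst ell2_inner_commute) (simp add: eigenspace_iff ell2_inner_scale_left)
      also have "\<dots> = complex_of_real l * ell2_inner h u e"
        by (subst (2) ell2_inner_commute) simp
      finally show ?thesis using l by (simp add: eigenspace_iff)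
    qed
    ultimately show "schroedinger h V (orthonormal_series E (ell2_inner h u)) x = orthonormal_series E (ell2_inner h (schroedinger h V u)) x"
      by (metis (no_types, lifting) has_sum_cong has_sum_unique)
  qed
  have pow: "(schroedinger h V ^^ j) (orthonormal_series E (ell2_inner h \<phi>)) = orthonormal_series E (ell2_inner h ((schroedinger h V ^^ j) \<phi>))" for j
  proof (induction j)
    case (Suc j)
    have "(schroedinger h V ^^ j) \<phi> \<in> ell2 h" "(schroedinger h V ^^ Suc j) \<phi> \<in> ell2 h"
      using \<phi> unfolding H_inf_iff by blast+
    then show ?case using Suc commute[of "(schroedinger h V ^^ j) \<phi>"] by simp
  qed simp
  show ?thesis
    unfolding H_inf_iff pow
  proof
    fix j
    have "(schroedinger h V ^^ j) \<phi> \<in> ell2 h" using \<phi> unfolding H_inf_iff by blast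
    then show "orthonormal_series E (ell2_inner h ((schroedinger h V ^^ j) \<phi>)) \<in> ell2 h"
      by (intro orthonormal_series_ell2(1)[OF oE] bessel(1)[OF oE])
  qed
qed

text \<open>The eigenfunction e equals its own series over E, so its inner product with u is
  determined by the coefficients of u on E, and these are shared by u and its projection.\<close>

lemma eigen_projection_residual_orthogonal:
  assumes E: "eigenbasis h V E" and u: "u \<in> ell2 h" and e: "e \<in> eigenspace h V l"
  shows "ell2_inner h (\<lambda>x. u x - orthonormal_series E (ell2_inner h u) x) e = 0"
proof -
  have oE: "orthonormal h E" using E by (simp add: eigenbasis_def)
  note e2 = eigenspace_ell2[OF e]
  have "((\<lambda>e'. ell2_inner h e e' * ell2_inner h e' u) has_sum ell2_inner h (orthonormal_series E (ell2_inner h e)) u) E"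
    by (rule orthonormal_series_inner[OF oE bessel(1)[OF oE e2] u])
  then have "((\<lambda>e'. ell2_inner h e e' * ell2_inner h e' u) has_sum ell2_inner h e u) E"
    using eigenbasis_expansion[OF E e] by simp
  then have "((\<lambda>e'. cnj (ell2_inner h e e' * ell2_inner h e' u)) has_sum cnj (ell2_inner h e u)) E"
    by (simp only: has_sum_cnj_iff)
  moreover have "cnj (ell2_inner h e e' * ell2_inner h e' u) = ell2_inner h u e' * ell2_inner h e' e" for e'
    using ell2_inner_commute[of h e' e] ell2_inner_commute[of h u e'] by simp
  ultimately have "((\<lambda>e'. ell2_inner h u e' * ell2_inner h e' e) has_sum ell2_inner h u e) E"
    using ell2_inner_commute[of h u e] by simp
  moreover have "((\<lambda>e'. ell2_inner h u e' * ell2_inner h e' e) has_sum ell2_inner h (orthonormal_series E (ell2_inner h u)) e) E"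
    by (rule orthonormal_series_inner[OF oE bessel(1)[OF oE u] e2])
  ultimately have "ell2_inner h u e = ell2_inner h (orthonormal_series E (ell2_inner h u)) e"
    by (rule has_sum_unique)
  then show ?thesis
    by (subst ell2_inner_diff_left[OF u orthonormal_series_ell2(1)[OF oE bessel(1)[OF oE u]] e2]) simp
qed

section \<open>Sobolev spaces and norms in terms of square summable representatives\<close>

lemma embed_eq: "\<phi> \<in> H_inf h V \<Longrightarrow> embed h V v \<phi> = ell2_inner h v (\<lambda>x. cnj (\<phi> x))"
  by (simp add: embed_def ell2_inner_def)

text \<open>Point masses are test functions and recover the values of v. This uniqueness is what
  gives the definite description in \<open>Sobolev_norm\<close> its meaning.\<close>

lemma embed_inj:
  assumes v: "v \<in> ell2 h" and w: "w \<in> ell2 h" and eq: "embed h V v = embed h V w"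
  shows "v = w"
proof
  fix k
  show "v k = w k"
  proof (cases "k \<in> lattice h")
    case True
    have d: "(\<lambda>x. cnj (delta k x)) = delta k" by (auto simp: delta_def)
    have "embed h V u (delta k) = u k" for u
      unfolding embed_eq[OF delta_H_inf[OF True]] d by (rule ell2_inner_delta_right[OF True])
    then show ?thesis using fun_cong[OF eq, of "delta k"] by metis
  qed (simp add: ell2_vanishes[OF v] ell2_vanishes[OF w])
qed

lemma Sobolev_norm_eq:
  assumes "v \<in> ell2 h" "one_plus_H_powr_dual h V (s / 2) U = embed h V v"
  shows "Sobolev_norm h V s U = ell2_norm h v"
proof -
  have "(THE v. v \<in> ell2 h \<and> one_plus_H_powr_dual h V (s / 2) U = embed h V v) = v"
    using assms by (intro the_equality) (auto intro: embed_inj)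
  then show ?thesis by (simp add: Sobolev_norm_def)
qed

lemma Sobolev_norm_nonneg:
  assumes "U \<in> Sobolev h V s"
  shows "0 \<le> Sobolev_norm h V s U"
proof -
  obtain v where "v \<in> ell2 h" "one_plus_H_powr_dual h V (s / 2) U = embed h V v"
    using assms unfolding Sobolev_def by blast
  then show ?thesis by (simp add: Sobolev_norm_eq ell2_norm_nonneg)
qed

lemma H_minf_diff:
  assumes U: "U \<in> H_minf h V" and W: "W \<in> H_minf h V"
  shows "(\<lambda>\<phi>. U \<phi> - W \<phi>) \<in> H_minf h V"
proof -
  let ?p = "\<lambda>m \<phi>. \<Sum>j\<le>m. ell2_norm h ((schroedinger h V ^^ j) \<phi>)"
  obtain C m where C: "\<And>\<phi>. \<phi> \<in> H_inf h V \<Longrightarrow> cmod (U \<phi>) \<le> C * ?p m \<phi>"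
    using U unfolding H_minf_def by blast
  obtain D n where D: "\<And>\<phi>. \<phi> \<in> H_inf h V \<Longrightarrow> cmod (W \<phi>) \<le> D * ?p n \<phi>"
    using W unfolding H_minf_def by blast
  have "cmod (U \<phi> - W \<phi>) \<le> (\<bar>C\<bar> + \<bar>D\<bar>) * ?p (max m n) \<phi>" if \<phi>: "\<phi> \<in> H_inf h V" for \<phi>
  proof -
    have mono: "?p i \<phi> \<le> ?p (max m n) \<phi>" if "i \<le> max m n" for i
      using that by (intro sum_mono2) (auto simp: ell2_norm_nonneg)
    have nn: "0 \<le> ?p i \<phi>" for i by (intro sum_nonneg ell2_norm_nonneg)
    have "C * ?p m \<phi> \<le> \<bar>C\<bar> * ?p (max m n) \<phi>" "D * ?p n \<phi> \<le> \<bar>D\<bar> * ?p (max m n) \<phi>"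
      using mono nn by (auto intro!: mult_mono)
    then show ?thesis
      using norm_triangle_ineq4[of "U \<phi>" "W \<phi>"] C[OF \<phi>] D[OF \<phi>] by (simp add: distrib_right)
  qed
  then have "\<exists>C m. \<forall>\<phi>\<in>H_inf h V. cmod (U \<phi> - W \<phi>) \<le> C * ?p m \<phi>" by blast
  moreover have "\<forall>\<phi>. \<phi> \<notin> H_inf h V \<longrightarrow> U \<phi> - W \<phi> = 0"
    using U W unfolding H_minf_def by simp
  moreover have "\<forall>\<phi>\<in>H_inf h V. \<forall>\<psi>\<in>H_inf h V. U (\<lambda>x. \<phi> x + \<psi> x) - W (\<lambda>x. \<phi> x + \<psi> x) = (U \<phi> - W \<phi>) + (U \<psi> - W \<psi>)"
    using U W unfolding H_minf_def by simp
  moreover have "\<forall>\<phi>\<in>H_inf h V. \<forall>c. U (\<lambda>x. c * \<phi> x) - W (\<lambda>x. c * \<phi> x) = c * (U \<phi> - W \<phi>)"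
    using U W unfolding H_minf_def by (simp add: right_diff_distrib)
  ultimately show ?thesis unfolding H_minf_def by blast
qed

lemma Sobolev_diff:
  assumes U: "U \<in> Sobolev h V s" and W: "W \<in> Sobolev h V s"
  shows "(\<lambda>\<phi>. U \<phi> - W \<phi>) \<in> Sobolev h V s"
proof -
  obtain v where v: "v \<in> ell2 h" "one_plus_H_powr_dual h V (s / 2) U = embed h V v"
    using U unfolding Sobolev_def by blast
  obtain w where w: "w \<in> ell2 h" "one_plus_H_powr_dual h V (s / 2) W = embed h V w"
    using W unfolding Sobolev_def by blast
  have "one_plus_H_powr_dual h V (s / 2) (\<lambda>\<phi>. U \<phi> - W \<phi>) = embed h V (\<lambda>x. v x - w x)"
  proof
    fix \<phi>
    show "one_plus_H_powr_dual h V (s / 2) (\<lambda>\<phi>. U \<phi> - W \<phi>) \<phi> = embed h V (\<lambda>x. v x - w x) \<phi>"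
    proof (cases "\<phi> \<in> H_inf h V")
      case True
      have "one_plus_H_powr_dual h V (s / 2) (\<lambda>\<phi>. U \<phi> - W \<phi>) \<phi> = embed h V v \<phi> - embed h V w \<phi>"
        unfolding v(2)[symmetric] w(2)[symmetric] by (simp add: one_plus_H_powr_dual_def)
      also have "\<dots> = embed h V (\<lambda>x. v x - w x) \<phi>"
        unfolding embed_eq[OF True]
        by (rule ell2_inner_diff_left[OF v(1) w(1) ell2_cnj[OF H_inf_ell2[OF True]], symmetric])
      finally show ?thesis .
    qed (simp add: one_plus_H_powr_dual_def embed_def)
  qed
  moreover have "(\<lambda>x. v x - w x) \<in> ell2 h" by (rule ell2_diff[OF v(1) w(1)])
  moreover have "(\<lambda>\<phi>. U \<phi> - W \<phi>) \<in> H_minf h V"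
    using U W by (intro H_minf_diff) (auto simp: Sobolev_def)
  ultimately show ?thesis unfolding Sobolev_def by blast
qed

text \<open>Completeness of the eigenfunctions is not needed: \<open>(I + H)^r\<close> annihilates the component of a
  point mass orthogonal to all eigenfunctions, so the representative of an element of the Sobolev
  space lies in the closed span of the eigenfunctions.\<close>

lemma Sobolev_representative_parseval:
  assumes E: "eigenbasis h V E" and U: "U \<in> H_minf h V" and v: "v \<in> ell2 h"
    and repr: "one_plus_H_powr_dual h V r U = embed h V v"
  shows "((\<lambda>e. (cmod (ell2_inner h v e))\<^sup>2) has_sum (ell2_norm h v)\<^sup>2) E"
proof -
  have oE: "orthonormal h E" using E by (simp add: eigenbasis_def)
  note vs = bessel(1)[OF oE v]
  have "v k = orthonormal_series E (ell2_inner h v) k" for k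
  proof (cases "k \<in> lattice h")
    case True
    let ?P = "orthonormal_series E (ell2_inner h (delta k))"
    note d2 = delta_ell2[OF True] and dH = delta_H_inf[OF True, of V]
    note ds = bessel(1)[OF oE d2]
    have P2: "?P \<in> ell2 h" by (rule orthonormal_series_ell2(1)[OF oE ds])
    \<comment> \<open>The part of the point mass orthogonal to all eigenfunctions. It is again a
      test function, so the functional U can be applied to it.\<close>
    define w where "w x = delta k x - ?P x" for x
    have wH: "w \<in> H_inf h V"
      unfolding w_def by (rule H_inf_diff[OF dH eigen_projection_H_inf[OF E dH]])
    have w2: "w \<in> ell2 h" by (rule H_inf_ell2[OF wH])
    have worth: "ell2_inner h w e = 0" if "e \<in> eigenspace h V l" for e l
      unfolding w_def by (rule eigen_projection_residual_orthogonal[OF E d2 that])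
    \<comment> \<open>The duality pairing is bilinear while the inner product is sesquilinear, hence
      the conjugate; conjugation preserves the eigenspaces because H is real.\<close>
    let ?w = "\<lambda>x. cnj (w x)"
    have cwH: "?w \<in> H_inf h V" by (rule H_inf_cnj[OF wH])
    have "ell2_inner h ?w e = 0" if e: "e \<in> eigenspace h V l" for e l
    proof -
      have "ell2_inner h ?w e = cnj (ell2_inner h w (\<lambda>x. cnj (e x)))"
        by (simp add: ell2_inner_def infsum_cnj[symmetric])
      then show ?thesis using worth[OF eigenspace_cnj[OF e]] by simp
    qed
    then have zero: "one_plus_H_powr h V r ?w = (\<lambda>x. 0)"
      by (rule one_plus_H_powr_eq_0[OF ell2_cnj[OF w2]])
    have "\<forall>\<phi>\<in>H_inf h V. \<forall>c. U (\<lambda>x. c * \<phi> x) = c * U \<phi>"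
      using U unfolding H_minf_def by blast
    from this[rule_format, OF cwH, of 0] have "U (\<lambda>x. 0) = 0" by simp
    \<comment> \<open>The power of I + H maps \<open>?w\<close> to 0, so v is orthogonal to w and
      v(k) depends only on the projection of the point mass: v is its own eigenfunction
      series.\<close>
    then have "embed h V v ?w = 0"
      unfolding repr[symmetric] by (simp add: one_plus_H_powr_dual_def zero)
    then have "ell2_inner h v w = 0" unfolding embed_eq[OF cwH] by simp
    then have "ell2_inner h w v = 0" using ell2_inner_commute[of h w v] by simp
    then have "ell2_inner h (delta k) v = ell2_inner h ?P v"
      unfolding w_def using ell2_inner_diff_left[OF d2 P2 v] by simp
    then have "cnj (v k) = ell2_inner h ?P v" by (simp add: ell2_inner_delta_left[OF True])
    moreover have "((\<lambda>e. ell2_inner h (delta k) e * ell2_inner h e v) has_sum ell2_inner h ?P v) E"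
      by (rule orthonormal_series_inner[OF oE ds v])
    ultimately have "((\<lambda>e. cnj (ell2_inner h (delta k) e * ell2_inner h e v)) has_sum cnj (cnj (v k))) E"
      by (simp only: has_sum_cnj_iff)
    moreover have "cnj (ell2_inner h (delta k) e * ell2_inner h e v) = ell2_inner h v e * e k" for e
      using ell2_inner_commute[of h v e] by (simp add: ell2_inner_delta_left[OF True])
    ultimately have "((\<lambda>e. ell2_inner h v e * e k) has_sum v k) E" by simp
    then show ?thesis
      using orthonormal_series_has_sum[OF oE vs] by (rule has_sum_unique)
  next
    case False
    then show ?thesis
      using ell2_vanishes[OF v] ell2_vanishes[OF orthonormal_series_ell2(1)[OF oE vs]] by simp
  qed
  then have "v = orthonormal_series E (ell2_inner h v)" by (rule ext)
  then have "(ell2_norm h v)\<^sup>2 \<le> (\<Sum>\<^sub>\<infinity>e\<in>E. (cmod (ell2_inner h v e))\<^sup>2)"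
    using orthonormal_series_ell2(2)[OF oE vs] by simp
  with bessel(2)[OF oE v] have "(\<Sum>\<^sub>\<infinity>e\<in>E. (cmod (ell2_inner h v e))\<^sup>2) = (ell2_norm h v)\<^sup>2" by simp
  then show ?thesis using has_sum_infsum[OF vs] by simp
qed

text \<open>The family consists of the conjugates of an eigenbasis: the bilinear pairing with the
  conjugate of e yields the coefficient at e. One family and its eigenvalues serve all orders s
  simultaneously, and the norms become weighted sums of the squared values of U.\<close>

lemma Sobolev_eigenbasis:
  fixes V :: "real ^ 'n::finite \<Rightarrow> real"
  assumes V: "\<And>k. k \<in> lattice h \<Longrightarrow> V k \<ge> V0"
  obtains \<Phi> lam where "\<And>\<phi>. \<phi> \<in> \<Phi> \<Longrightarrow> \<phi> \<in> H_inf h V"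
    "\<And>\<phi>. \<phi> \<in> \<Phi> \<Longrightarrow> V0 \<le> lam \<phi>"
    "\<And>\<phi>. \<phi> \<in> \<Phi> \<Longrightarrow> schroedinger h V \<phi> = (\<lambda>x. complex_of_real (lam \<phi>) * \<phi> x)"
    "\<And>s U. U \<in> Sobolev h V s \<Longrightarrow>
      ((\<lambda>\<phi>. (cmod (complex_of_real ((1 + lam \<phi>) powr (s / 2)) * U \<phi>))\<^sup>2) has_sum (Sobolev_norm h V s U)\<^sup>2) \<Phi>"
proof -
  obtain E where E: "eigenbasis h V E" using eigenbasis_exists by blast
  have oE: "orthonormal h E" using E by (simp add: eigenbasis_def)
  define conj where "conj e = (\<lambda>x. cnj (e x))" for e :: "'n lfun"
  define \<Phi> where "\<Phi> = conj ` E"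
  have cc: "conj (conj e) = e" for e by (simp add: conj_def)
  \<comment> \<open>A nonzero function has at most one eigenvalue, so the choice recovers the
    eigenvalue of each basis function.\<close>
  define lam where "lam \<phi> = (SOME l. \<phi> \<in> eigenspace h V l)" for \<phi>
  have lam: "\<phi> \<in> eigenspace h V (lam \<phi>)" if \<phi>: "\<phi> \<in> \<Phi>" for \<phi>
  proof -
    obtain e where e: "e \<in> E" "\<phi> = conj e" using \<phi> unfolding \<Phi>_def by blast
    obtain l where "e \<in> eigenspace h V l" using E e(1) unfolding eigenbasis_def by blast
    then have "\<phi> \<in> eigenspace h V l" unfolding e(2) conj_def by (rule eigenspace_cnj)
    then show ?thesis unfolding lam_def by (rule someI)
  qed
  have ne: "\<phi> \<noteq> (\<lambda>x. 0)" if \<phi>: "\<phi> \<in> \<Phi>" for \<phi>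
  proof
    assume 0: "\<phi> = (\<lambda>x. 0)"
    obtain e where e: "e \<in> E" "\<phi> = conj e" using \<phi> unfolding \<Phi>_def by blast
    have "e = conj \<phi>" using e(2) cc by simp
    then have "e = (\<lambda>x. 0)" by (simp add: 0 conj_def)
    moreover have "ell2_inner h e e = 1" using oE e(1) unfolding orthonormal_def by simp
    ultimately show False by simp
  qed
  show ?thesis
  proof (rule that)
    fix \<phi> assume \<phi>: "\<phi> \<in> \<Phi>"
    show "\<phi> \<in> H_inf h V" by (rule eigenspace_H_inf[OF lam[OF \<phi>]])
    show "V0 \<le> lam \<phi>" by (rule eigenvalue_lower_bound[OF V lam[OF \<phi>] ne[OF \<phi>]])
    show "schroedinger h V \<phi> = (\<lambda>x. complex_of_real (lam \<phi>) * \<phi> x)"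
      using lam[OF \<phi>] by (simp add: eigenspace_iff)
  next
    fix s U assume U: "U \<in> Sobolev h V s"
    obtain v where v: "v \<in> ell2 h" "one_plus_H_powr_dual h V (s / 2) U = embed h V v"
      using U unfolding Sobolev_def by blast
    have UH: "U \<in> H_minf h V" using U by (simp add: Sobolev_def)
    have coef: "complex_of_real ((1 + lam (conj e)) powr (s / 2)) * U (conj e) = ell2_inner h v e" if e: "e \<in> E" for e
    proof -
      have c: "conj e \<in> \<Phi>" using e by (simp add: \<Phi>_def)
      have cH: "conj e \<in> H_inf h V" by (rule eigenspace_H_inf[OF lam[OF c]])
      have "ell2_inner h v e = embed h V v (conj e)"
        unfolding embed_eq[OF cH] using cc[of e] by (simp add: conj_def)
      also have "\<dots> = U (one_plus_H_powr h V (s / 2) (conj e))"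
        unfolding v(2)[symmetric] using cH by (simp add: one_plus_H_powr_dual_def)
      also have "\<dots> = complex_of_real ((1 + lam (conj e)) powr (s / 2)) * U (conj e)"
        unfolding one_plus_H_powr_eigenspace[OF lam[OF c] ne[OF c]]
        using UH cH unfolding H_minf_def by blast
      finally show ?thesis by simp
    qed
    have inj: "inj_on conj E" by (metis cc inj_onI)
    have "((\<lambda>e. (cmod (ell2_inner h v e))\<^sup>2) has_sum (ell2_norm h v)\<^sup>2) E"
      by (rule Sobolev_representative_parseval[OF E UH v])
    then have "((\<lambda>e. (cmod (complex_of_real ((1 + lam (conj e)) powr (s / 2)) * U (conj e)))\<^sup>2) has_sum (Sobolev_norm h V s U)\<^sup>2) E"
      using coef by (subst has_sum_cong[where g = "\<lambda>e. (cmod (ell2_inner h v e))\<^sup>2"]) (simp_all add: Sobolev_norm_eq[OF v])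
    then show "((\<lambda>\<phi>. (cmod (complex_of_real ((1 + lam \<phi>) powr (s / 2)) * U \<phi>))\<^sup>2) has_sum (Sobolev_norm h V s U)\<^sup>2) \<Phi>"
      unfolding \<Phi>_def by (subst has_sum_reindex[OF inj]) (simp add: comp_def)
  qed
qed

section \<open>Curves of square summable coefficients\<close>

text \<open>Continuity of a Sobolev curve in coefficient form. An \<open>infsum\<close> over a
  family that is not summable is 0, so the limit clause would be meaningless without summability at
  each time.\<close>

definition l2_continuous_on :: "'i set \<Rightarrow> real set \<Rightarrow> (real \<Rightarrow> 'i \<Rightarrow> complex) \<Rightarrow> bool" where
  "l2_continuous_on \<Phi> I c \<longleftrightarrow> (\<forall>t\<in>I. (\<lambda>i. (cmod (c t i))\<^sup>2) summable_on \<Phi>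
     \<and> ((\<lambda>r. \<Sum>\<^sub>\<infinity>i\<in>\<Phi>. (cmod (c r i - c t i))\<^sup>2) \<longlongrightarrow> 0) (at t within I))"

lemma power2_summable_diff:
  fixes x y :: "'i \<Rightarrow> complex"
  assumes "(\<lambda>i. (cmod (x i))\<^sup>2) summable_on \<Phi>" "(\<lambda>i. (cmod (y i))\<^sup>2) summable_on \<Phi>"
  shows "(\<lambda>i. (cmod (x i - y i))\<^sup>2) summable_on \<Phi>"
proof -
  have "(\<lambda>i. 2 * (cmod (x i))\<^sup>2 + 2 * (cmod (y i))\<^sup>2) summable_on \<Phi>"
    using assms by (intro summable_on_add summable_on_cmult_right)
  then show ?thesis
  proof (rule summable_on_comparison_test)
    show "(cmod (x i - y i))\<^sup>2 \<le> 2 * (cmod (x i))\<^sup>2 + 2 * (cmod (y i))\<^sup>2" for i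
      using norm_add_power2_le[of "x i" "- y i"] by simp
  qed auto
qed

lemma l2_continuous_on_nearby:
  assumes c: "l2_continuous_on \<Phi> I c" and t: "t \<in> I" and \<eta>: "0 < \<eta>"
  shows "\<exists>d>0. \<forall>r\<in>I. \<bar>r - t\<bar> < d \<longrightarrow> (\<Sum>\<^sub>\<infinity>i\<in>\<Phi>. (cmod (c r i - c t i))\<^sup>2) \<le> \<eta>"
proof -
  have "((\<lambda>r. \<Sum>\<^sub>\<infinity>i\<in>\<Phi>. (cmod (c r i - c t i))\<^sup>2) \<longlongrightarrow> 0) (at t within I)"
    using c t by (simp add: l2_continuous_on_def)
  then have "\<forall>\<^sub>F r in at t within I. (\<Sum>\<^sub>\<infinity>i\<in>\<Phi>. (cmod (c r i - c t i))\<^sup>2) < \<eta>"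
    using \<eta> by (rule order_tendstoD(2))
  then obtain d where d: "d > 0" "\<And>r. r \<in> I \<Longrightarrow> r \<noteq> t \<Longrightarrow> dist r t < d \<Longrightarrow> (\<Sum>\<^sub>\<infinity>i\<in>\<Phi>. (cmod (c r i - c t i))\<^sup>2) < \<eta>"
    unfolding eventually_at by metis
  have "(\<Sum>\<^sub>\<infinity>i\<in>\<Phi>. (cmod (c r i - c t i))\<^sup>2) \<le> \<eta>" if "r \<in> I" "\<bar>r - t\<bar> < d" for r
    using d(2)[of r] that \<eta> by (cases "r = t") (auto simp: dist_real_def intro: less_imp_le)
  with d(1) show ?thesis by blast
qed

lemma l2_diff_summable:
  assumes c: "l2_continuous_on \<Phi> I c" and "t \<in> I" "r \<in> I"
  shows "(\<lambda>i. (cmod (c r i - c t i))\<^sup>2) summable_on \<Phi>"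
  by (rule power2_summable_diff) (use assms in \<open>auto simp: l2_continuous_on_def\<close>)

lemma l2_coordinate_continuous:
  assumes c: "l2_continuous_on \<Phi> I c" and i: "i \<in> \<Phi>"
  shows "continuous_on I (\<lambda>t. c t i)"
  unfolding continuous_on_def
proof
  fix t assume t: "t \<in> I"
  have "((\<lambda>r. sqrt (\<Sum>\<^sub>\<infinity>i\<in>\<Phi>. (cmod (c r i - c t i))\<^sup>2)) \<longlongrightarrow> sqrt 0) (at t within I)"
    using c t by (intro tendsto_real_sqrt) (simp add: l2_continuous_on_def)
  moreover have "\<forall>\<^sub>F r in at t within I. norm (c r i - c t i) \<le> sqrt (\<Sum>\<^sub>\<infinity>i\<in>\<Phi>. (cmod (c r i - c t i))\<^sup>2)"
    unfolding eventually_at_filter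
  proof (intro always_eventually allI impI)
    fix r assume "r \<in> I"
    then have "(\<Sum>i\<in>{i}. (cmod (c r i - c t i))\<^sup>2) \<le> (\<Sum>\<^sub>\<infinity>i\<in>\<Phi>. (cmod (c r i - c t i))\<^sup>2)"
      using i t by (intro finite_sum_le_infsum l2_diff_summable[OF c]) auto
    then show "norm (c r i - c t i) \<le> sqrt (\<Sum>\<^sub>\<infinity>i\<in>\<Phi>. (cmod (c r i - c t i))\<^sup>2)"
      by (intro real_le_rsqrt) simp
  qed
  ultimately have "((\<lambda>r. c r i - c t i) \<longlongrightarrow> 0) (at t within I)"
    by (simp add: Lim_null_comparison)
  then show "((\<lambda>t. c t i) \<longlongrightarrow> c t i) (at t within I)" by (rule Lim_null[THEN iffD2])
qed

lemma norm_power2_le_via: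
  fixes x y z :: complex
  shows "(cmod (x - y))\<^sup>2 \<le> 2 * (cmod (x - z))\<^sup>2 + 2 * (cmod (y - z))\<^sup>2"
  using norm_add_power2_le[of "x - z" "z - y"] by (simp add: norm_minus_commute)

text \<open>A Lebesgue number argument. Two nearby times lie close to a common centre; squared
  distances double in the triangle inequality, so \<eta> / 4 from each side adds up to
  \<eta>.\<close>

lemma l2_uniformly_continuous:
  assumes c: "l2_continuous_on \<Phi> I c" and I: "compact I" and \<eta>: "0 < \<eta>"
  shows "\<exists>d>0. \<forall>r\<in>I. \<forall>t\<in>I. \<bar>r - t\<bar> < d \<longrightarrow> (\<Sum>\<^sub>\<infinity>i\<in>\<Phi>. (cmod (c r i - c t i))\<^sup>2) \<le> \<eta>"
proof -
  let ?D = "\<lambda>r t. \<Sum>\<^sub>\<infinity>i\<in>\<Phi>. (cmod (c r i - c t i))\<^sup>2"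
  have "\<exists>d>0. \<forall>r\<in>I. \<bar>r - t\<bar> < d \<longrightarrow> ?D r t \<le> \<eta> / 4" if "t \<in> I" for t
    using l2_continuous_on_nearby[OF c that, of "\<eta> / 4"] \<eta> by simp
  then obtain d where d: "\<And>t. t \<in> I \<Longrightarrow> d t > 0"
    "\<And>t r. t \<in> I \<Longrightarrow> r \<in> I \<Longrightarrow> \<bar>r - t\<bar> < d t \<Longrightarrow> ?D r t \<le> \<eta> / 4" by metis
  obtain e where e: "0 < e" "\<And>t. t \<in> I \<Longrightarrow> \<exists>G\<in>(\<lambda>x. ball x (d x)) ` I. ball t e \<subseteq> G"
  proof (rule Heine_Borel_lemma[OF I])
    show "I \<subseteq> \<Union> ((\<lambda>x. ball x (d x)) ` I)" using d(1) by force
  qed auto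
  have "?D r t \<le> \<eta>" if rt: "r \<in> I" "t \<in> I" "\<bar>r - t\<bar> < e" for r t
  proof -
    obtain x where x: "x \<in> I" "ball t e \<subseteq> ball x (d x)" using e(2)[OF rt(2)] by blast
    have "r \<in> ball x (d x)" "t \<in> ball x (d x)"
      using x(2) rt e(1) by (auto simp: dist_real_def subset_iff abs_minus_commute)
    then have le: "?D r x \<le> \<eta> / 4" "?D t x \<le> \<eta> / 4"
      using d(2)[OF x(1)] rt by (auto simp: dist_real_def abs_minus_commute)
    note s = l2_diff_summable[OF c x(1) rt(1)] l2_diff_summable[OF c x(1) rt(2)]
    have "?D r t \<le> (\<Sum>\<^sub>\<infinity>i\<in>\<Phi>. 2 * (cmod (c r i - c x i))\<^sup>2 + 2 * (cmod (c t i - c x i))\<^sup>2)"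
      by (intro infsum_mono l2_diff_summable[OF c rt(2,1)] summable_on_add summable_on_cmult_right s norm_power2_le_via)
    also have "\<dots> = 2 * ?D r x + 2 * ?D t x"
      by (simp add: infsum_add summable_on_cmult_right s infsum_cmult_right)
    finally show ?thesis using le by simp
  qed
  with e(1) show ?thesis by blast
qed

text \<open>The curve has compact image in l2, hence uniformly small tails: a finite net of times,
  each with its own finite set of large coefficients. The distance to the net and the tail at the
  net point enter doubled, which is why both are taken at \<eta> / 4.\<close>

lemma l2_uniform_tails:
  assumes c: "l2_continuous_on \<Phi> I c" and I: "compact I" and \<eta>: "0 < \<eta>"
  shows "\<exists>S0. finite S0 \<and> S0 \<subseteq> \<Phi> \<and>
    (\<forall>t\<in>I. \<forall>S. finite S \<longrightarrow> S \<subseteq> \<Phi> - S0 \<longrightarrow> (\<Sum>i\<in>S. (cmod (c t i))\<^sup>2) \<le> \<eta>)"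
proof -
  let ?D = "\<lambda>r t. \<Sum>\<^sub>\<infinity>i\<in>\<Phi>. (cmod (c r i - c t i))\<^sup>2"
  obtain d where d: "d > 0" "\<And>r t. r \<in> I \<Longrightarrow> t \<in> I \<Longrightarrow> \<bar>r - t\<bar> < d \<Longrightarrow> ?D r t \<le> \<eta> / 4"
    using l2_uniformly_continuous[OF c I, of "\<eta> / 4"] \<eta> by auto
  obtain X where X: "finite X" "X \<subseteq> I" "I \<subseteq> (\<Union>x\<in>X. ball x d)"
    using compactE_image[OF I, of I "\<lambda>x. ball x d"] d(1) by (metis UN_I centre_in_ball open_ball subsetI)
  have "\<exists>F. finite F \<and> F \<subseteq> \<Phi> \<and> (\<forall>S. finite S \<longrightarrow> S \<subseteq> \<Phi> - F \<longrightarrow> (\<Sum>i\<in>S. (cmod (c x i))\<^sup>2) \<le> \<eta> / 4)" if x: "x \<in> X" for x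
  proof -
    have s: "(\<lambda>i. (cmod (c x i))\<^sup>2) summable_on \<Phi>"
      using c x X(2) by (auto simp: l2_continuous_on_def)
    have "\<eta> / 4 > 0" using \<eta> by simp
    from infsum_finite_approximation[OF s this] obtain F where F: "finite F" "F \<subseteq> \<Phi>"
      "dist (\<Sum>i\<in>F. (cmod (c x i))\<^sup>2) (\<Sum>\<^sub>\<infinity>i\<in>\<Phi>. (cmod (c x i))\<^sup>2) \<le> \<eta> / 4" by auto
    have "(\<Sum>i\<in>S. (cmod (c x i))\<^sup>2) \<le> \<eta> / 4" if S: "finite S" "S \<subseteq> \<Phi> - F" for S
    proof -
      have "(\<Sum>i\<in>F \<union> S. (cmod (c x i))\<^sup>2) \<le> (\<Sum>\<^sub>\<infinity>i\<in>\<Phi>. (cmod (c x i))\<^sup>2)"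
        using F S by (intro finite_sum_le_infsum s) auto
      moreover have "(\<Sum>i\<in>F \<union> S. (cmod (c x i))\<^sup>2) = (\<Sum>i\<in>F. (cmod (c x i))\<^sup>2) + (\<Sum>i\<in>S. (cmod (c x i))\<^sup>2)"
        using F S by (intro sum.union_disjoint) auto
      ultimately show ?thesis using F(3) unfolding dist_real_def by linarith
    qed
    with F show ?thesis by blast
  qed
  then obtain F where F: "\<And>x. x \<in> X \<Longrightarrow> finite (F x)" "\<And>x. x \<in> X \<Longrightarrow> F x \<subseteq> \<Phi>"
    "\<And>x S. x \<in> X \<Longrightarrow> finite S \<Longrightarrow> S \<subseteq> \<Phi> - F x \<Longrightarrow> (\<Sum>i\<in>S. (cmod (c x i))\<^sup>2) \<le> \<eta> / 4" by metis
  have "(\<Sum>i\<in>S. (cmod (c t i))\<^sup>2) \<le> \<eta>" if t: "t \<in> I" and S: "finite S" "S \<subseteq> \<Phi> - (\<Union>x\<in>X. F x)" for t S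
  proof -
    obtain x where x: "x \<in> X" "\<bar>t - x\<bar> < d"
      using X(3) t by (auto simp: dist_real_def abs_minus_commute)
    have xI: "x \<in> I" using x X by blast
    have "(\<Sum>i\<in>S. (cmod (c t i))\<^sup>2) \<le> (\<Sum>i\<in>S. 2 * (cmod (c t i - c x i))\<^sup>2 + 2 * (cmod (c x i))\<^sup>2)"
    proof (rule sum_mono)
      show "(cmod (c t i))\<^sup>2 \<le> 2 * (cmod (c t i - c x i))\<^sup>2 + 2 * (cmod (c x i))\<^sup>2" for i
        using norm_add_power2_le[of "c t i - c x i" "c x i"] by simp
    qed
    also have "\<dots> = 2 * (\<Sum>i\<in>S. (cmod (c t i - c x i))\<^sup>2) + 2 * (\<Sum>i\<in>S. (cmod (c x i))\<^sup>2)"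
      by (simp add: sum.distrib sum_distrib_left)
    also have "(\<Sum>i\<in>S. (cmod (c t i - c x i))\<^sup>2) \<le> ?D t x"
      using S by (intro finite_sum_le_infsum l2_diff_summable[OF c xI t]) auto
    also have "?D t x \<le> \<eta> / 4" by (rule d(2)[OF t xI x(2)])
    also have "(\<Sum>i\<in>S. (cmod (c x i))\<^sup>2) \<le> \<eta> / 4"
      using S x(1) by (intro F(3)) auto
    finally show ?thesis by simp
  qed
  then show ?thesis using X(1) F(1,2) by (intro exI[of _ "\<Union>x\<in>X. F x"]) blast
qed

section \<open>Convergence of the modes\<close>

context decreasing_kernel
begin

lemma kernel_scaleR_integrable:
  fixes v :: "real \<Rightarrow> complex"
  assumes T: "0 < T" and v: "continuous_on {0..T} v" and t: "t \<in> {0..T}"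
  shows "set_integrable lborel {0<..T} (\<lambda>s. k s *\<^sub>R (v (max 0 (t - s)) - v 0))"
proof -
  define v' where "v' x = v (max 0 (min T x))" for x
  have "continuous_on UNIV v'"
    unfolding v'_def by (rule continuous_on_compose2[OF v]) (use T in \<open>auto intro!: continuous_intros\<close>)
  then have v'm[measurable]: "v' \<in> borel_measurable borel" by (rule borel_measurable_continuous_onI)
  have "bounded (v ` {0..T})"
    by (intro compact_imp_bounded compact_continuous_image v) simp
  then obtain C where "\<And>x. x \<in> {0..T} \<Longrightarrow> norm (v x) \<le> C"
    unfolding bounded_iff by force
  then have C: "norm (v' x) \<le> C" for x using T by (simp add: v'_def)
  have "norm (v' (t - s) - v 0) \<le> C + norm (v 0)" for s
    using norm_triangle_ineq4[of "v' (t - s)" "v 0"] C[of "t - s"] by linarith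
  then have "set_integrable lborel {0..T} (\<lambda>s. k s *\<^sub>R (v' (t - s) - v 0))"
    by (intro set_integrable_scaleR_bounded(1)[OF kernel_integrable, where B = "C + norm (v 0)"]) measurable
  then have "set_integrable lborel {0<..T} (\<lambda>s. k s *\<^sub>R (v' (t - s) - v 0))"
    by (rule set_integrable_subset) auto
  moreover have "set_integrable lborel {0<..T} (\<lambda>s. k s *\<^sub>R (v' (t - s) - v 0)) \<longleftrightarrow>
      set_integrable lborel {0<..T} (\<lambda>s. k s *\<^sub>R (v (max 0 (t - s)) - v 0))"
    using t by (intro set_integrable_cong refl) (auto simp: v'_def)
  ultimately show ?thesis by simp
qed

text \<open>The factor b(t) l(i) is real, so real and imaginary parts satisfy the same equation
  separately. Indexing by S times the booleans turns them into a real system with the same sum of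
  squares.\<close>

lemma complex_maximum_principle:
  fixes v F :: "'i \<Rightarrow> real \<Rightarrow> complex"
  assumes S: "finite S" and T: "0 < T" and \<kappa>: "0 < \<kappa>"
    and vc: "\<And>i. i \<in> S \<Longrightarrow> continuous_on {0..T} (v i)"
    and Fc: "\<And>i. i \<in> S \<Longrightarrow> continuous_on {0..T} (F i)"
    and bc: "continuous_on {0..T} b"
    and low: "\<And>i t. i \<in> S \<Longrightarrow> t \<in> {0..T} \<Longrightarrow> \<kappa> \<le> b t * l i"
    and eq: "\<And>i t. i \<in> S \<Longrightarrow> t \<in> {0..T} \<Longrightarrow>
      (LINT s:{0<..T}|lborel. k s *\<^sub>R (v i (max 0 (t - s)) - v i 0)) =
        integral {0..t} (\<lambda>\<tau>. F i \<tau> - of_real (b \<tau> * l i) * v i \<tau>)"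
    and init: "(\<Sum>i\<in>S. (cmod (v i 0))\<^sup>2) \<le> B"
    and source: "\<And>t. t \<in> {0..T} \<Longrightarrow> (\<Sum>i\<in>S. (cmod (F i t))\<^sup>2) \<le> \<kappa>\<^sup>2 * B"
    and t: "t \<in> {0..T}"
  shows "(\<Sum>i\<in>S. (cmod (v i t))\<^sup>2) \<le> B"
proof -
  define P where "P p z = (if p then Re z else Im z)" for p z
  have split: "(\<Sum>j\<in>S \<times> UNIV. (P (snd j) (h (fst j)))\<^sup>2) = (\<Sum>i\<in>S. (cmod (h i))\<^sup>2)" for h
    unfolding sum.cartesian_product' by (simp add: P_def UNIV_bool cmod_power2 add.commute)
  have Plin: "bounded_linear (P p)" for p
    unfolding P_def[abs_def] by (cases p) (simp_all add: bounded_linear_Re bounded_linear_Im)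
  have Pc: "continuous_on A (\<lambda>x. P p (h x))" if "continuous_on A h" for A p h
    using bounded_linear.continuous_on[OF Plin that] .
  have "(\<Sum>j\<in>S \<times> UNIV. (P (snd j) (v (fst j) t))\<^sup>2) \<le> B"
  proof (rule maximum_principle[where S = "S \<times> UNIV" and T = T and v = "\<lambda>j t. P (snd j) (v (fst j) t)"
        and F = "\<lambda>j t. P (snd j) (F (fst j) t)" and l = "\<lambda>j. l (fst j)" and b = b and \<kappa> = \<kappa>])
    fix j t assume j: "j \<in> S \<times> (UNIV :: bool set)" and t: "t \<in> {0..T}"
    let ?i = "fst j" and ?p = "snd j"
    have i: "?i \<in> S" using j by auto
    have int: "integrable lborel (\<lambda>s. indicator {0<..T} s *\<^sub>R (k s *\<^sub>R (v ?i (max 0 (t - s)) - v ?i 0)))"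
      using kernel_scaleR_integrable[OF T vc[OF i] t] by (simp add: set_integrable_def)
    have "(LINT s:{0<..T}|lborel. k s * (P ?p (v ?i (max 0 (t - s))) - P ?p (v ?i 0))) =
        P ?p (LINT s:{0<..T}|lborel. k s *\<^sub>R (v ?i (max 0 (t - s)) - v ?i 0))"
      unfolding set_lebesgue_integral_def
      by (subst integral_bounded_linear[OF Plin int, symmetric])
         (simp add: linear_scale[OF bounded_linear.linear[OF Plin]] linear_diff[OF bounded_linear.linear[OF Plin]] mult.assoc)
    also have "\<dots> = P ?p (integral {0..t} (\<lambda>\<tau>. F ?i \<tau> - of_real (b \<tau> * l ?i) * v ?i \<tau>))"
      by (simp only: eq[OF i t])
    also have "\<dots> = integral {0..t} (\<lambda>\<tau>. P ?p (F ?i \<tau> - of_real (b \<tau> * l ?i) * v ?i \<tau>))"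
    proof (subst integral_linear[OF _ Plin, symmetric])
      have "continuous_on {0..t} (\<lambda>\<tau>. F ?i \<tau> - of_real (b \<tau> * l ?i) * v ?i \<tau>)"
        using t by (intro continuous_intros continuous_on_subset[OF Fc[OF i]] continuous_on_subset[OF bc]
            continuous_on_subset[OF vc[OF i]]) auto
      then show "(\<lambda>\<tau>. F ?i \<tau> - of_real (b \<tau> * l ?i) * v ?i \<tau>) integrable_on {0..t}"
        by (rule integrable_continuous_interval)
    qed (simp add: comp_def)
    also have "(\<lambda>\<tau>. P ?p (F ?i \<tau> - of_real (b \<tau> * l ?i) * v ?i \<tau>)) = (\<lambda>\<tau>. P ?p (F ?i \<tau>) - b \<tau> * l ?i * P ?p (v ?i \<tau>))"
      by (simp add: P_def fun_eq_iff)
    finally show "(LINT s:{0<..T}|lborel. k s * (P ?p (v ?i (max 0 (t - s))) - P ?p (v ?i 0))) =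
        integral {0..t} (\<lambda>\<tau>. P ?p (F ?i \<tau>) - b \<tau> * l ?i * P ?p (v ?i \<tau>))" .
  next
    show "(\<Sum>j\<in>S \<times> UNIV. (P (snd j) (v (fst j) 0))\<^sup>2) \<le> B"
      using init split[of "\<lambda>i. v i 0"] by simp
    show "(\<Sum>j\<in>S \<times> UNIV. (P (snd j) (F (fst j) t))\<^sup>2) \<le> \<kappa>\<^sup>2 * B" if "t \<in> {0..T}" for t
      using source[OF that] split[of "\<lambda>i. F i t"] by simp
    show "continuous_on {0..T} (\<lambda>t. P (snd j) (v (fst j) t))" "continuous_on {0..T} (\<lambda>t. P (snd j) (F (fst j) t))"
      if "j \<in> S \<times> UNIV" for j
      using that by (auto intro: Pc[OF vc] Pc[OF Fc])
    show "\<kappa> \<le> b t * l (fst j)" if "j \<in> S \<times> UNIV" "t \<in> {0..T}" for j t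
      using that by (intro low) auto
  qed (use S T \<kappa> bc t in auto)
  then show ?thesis using split[of "\<lambda>i. v i t"] by simp
qed

text \<open>The problem reduced to coefficients in the target norm. Quantifying over all finite S
  with one bound takes the place of infinite sums and lets the finite maximum principle be used
  directly.\<close>

lemma mode_convergence:
  fixes c f :: "real \<Rightarrow> 'i \<Rightarrow> complex" and cn fn :: "real \<Rightarrow> real \<Rightarrow> 'i \<Rightarrow> complex"
    and a :: "real \<Rightarrow> real" and an :: "real \<Rightarrow> real \<Rightarrow> real"
  assumes T: "0 < T" and V0: "0 < V0" and lam: "\<And>i. i \<in> \<Phi> \<Longrightarrow> V0 \<le> lam i"
    and c: "l2_continuous_on \<Phi> {0..T} c" and f: "l2_continuous_on \<Phi> {0..T} f"
    and ac: "continuous_on {0..T} a" and a0: "0 < a0" "\<And>t. t \<in> {0..T} \<Longrightarrow> a0 \<le> a t"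
    and cnc: "\<And>\<epsilon> i. \<epsilon> \<in> {0<..1} \<Longrightarrow> i \<in> \<Phi> \<Longrightarrow> continuous_on {0..T} (\<lambda>t. cn \<epsilon> t i)"
    and fnc: "\<And>\<epsilon> i. \<epsilon> \<in> {0<..1} \<Longrightarrow> i \<in> \<Phi> \<Longrightarrow> continuous_on {0..T} (\<lambda>t. fn \<epsilon> t i)"
    and anc: "\<And>\<epsilon>. \<epsilon> \<in> {0<..1} \<Longrightarrow> continuous_on {0..T} (an \<epsilon>)"
    and eq: "\<And>i t. i \<in> \<Phi> \<Longrightarrow> t \<in> {0..T} \<Longrightarrow>
      (LINT s:{0<..T}|lborel. k s *\<^sub>R (c (max 0 (t - s)) i - c 0 i)) =
        integral {0..t} (\<lambda>\<tau>. f \<tau> i - of_real (a \<tau> * lam i) * c \<tau> i)"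
    and eqn: "\<And>\<epsilon> i t. \<epsilon> \<in> {0<..1} \<Longrightarrow> i \<in> \<Phi> \<Longrightarrow> t \<in> {0..T} \<Longrightarrow>
      (LINT s:{0<..T}|lborel. k s *\<^sub>R (cn \<epsilon> (max 0 (t - s)) i - cn \<epsilon> 0 i)) =
        integral {0..t} (\<lambda>\<tau>. fn \<epsilon> \<tau> i - of_real (an \<epsilon> \<tau> * lam i) * cn \<epsilon> \<tau> i)"
    and init: "\<And>\<epsilon> i. \<epsilon> \<in> {0<..1} \<Longrightarrow> i \<in> \<Phi> \<Longrightarrow> cn \<epsilon> 0 i = c 0 i"
    and an: "\<And>\<eta>. 0 < \<eta> \<Longrightarrow> \<forall>\<^sub>F \<epsilon> in at_right 0. \<forall>t\<in>{0..T}. \<bar>an \<epsilon> t - a t\<bar> \<le> \<eta>"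
    and fn: "\<And>\<eta>. 0 < \<eta> \<Longrightarrow> \<forall>\<^sub>F \<epsilon> in at_right 0. \<forall>t\<in>{0..T}. \<forall>S. finite S \<longrightarrow> S \<subseteq> \<Phi> \<longrightarrow>
      (\<Sum>i\<in>S. (cmod (fn \<epsilon> t i - f t i))\<^sup>2) \<le> \<eta>"
    and \<eta>: "0 < \<eta>"
  shows "\<forall>\<^sub>F \<epsilon> in at_right 0. \<forall>t\<in>{0..T}. \<forall>S. finite S \<longrightarrow> S \<subseteq> \<Phi> \<longrightarrow>
      (\<Sum>i\<in>S. (cmod (cn \<epsilon> t i - c t i))\<^sup>2) \<le> \<eta>"
proof -
  \<comment> \<open>Once the regularized coefficient is within a0 / 2 of a, its product with every
    eigenvalue is at least this number.\<close>
  define \<kappa> where "\<kappa> = a0 / 2 * V0"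
  have \<kappa>: "0 < \<kappa>" using a0(1) V0 by (simp add: \<kappa>_def)
  have le2: "(\<Sum>i\<in>S. (cmod (x i + y i))\<^sup>2) \<le> 2 * (\<Sum>i\<in>S. (cmod (x i))\<^sup>2) + 2 * (\<Sum>i\<in>S. (cmod (y i))\<^sup>2)"
    for S :: "'i set" and x y
  proof -
    have "(\<Sum>i\<in>S. (cmod (x i + y i))\<^sup>2) \<le> (\<Sum>i\<in>S. 2 * (cmod (x i))\<^sup>2 + 2 * (cmod (y i))\<^sup>2)"
      by (intro sum_mono norm_add_power2_le)
    then show ?thesis by (simp add: sum.distrib sum_distrib_left)
  qed
  have cc: "continuous_on {0..T} (\<lambda>t. c t i)" "continuous_on {0..T} (\<lambda>t. f t i)" if "i \<in> \<Phi>" for i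
    using l2_coordinate_continuous[OF c that] l2_coordinate_continuous[OF f that] .
  \<comment> \<open>On the high modes both solutions have squared norm at most B, so their
    difference has at most 4 B = \<eta> / 4; the low modes get \<eta> / 2.\<close>
  define B where "B = \<eta> / 16"
  have B: "0 < B" using \<eta> by (simp add: B_def)
  from l2_uniform_tails[OF c compact_Icc B]
  obtain S1 where S1': "finite S1 \<and> S1 \<subseteq> \<Phi> \<and>
      (\<forall>t\<in>{0..T}. \<forall>S. finite S \<longrightarrow> S \<subseteq> \<Phi> - S1 \<longrightarrow> (\<Sum>i\<in>S. (cmod (c t i))\<^sup>2) \<le> B)"
    by (rule exE)
  note S1 = S1'[THEN conjunct1] S1'[THEN conjunct2, THEN conjunct1] S1'[THEN conjunct2, THEN conjunct2, rule_format]
  \<comment> \<open>The regularized source is f plus an error; with \<kappa>^2 B / 4 for each and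
    the factor 2 of the squared triangle inequality it meets the threshold \<kappa>^2 B of the
    maximum principle.\<close>
  have \<kappa>B: "0 < \<kappa>\<^sup>2 * B / 4" using \<kappa> B by simp
  from l2_uniform_tails[OF f compact_Icc \<kappa>B]
  obtain S2 where S2': "finite S2 \<and> S2 \<subseteq> \<Phi> \<and>
      (\<forall>t\<in>{0..T}. \<forall>S. finite S \<longrightarrow> S \<subseteq> \<Phi> - S2 \<longrightarrow> (\<Sum>i\<in>S. (cmod (f t i))\<^sup>2) \<le> \<kappa>\<^sup>2 * B / 4)"
    by (rule exE)
  note S2 = S2'[THEN conjunct1] S2'[THEN conjunct2, THEN conjunct1] S2'[THEN conjunct2, THEN conjunct2, rule_format]
  \<comment> \<open>Chosen from the limit data alone, hence independent of \<epsilon>. This fixes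
    the bound C below before \<epsilon> is made small.\<close>
  define S0 where "S0 = S1 \<union> S2"
  have S0: "finite S0" "S0 \<subseteq> \<Phi>" using S1 S2 by (auto simp: S0_def)
  have "continuous_on {0..T} (\<lambda>t. \<Sum>i\<in>S0. (lam i * cmod (c t i))\<^sup>2)"
  proof (intro continuous_intros)
    fix i assume "i \<in> S0"
    then show "continuous_on {0..T} (\<lambda>t. c t i)" using S0(2) by (intro cc) auto
  qed
  then have "bounded ((\<lambda>t. \<Sum>i\<in>S0. (lam i * cmod (c t i))\<^sup>2) ` {0..T})"
    by (rule compact_imp_bounded[OF compact_continuous_image[OF _ compact_Icc]])
  then obtain C where "\<forall>z\<in>(\<lambda>t. \<Sum>i\<in>S0. (lam i * cmod (c t i))\<^sup>2) ` {0..T}. norm z \<le> C"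
    unfolding bounded_iff by (rule exE)
  then have C: "(\<Sum>i\<in>S0. (lam i * cmod (c t i))\<^sup>2) \<le> C" if "t \<in> {0..T}" for t
    using that by (metis (no_types, lifting) abs_le_D1 imageI real_norm_def)
  have "0 \<le> (\<Sum>i\<in>S0. (lam i * cmod (c 0 i))\<^sup>2)" by (intro sum_nonneg) simp
  also have "\<dots> \<le> C" using C[of 0] T by simp
  finally have C0: "0 \<le> C" .
  \<comment> \<open>The first entry keeps the coefficient above a0 / 2; the second makes the squared
    commutator term, of size \<eta>a^2 C, use at most half of its share of the source bound. The
    summand 1 covers C = 0.\<close>
  define \<eta>a where "\<eta>a = min (a0 / 2) (sqrt (\<kappa>\<^sup>2 * \<eta> / (8 * C + 1)))"
  have \<eta>a: "0 < \<eta>a" using a0(1) \<kappa> \<eta> C0 by (simp add: \<eta>a_def add_nonneg_pos)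
  have "\<eta>a\<^sup>2 \<le> (sqrt (\<kappa>\<^sup>2 * \<eta> / (8 * C + 1)))\<^sup>2"
    using \<eta>a by (intro power_mono) (simp_all add: \<eta>a_def)
  also have "\<dots> = \<kappa>\<^sup>2 * \<eta> / (8 * C + 1)" using \<eta> C0 by (intro real_sqrt_pow2) auto
  finally have "\<eta>a\<^sup>2 * (8 * C + 1) \<le> \<kappa>\<^sup>2 * \<eta>" using C0 by (simp add: pos_le_divide_eq)
  then have \<eta>aC: "2 * (\<eta>a\<^sup>2 * C) \<le> \<kappa>\<^sup>2 * \<eta> / 4"
    using zero_le_power2[of \<eta>a] unfolding distrib_left by linarith
  from fn[OF \<kappa>B] an[OF \<eta>a] eventually_at_right_real[of 0 1, simplified]
  show ?thesis
  proof eventually_elim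
    case (elim \<epsilon>)
    then have \<epsilon>: "\<epsilon> \<in> {0<..1}" by auto
    have fe: "(\<Sum>i\<in>S. (cmod (fn \<epsilon> t i - f t i))\<^sup>2) \<le> \<kappa>\<^sup>2 * B / 4" if "t \<in> {0..T}" "finite S" "S \<subseteq> \<Phi>" for t S
      using elim that by blast
    have ae: "\<bar>an \<epsilon> t - a t\<bar> \<le> \<eta>a" if "t \<in> {0..T}" for t using elim that by blast
    have low: "\<kappa> \<le> an \<epsilon> t * lam i" if "i \<in> \<Phi>" "t \<in> {0..T}" for i t
    proof -
      have "\<bar>an \<epsilon> t - a t\<bar> \<le> a0 / 2" using ae[OF that(2)] by (simp add: \<eta>a_def)
      then have "a0 / 2 \<le> an \<epsilon> t" using a0(2)[OF that(2)] by linarith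
      then show ?thesis unfolding \<kappa>_def using lam[OF that(1)] V0 a0(1) by (intro mult_mono) auto
    qed
    \<comment> \<open>No equation for the difference is used here: \<open>cn\<close> is bounded by
      the maximum principle from the small tails of the common initial value and of its source, and
      c by the choice of \<open>S1\<close>.\<close>
    have tail: "(\<Sum>i\<in>S. (cmod (cn \<epsilon> t i - c t i))\<^sup>2) \<le> 4 * B"
      if t: "t \<in> {0..T}" and S: "finite S" "S \<subseteq> \<Phi> - S0" for t S
    proof -
      have S': "S \<subseteq> \<Phi>" "S \<subseteq> \<Phi> - S1" "S \<subseteq> \<Phi> - S2" using S by (auto simp: S0_def)
      have "(\<Sum>i\<in>S. (cmod (cn \<epsilon> t i))\<^sup>2) \<le> B"
      proof (rule complex_maximum_principle[where T = T and F = "\<lambda>i t. fn \<epsilon> t i" and b = "an \<epsilon>" and l = lam and \<kappa> = \<kappa>])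
        show "(\<Sum>i\<in>S. (cmod (cn \<epsilon> 0 i))\<^sup>2) \<le> B"
          using S1(3)[OF _ S(1) S'(2), of 0] T init[OF \<epsilon>] S'(1) by (simp add: subset_iff cong: sum.cong)
        show "(\<Sum>i\<in>S. (cmod (fn \<epsilon> t i))\<^sup>2) \<le> \<kappa>\<^sup>2 * B" if t: "t \<in> {0..T}" for t
          using le2[where x = "\<lambda>i. fn \<epsilon> t i - f t i" and y = "\<lambda>i. f t i" and S = S]
            fe[OF t S(1) S'(1)] S2(3)[OF t S(1) S'(3)] by simp
        fix i assume "i \<in> S"
        then have i: "i \<in> \<Phi>" using S'(1) by blast
        show "continuous_on {0..T} (\<lambda>t. cn \<epsilon> t i)" "continuous_on {0..T} (\<lambda>t. fn \<epsilon> t i)"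
          by (rule cnc[OF \<epsilon> i]) (rule fnc[OF \<epsilon> i])
        show "\<kappa> \<le> an \<epsilon> t * lam i" if "t \<in> {0..T}" for t by (rule low[OF i that])
        show "(LINT s:{0<..T}|lborel. k s *\<^sub>R (cn \<epsilon> (max 0 (t - s)) i - cn \<epsilon> 0 i)) =
            integral {0..t} (\<lambda>\<tau>. fn \<epsilon> \<tau> i - of_real (an \<epsilon> \<tau> * lam i) * cn \<epsilon> \<tau> i)" if "t \<in> {0..T}" for t
          by (rule eqn[OF \<epsilon> i that])
      qed (use S(1) T \<kappa> t anc[OF \<epsilon>] in auto)
      then show ?thesis
        using le2[where x = "\<lambda>i. cn \<epsilon> t i" and y = "\<lambda>i. - c t i" and S = S] S1(3)[OF t S(1) S'(2)]
        by simp
    qed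
    \<comment> \<open>With coefficient \<open>an\<close> on the left, the difference has zero
      initial value and acquires the source (a - an) lam c. On the finite set \<open>S0\<close> the
      eigenvalues are bounded, so this source is small in the target norm.\<close>
    have main: "(\<Sum>i\<in>S0. (cmod (cn \<epsilon> t i - c t i))\<^sup>2) \<le> \<eta> / 2" if t: "t \<in> {0..T}" for t
    proof (rule complex_maximum_principle[where T = T and v = "\<lambda>i t. cn \<epsilon> t i - c t i"
          and F = "\<lambda>i t. (fn \<epsilon> t i - f t i) + of_real ((a t - an \<epsilon> t) * lam i) * c t i"
          and b = "an \<epsilon>" and l = lam and \<kappa> = \<kappa>])
      fix i t assume i: "i \<in> S0" and t: "t \<in> {0..T}"
      have i': "i \<in> \<Phi>" using i S0 by blast
      have cont: "continuous_on {0..t} (\<lambda>\<tau>. fn \<epsilon> \<tau> i - of_real (an \<epsilon> \<tau> * lam i) * cn \<epsilon> \<tau> i)"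
        "continuous_on {0..t} (\<lambda>\<tau>. f \<tau> i - of_real (a \<tau> * lam i) * c \<tau> i)"
        using t by (intro continuous_intros continuous_on_subset[OF fnc[OF \<epsilon> i']] continuous_on_subset[OF anc[OF \<epsilon>]]
            continuous_on_subset[OF cnc[OF \<epsilon> i']] continuous_on_subset[OF ac] continuous_on_subset[OF cc(1)[OF i']]
            continuous_on_subset[OF cc(2)[OF i']]; simp)+
      have "(LINT s:{0<..T}|lborel. k s *\<^sub>R (cn \<epsilon> (max 0 (t - s)) i - c (max 0 (t - s)) i - (cn \<epsilon> 0 i - c 0 i)))
        = (LINT s:{0<..T}|lborel. k s *\<^sub>R (cn \<epsilon> (max 0 (t - s)) i - cn \<epsilon> 0 i) - k s *\<^sub>R (c (max 0 (t - s)) i - c 0 i))"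
        by (intro arg_cong[where f = "set_lebesgue_integral lborel {0<..T}"] ext) (simp add: algebra_simps)
      also have "\<dots> = integral {0..t} (\<lambda>\<tau>. fn \<epsilon> \<tau> i - of_real (an \<epsilon> \<tau> * lam i) * cn \<epsilon> \<tau> i)
          - integral {0..t} (\<lambda>\<tau>. f \<tau> i - of_real (a \<tau> * lam i) * c \<tau> i)"
        unfolding eq[OF i' t, symmetric] eqn[OF \<epsilon> i' t, symmetric]
        by (rule set_integral_diff(2)[OF kernel_scaleR_integrable[OF T cnc[OF \<epsilon> i'] t] kernel_scaleR_integrable[OF T cc(1)[OF i'] t]])
      also have "\<dots> = integral {0..t} (\<lambda>\<tau>. (fn \<epsilon> \<tau> i - of_real (an \<epsilon> \<tau> * lam i) * cn \<epsilon> \<tau> i)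
          - (f \<tau> i - of_real (a \<tau> * lam i) * c \<tau> i))"
        by (rule Henstock_Kurzweil_Integration.integral_diff[symmetric]; rule integrable_continuous_interval; rule cont)
      also have "(\<lambda>\<tau>. (fn \<epsilon> \<tau> i - of_real (an \<epsilon> \<tau> * lam i) * cn \<epsilon> \<tau> i) - (f \<tau> i - of_real (a \<tau> * lam i) * c \<tau> i)) =
          (\<lambda>\<tau>. fn \<epsilon> \<tau> i - f \<tau> i + of_real ((a \<tau> - an \<epsilon> \<tau>) * lam i) * c \<tau> i - of_real (an \<epsilon> \<tau> * lam i) * (cn \<epsilon> \<tau> i - c \<tau> i))"
        by (simp add: fun_eq_iff algebra_simps)
      finally show "(LINT s:{0<..T}|lborel. k s *\<^sub>R (cn \<epsilon> (max 0 (t - s)) i - c (max 0 (t - s)) i - (cn \<epsilon> 0 i - c 0 i))) =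
        integral {0..t} (\<lambda>\<tau>. fn \<epsilon> \<tau> i - f \<tau> i + of_real ((a \<tau> - an \<epsilon> \<tau>) * lam i) * c \<tau> i
          - of_real (an \<epsilon> \<tau> * lam i) * (cn \<epsilon> \<tau> i - c \<tau> i))" .
    next
      show "(\<Sum>i\<in>S0. (cmod (cn \<epsilon> 0 i - c 0 i))\<^sup>2) \<le> \<eta> / 2"
      proof -
        have "(\<Sum>i\<in>S0. (cmod (cn \<epsilon> 0 i - c 0 i))\<^sup>2) = (\<Sum>i\<in>S0. 0)"
          by (rule sum.cong) (use init[OF \<epsilon>] S0 in auto)
        then show ?thesis using \<eta> by simp
      qed
    next
      fix t assume t: "t \<in> {0..T}"
      have "(\<Sum>i\<in>S0. (cmod (of_real ((a t - an \<epsilon> t) * lam i) * c t i))\<^sup>2) = (a t - an \<epsilon> t)\<^sup>2 * (\<Sum>i\<in>S0. (lam i * cmod (c t i))\<^sup>2)"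
        unfolding sum_distrib_left
        by (intro sum.cong refl) (simp only: norm_mult norm_of_real power_mult_distrib power2_abs abs_mult mult.assoc)
      also have "\<dots> \<le> \<eta>a\<^sup>2 * C"
      proof (rule mult_mono[OF _ C[OF t]])
        have "\<bar>a t - an \<epsilon> t\<bar> \<le> \<bar>\<eta>a\<bar>" using ae[OF t] \<eta>a by auto
        then show "(a t - an \<epsilon> t)\<^sup>2 \<le> \<eta>a\<^sup>2" by (simp only: abs_le_square_iff)
      qed (auto intro: sum_nonneg)
      finally have "(\<Sum>i\<in>S0. (cmod (fn \<epsilon> t i - f t i + of_real ((a t - an \<epsilon> t) * lam i) * c t i))\<^sup>2)
          \<le> 2 * (\<kappa>\<^sup>2 * B / 4) + 2 * (\<eta>a\<^sup>2 * C)"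
        using le2[where x = "\<lambda>i. fn \<epsilon> t i - f t i" and y = "\<lambda>i. of_real ((a t - an \<epsilon> t) * lam i) * c t i" and S = S0]
          fe[OF t S0] by linarith
      also have "\<dots> \<le> \<kappa>\<^sup>2 * \<eta> / 4 + \<kappa>\<^sup>2 * \<eta> / 4"
        using \<eta>aC \<eta> \<kappa> by (intro add_mono) (auto simp: B_def)
      finally show "(\<Sum>i\<in>S0. (cmod (fn \<epsilon> t i - f t i + of_real ((a t - an \<epsilon> t) * lam i) * c t i))\<^sup>2) \<le> \<kappa>\<^sup>2 * (\<eta> / 2)"
        by (simp add: mult.commute)
    next
      fix i assume "i \<in> S0"
      then have i: "i \<in> \<Phi>" using S0 by blast
      show "continuous_on {0..T} (\<lambda>t. cn \<epsilon> t i - c t i)"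
        by (intro continuous_intros cnc[OF \<epsilon> i] cc[OF i])
      show "continuous_on {0..T} (\<lambda>t. fn \<epsilon> t i - f t i + of_real ((a t - an \<epsilon> t) * lam i) * c t i)"
        by (intro continuous_intros fnc[OF \<epsilon> i] cc[OF i] anc[OF \<epsilon>] ac)
      show "\<kappa> \<le> an \<epsilon> t * lam i" if "t \<in> {0..T}" for t by (rule low[OF i that])
    qed (use S0 T \<kappa> t anc[OF \<epsilon>] in auto)
    show ?case
    proof (intro ballI allI impI)
      fix t S assume t: "t \<in> {0..T}" and S: "finite S" "S \<subseteq> \<Phi>"
      let ?d = "\<lambda>i. (cmod (cn \<epsilon> t i - c t i))\<^sup>2"
      have "sum ?d S = sum ?d (S \<inter> S0) + sum ?d (S - S0)"
        using S(1) by (rule sum.Int_Diff)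
      also have "sum ?d (S \<inter> S0) \<le> sum ?d S0" using S0(1) by (intro sum_mono2) auto
      also have "\<dots> \<le> \<eta> / 2" by (rule main[OF t])
      also have "sum ?d (S - S0) \<le> 4 * B" using S by (intro tail[OF t]) auto
      finally show "sum ?d S \<le> \<eta>" using \<eta> by (simp add: B_def)
    qed
  qed
qed

end

section \<open>Mollification\<close>

lemma friedrichs_mollifier_scaled:
  assumes \<psi>: "friedrichs_mollifier T \<psi>" and w: "0 < w"
  shows "integrable lborel (scaled_mollifier \<psi> w)" "(LINT x|lborel. scaled_mollifier \<psi> w x) = 1"
    "0 \<le> scaled_mollifier \<psi> w x" "x \<notin> {0..w * T} \<Longrightarrow> scaled_mollifier \<psi> w x = 0"
proof -
  have one: "(LINT x|lborel. \<psi> x) = 1" and nn: "\<And>x. 0 \<le> \<psi> x"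
    and supp: "closure {x. \<psi> x \<noteq> 0} \<subseteq> {0..T}"
    using \<psi> unfolding friedrichs_mollifier_def by auto
  \<comment> \<open>The Bochner integral of a function that is not integrable is 0 by convention, so
    total mass 1 already implies integrability.\<close>
  have "integrable lborel \<psi>"
    using one by (metis not_integrable_integral_eq zero_neq_one)
  then have "integrable lborel (\<lambda>x. \<psi> (0 + (1 / w) * x))"
    by (rule lborel_integrable_real_affine) (use w in simp)
  then show "integrable lborel (scaled_mollifier \<psi> w)"
    unfolding scaled_mollifier_def by (intro integrable_divide) simp
  have "(LINT x|lborel. \<psi> x) = \<bar>1 / w\<bar> *\<^sub>R (LINT x|lborel. \<psi> (0 + (1 / w) * x))"
    by (rule lborel_integral_real_affine) (use w in simp)
  then show "(LINT x|lborel. scaled_mollifier \<psi> w x) = 1"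
    using w one by (simp add: scaled_mollifier_def)
  show "0 \<le> scaled_mollifier \<psi> w x" using nn w by (simp add: scaled_mollifier_def)
  assume x: "x \<notin> {0..w * T}"
  have "x / w \<notin> {0..T}"
    using x w by (auto simp: field_simps zero_le_divide_iff)
  then have "\<psi> (x / w) = 0" using supp closure_subset[of "{x. \<psi> x \<noteq> 0}"] by blast
  then show "scaled_mollifier \<psi> w x = 0" by (simp add: scaled_mollifier_def)
qed

text \<open>Jensen's inequality for the squared norm. Pairing the mean J with itself under the
  integral gives |J|^2 \<le> (|J|^2 + B) / 2, hence |J|^2 \<le> B.\<close>

lemma weighted_mean_power2_le:
  fixes q :: "'i \<Rightarrow> real \<Rightarrow> complex"
  assumes S: "finite S"
    and \<rho>: "integrable lborel \<rho>" "(LINT x|lborel. \<rho> x) = 1" "\<And>x. 0 \<le> \<rho> x"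
    and int: "\<And>i. i \<in> S \<Longrightarrow> integrable lborel (\<lambda>x. \<rho> x *\<^sub>R q i x)"
    and B: "\<And>x. \<rho> x \<noteq> 0 \<Longrightarrow> (\<Sum>i\<in>S. (cmod (q i x))\<^sup>2) \<le> B"
  shows "(\<Sum>i\<in>S. (cmod (LINT x|lborel. \<rho> x *\<^sub>R q i x))\<^sup>2) \<le> B"
proof -
  define J where "J i = (LINT x|lborel. \<rho> x *\<^sub>R q i x)" for i
  define X where "X = (\<Sum>i\<in>S. (cmod (J i))\<^sup>2)"
  have int': "integrable lborel (\<lambda>x. \<Sum>i\<in>S. J i \<bullet> (\<rho> x *\<^sub>R q i x))"
    using int by (intro Bochner_Integration.integrable_sum integrable_inner_right)
  have "X = (\<Sum>i\<in>S. J i \<bullet> J i)" by (simp add: X_def dot_square_norm)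
  also have "\<dots> = (\<Sum>i\<in>S. (LINT x|lborel. J i \<bullet> (\<rho> x *\<^sub>R q i x)))"
  proof (rule sum.cong[OF refl])
    fix i assume i: "i \<in> S"
    have "(LINT x|lborel. J i \<bullet> (\<rho> x *\<^sub>R q i x)) = J i \<bullet> (LINT x|lborel. \<rho> x *\<^sub>R q i x)"
      by (rule integral_inner_right) (rule int[OF i])
    then show "J i \<bullet> J i = (LINT x|lborel. J i \<bullet> (\<rho> x *\<^sub>R q i x))"
      by (simp only: J_def[of i, symmetric])
  qed
  also have "\<dots> = (LINT x|lborel. (\<Sum>i\<in>S. J i \<bullet> (\<rho> x *\<^sub>R q i x)))"
    using int by (intro Bochner_Integration.integral_sum[symmetric] integrable_inner_right)
  also have "\<dots> \<le> (LINT x|lborel. \<rho> x * ((X + B) / 2))"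
  proof (rule integral_mono[OF int'])
    fix x
    have "J i \<bullet> (\<rho> x *\<^sub>R q i x) \<le> \<rho> x * (((cmod (J i))\<^sup>2 + (cmod (q i x))\<^sup>2) / 2)" for i
    proof -
      have "J i \<bullet> q i x \<le> cmod (J i) * cmod (q i x)" by (rule norm_cauchy_schwarz)
      also have "\<dots> \<le> ((cmod (J i))\<^sup>2 + (cmod (q i x))\<^sup>2) / 2"
        using sum_squares_bound[of "cmod (J i)" "cmod (q i x)"] by simp
      finally show ?thesis using \<rho>(3)[of x] by (simp only: inner_scaleR_right mult_left_mono)
    qed
    then have "(\<Sum>i\<in>S. J i \<bullet> (\<rho> x *\<^sub>R q i x)) \<le> (\<Sum>i\<in>S. \<rho> x * (((cmod (J i))\<^sup>2 + (cmod (q i x))\<^sup>2) / 2))"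
      by (rule sum_mono)
    also have "\<dots> = \<rho> x * ((X + (\<Sum>i\<in>S. (cmod (q i x))\<^sup>2)) / 2)"
      unfolding X_def sum.distrib[symmetric] sum_divide_distrib sum_distrib_left ..
    also have "\<dots> \<le> \<rho> x * ((X + B) / 2)"
      using B[of x] \<rho>(3)[of x] by (cases "\<rho> x = 0") (auto intro!: mult_left_mono)
    finally show "(\<Sum>i\<in>S. J i \<bullet> (\<rho> x *\<^sub>R q i x)) \<le> \<rho> x * ((X + B) / 2)" .
  qed (use \<rho>(1) in simp)
  also have "\<dots> = (X + B) / 2" using \<rho>(2) by simp
  finally show ?thesis by (simp add: X_def J_def)
qed

lemma l2_continuous_on_subset:
  assumes "l2_continuous_on \<Phi> I c" "J \<subseteq> I"
  shows "l2_continuous_on \<Phi> J c"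
  using assms unfolding l2_continuous_on_def by (blast intro: tendsto_within_subset)

text \<open>The mollified value is a weighted mean of values at times within T times the scale
  \<open>\<omega> \<epsilon>\<close> of t, and the curve is uniformly continuous there. Jensen's
  inequality gives a bound independent of the finite set of modes.\<close>

lemma mollified_modes_converge:
  fixes c :: "real \<Rightarrow> 'i \<Rightarrow> complex"
  assumes T: "0 < T" and \<psi>: "friedrichs_mollifier T \<psi>" and \<omega>: "regularizing_scale \<omega>"
    and c: "l2_continuous_on \<Phi> UNIV c" and \<eta>: "0 < \<eta>"
  shows "\<forall>\<^sub>F \<epsilon> in at_right 0. \<forall>t\<in>{0..T}. \<forall>S. finite S \<longrightarrow> S \<subseteq> \<Phi> \<longrightarrow>
    (\<Sum>i\<in>S. (cmod ((LINT \<tau>|lborel. scaled_mollifier \<psi> (\<omega> \<epsilon>) \<tau> *\<^sub>R c (t - \<tau>) i) - c t i))\<^sup>2) \<le> \<eta>"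
proof -
  \<comment> \<open>The mollifier is supported on nonnegative times, so the mean looks only into the
    past; once the scale times T is below 1, all times involved lie in this compact
    interval.\<close>
  have cI: "l2_continuous_on \<Phi> {-1..T} c" by (rule l2_continuous_on_subset[OF c]) simp
  obtain d where d: "d > 0" "\<And>r t. r \<in> {-1..T} \<Longrightarrow> t \<in> {-1..T} \<Longrightarrow> \<bar>r - t\<bar> < d \<Longrightarrow>
      (\<Sum>\<^sub>\<infinity>i\<in>\<Phi>. (cmod (c r i - c t i))\<^sup>2) \<le> \<eta>"
    using l2_uniformly_continuous[OF cI compact_Icc \<eta>] by metis
  have "(\<omega> \<longlongrightarrow> 0) (at_right 0)" using \<omega> by (simp add: regularizing_scale_def)
  moreover have "0 < min d 1 / T" using d(1) T by simp
  ultimately have "\<forall>\<^sub>F \<epsilon> in at_right 0. \<omega> \<epsilon> < min d 1 / T" by (rule order_tendstoD(2))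
  moreover have "\<forall>\<^sub>F \<epsilon> in at_right 0. \<epsilon> \<in> {0<..<1::real}"
    by (rule eventually_at_right_real) simp
  ultimately show ?thesis
  proof eventually_elim
    case (elim \<epsilon>)
    then have w: "0 < \<omega> \<epsilon>" using \<omega> by (simp add: regularizing_scale_def)
    have wT: "\<omega> \<epsilon> * T < d" "\<omega> \<epsilon> * T < 1"
      using elim(1) T by (simp_all add: pos_less_divide_eq)
    let ?\<rho> = "scaled_mollifier \<psi> (\<omega> \<epsilon>)"
    note \<rho> = friedrichs_mollifier_scaled[OF \<psi> w]
    show ?case
    proof (intro ballI allI impI)
      fix t S assume t: "t \<in> {0..T}" and S: "finite S" "S \<subseteq> \<Phi>"
      have int: "integrable lborel (\<lambda>\<tau>. ?\<rho> \<tau> *\<^sub>R c (t - \<tau>) i)" if i: "i \<in> S" for i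
      proof -
        have cont: "continuous_on UNIV (\<lambda>t. c t i)"
          using l2_coordinate_continuous[OF c] S(2) i by blast
        then have cont': "continuous_on UNIV (\<lambda>\<tau>. c (t - \<tau>) i)"
          by (rule continuous_on_compose2) (auto intro!: continuous_intros)
        then have m[measurable]: "(\<lambda>\<tau>. c (t - \<tau>) i) \<in> borel_measurable borel"
          by (rule borel_measurable_continuous_onI)
        have [measurable]: "?\<rho> \<in> borel_measurable borel"
          using \<rho>(1) by (simp add: borel_measurable_integrable)
        have "bounded ((\<lambda>\<tau>. c (t - \<tau>) i) ` {0..\<omega> \<epsilon> * T})"
          by (rule compact_imp_bounded[OF compact_continuous_image[OF continuous_on_subset[OF cont'] compact_Icc]]) simp
        then obtain C where "\<forall>z\<in>(\<lambda>\<tau>. c (t - \<tau>) i) ` {0..\<omega> \<epsilon> * T}. norm z \<le> C"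
          unfolding bounded_iff by (rule exE)
        then have C: "norm (c (t - \<tau>) i) \<le> C" if "\<tau> \<in> {0..\<omega> \<epsilon> * T}" for \<tau>
          using that by blast
        show ?thesis
        proof (rule Bochner_Integration.integrable_bound[where f = "\<lambda>\<tau>. C * ?\<rho> \<tau>"])
          show "AE \<tau> in lborel. norm (?\<rho> \<tau> *\<^sub>R c (t - \<tau>) i) \<le> norm (C * ?\<rho> \<tau>)"
          proof (rule AE_I2)
            fix \<tau>
            show "norm (?\<rho> \<tau> *\<^sub>R c (t - \<tau>) i) \<le> norm (C * ?\<rho> \<tau>)"
            proof (cases "\<tau> \<in> {0..\<omega> \<epsilon> * T}")
              case True
              have "norm (c (t - \<tau>) i) \<le> \<bar>C\<bar>" using C[OF True] by simp
              from mult_left_mono[OF this \<rho>(3)[of \<tau>]] show ?thesis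
                using \<rho>(3)[of \<tau>] by (simp add: abs_mult mult.commute)
            qed (simp add: \<rho>(4))
          qed
        qed (use \<rho>(1) in simp_all)
      qed
      have diff: "(LINT \<tau>|lborel. ?\<rho> \<tau> *\<^sub>R c (t - \<tau>) i) - c t i = (LINT \<tau>|lborel. ?\<rho> \<tau> *\<^sub>R (c (t - \<tau>) i - c t i))"
        and int': "integrable lborel (\<lambda>\<tau>. ?\<rho> \<tau> *\<^sub>R (c (t - \<tau>) i - c t i))" if i: "i \<in> S" for i
      proof -
        have ic: "integrable lborel (\<lambda>\<tau>. ?\<rho> \<tau> *\<^sub>R c t i)" using \<rho>(1) by (rule integrable_scaleR_left)
        show "integrable lborel (\<lambda>\<tau>. ?\<rho> \<tau> *\<^sub>R (c (t - \<tau>) i - c t i))"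
          unfolding scaleR_diff_right by (rule Bochner_Integration.integrable_diff[OF int[OF i] ic])
        have "(LINT \<tau>|lborel. ?\<rho> \<tau> *\<^sub>R c t i) = c t i" using \<rho>(2) \<rho>(1) by simp
        then show "(LINT \<tau>|lborel. ?\<rho> \<tau> *\<^sub>R c (t - \<tau>) i) - c t i = (LINT \<tau>|lborel. ?\<rho> \<tau> *\<^sub>R (c (t - \<tau>) i - c t i))"
          unfolding scaleR_diff_right Bochner_Integration.integral_diff[OF int[OF i] ic] by simp
      qed
      have "(\<Sum>i\<in>S. (cmod (LINT \<tau>|lborel. ?\<rho> \<tau> *\<^sub>R (c (t - \<tau>) i - c t i)))\<^sup>2) \<le> \<eta>"
      proof (rule weighted_mean_power2_le[OF S(1) \<rho>(1,2) \<rho>(3) int'])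
        fix \<tau> assume "?\<rho> \<tau> \<noteq> 0"
        then have \<tau>: "\<tau> \<in> {0..\<omega> \<epsilon> * T}" using \<rho>(4) by blast
        have ts: "t - \<tau> \<in> {-1..T}" "t \<in> {-1..T}" "\<bar>t - \<tau> - t\<bar> < d"
          using \<tau> t wT by auto
        have "(\<Sum>i\<in>S. (cmod (c (t - \<tau>) i - c t i))\<^sup>2) \<le> (\<Sum>\<^sub>\<infinity>i\<in>\<Phi>. (cmod (c (t - \<tau>) i - c t i))\<^sup>2)"
          by (rule finite_sum_le_infsum[OF l2_diff_summable[OF c] S]) auto
        also have "\<dots> \<le> \<eta>" by (rule d(2)[OF ts])
        finally show "(\<Sum>i\<in>S. (cmod (c (t - \<tau>) i - c t i))\<^sup>2) \<le> \<eta>" .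
      qed
      then show "(\<Sum>i\<in>S. (cmod ((LINT \<tau>|lborel. ?\<rho> \<tau> *\<^sub>R c (t - \<tau>) i) - c t i))\<^sup>2) \<le> \<eta>"
        by (simp add: diff)
    qed
  qed
qed

text \<open>The scalar case is obtained from the mode version with the single index () and the
  coefficient viewed as complex-valued. Squaring \<eta> matches the squared norms used
  there.\<close>

lemma coeff_regularization_converges:
  assumes T: "0 < T" and reg: "coeff_regularization T a an" and \<eta>: "0 < \<eta>"
  shows "\<forall>\<^sub>F \<epsilon> in at_right 0. \<forall>t\<in>{0..T}. \<bar>an \<epsilon> t - a t\<bar> \<le> \<eta>"
proof -
  obtain \<psi> \<omega> b where \<psi>: "friedrichs_mollifier T \<psi>" and \<omega>: "regularizing_scale \<omega>"
    and b: "continuous_on UNIV b" "\<forall>t\<in>{0..T}. b t = a t"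
    and an: "\<forall>\<epsilon>\<in>{0<..1}. \<forall>t. an \<epsilon> t = (LINT \<tau>|lborel. b (t - \<tau>) * scaled_mollifier \<psi> (\<omega> \<epsilon>) \<tau>)"
    using reg unfolding coeff_regularization_def by (elim exE conjE)
  have "l2_continuous_on {()} UNIV (\<lambda>t i. complex_of_real (b t))"
  proof -
    have "((\<lambda>r. (cmod (complex_of_real (b r) - complex_of_real (b t)))\<^sup>2) \<longlongrightarrow> 0) (at t)" for t
    proof -
      have "(b \<longlongrightarrow> b t) (at t)" using b(1) by (simp add: continuous_on_def)
      then have "((\<lambda>r. (cmod (complex_of_real (b r) - complex_of_real (b t)))\<^sup>2) \<longlongrightarrow>
          (cmod (complex_of_real (b t) - complex_of_real (b t)))\<^sup>2) (at t)"
        by (intro tendsto_intros)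
      then show ?thesis by simp
    qed
    then show ?thesis by (simp add: l2_continuous_on_def)
  qed
  note conv = mollified_modes_converge[OF T \<psi> \<omega> this zero_less_power[OF \<eta>, of 2]]
  have "\<forall>\<^sub>F \<epsilon> in at_right 0. \<epsilon> \<in> {0<..<1::real}"
    by (rule eventually_at_right_real) simp
  with conv show ?thesis
  proof eventually_elim
    case (elim \<epsilon>)
    have \<epsilon>: "\<epsilon> \<in> {0<..1}" using elim(2) by simp
    show ?case
    proof
      fix t assume t: "t \<in> {0..T}"
      have "an \<epsilon> t = (LINT \<tau>|lborel. scaled_mollifier \<psi> (\<omega> \<epsilon>) \<tau> * b (t - \<tau>))"
        unfolding bspec[OF an \<epsilon>, THEN spec, of t]
        by (rule Bochner_Integration.integral_cong[OF refl]) (rule mult.commute)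
      then have "(LINT \<tau>|lborel. scaled_mollifier \<psi> (\<omega> \<epsilon>) \<tau> *\<^sub>R complex_of_real (b (t - \<tau>))) = complex_of_real (an \<epsilon> t)"
        unfolding scaleR_conv_of_real of_real_mult[symmetric] by (simp only: integral_complex_of_real)
      moreover
      have single: "(\<Sum>i\<in>{()}. q i) = q ()" for q :: "unit \<Rightarrow> real" by simp
      have "(cmod ((LINT \<tau>|lborel. scaled_mollifier \<psi> (\<omega> \<epsilon>) \<tau> *\<^sub>R complex_of_real (b (t - \<tau>)))
          - complex_of_real (b t)))\<^sup>2 \<le> \<eta>\<^sup>2"
        by (rule bspec[OF elim(1) t, THEN spec, of "{()}", THEN mp, THEN mp, unfolded single]) simp_all
      moreover have "b t = a t" using b(2) t by (rule bspec)
      ultimately have "(cmod (complex_of_real (an \<epsilon> t - a t)))\<^sup>2 \<le> \<eta>\<^sup>2"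
        by (simp only: of_real_diff)
      then show "\<bar>an \<epsilon> t - a t\<bar> \<le> \<eta>"
        unfolding norm_of_real using \<eta> by (simp add: abs_le_square_iff[symmetric])
    qed
  qed
qed

section \<open>Convergence of the very weak solution\<close>

locale spectral_basis =
  fixes h V0 :: real and V :: "real ^ 'n::finite \<Rightarrow> real" and \<Phi> :: "'n lfun set" and lam :: "'n lfun \<Rightarrow> real"
  assumes basis_H_inf: "\<phi> \<in> \<Phi> \<Longrightarrow> \<phi> \<in> H_inf h V"
    and V0: "0 < V0" and lam_ge: "\<phi> \<in> \<Phi> \<Longrightarrow> V0 \<le> lam \<phi>"
    and basis_eigen: "\<phi> \<in> \<Phi> \<Longrightarrow> schroedinger h V \<phi> = (\<lambda>x. complex_of_real (lam \<phi>) * \<phi> x)"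
    and parseval: "U \<in> Sobolev h V s \<Longrightarrow>
      ((\<lambda>\<phi>. (cmod (complex_of_real ((1 + lam \<phi>) powr (s / 2)) * U \<phi>))\<^sup>2) has_sum (Sobolev_norm h V s U)\<^sup>2) \<Phi>"
begin

text \<open>The coefficient of (I + H)^(s/2) U, so that the Sobolev norm of order s is the plain l2
  norm of the family.\<close>

definition coef :: "real \<Rightarrow> 'n functional \<Rightarrow> 'n lfun \<Rightarrow> complex" where
  "coef s U \<phi> = complex_of_real ((1 + lam \<phi>) powr (s / 2)) * U \<phi>"

lemma coef_l2_continuous:
  assumes u: "u \<in> C_Sobolev h V s I"
  shows "l2_continuous_on \<Phi> I (\<lambda>t. coef s (u t))"
  unfolding l2_continuous_on_def
proof
  fix t assume t: "t \<in> I"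
  have S: "u r \<in> Sobolev h V s" if "r \<in> I" for r
    using u that by (simp add: C_Sobolev_def)
  have sq: "(Sobolev_norm h V s (\<lambda>\<phi>. u r \<phi> - u t \<phi>))\<^sup>2 = (\<Sum>\<^sub>\<infinity>i\<in>\<Phi>. (cmod (coef s (u r) i - coef s (u t) i))\<^sup>2)"
    if r: "r \<in> I" for r
    using infsumI[OF parseval[OF Sobolev_diff[OF S[OF r] S[OF t]]]] by (simp add: coef_def right_diff_distrib)
  have "((\<lambda>r. Sobolev_norm h V s (\<lambda>\<phi>. u r \<phi> - u t \<phi>)) \<longlongrightarrow> 0) (at t within I)"
    using u t by (simp add: C_Sobolev_def)
  then have "((\<lambda>r. (Sobolev_norm h V s (\<lambda>\<phi>. u r \<phi> - u t \<phi>))\<^sup>2) \<longlongrightarrow> 0\<^sup>2) (at t within I)"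
    by (rule tendsto_power)
  moreover have "\<forall>\<^sub>F r in at t within I. (Sobolev_norm h V s (\<lambda>\<phi>. u r \<phi> - u t \<phi>))\<^sup>2 =
      (\<Sum>\<^sub>\<infinity>i\<in>\<Phi>. (cmod (coef s (u r) i - coef s (u t) i))\<^sup>2)"
    unfolding eventually_at_filter by (rule always_eventually) (simp add: sq)
  ultimately have "((\<lambda>r. \<Sum>\<^sub>\<infinity>i\<in>\<Phi>. (cmod (coef s (u r) i - coef s (u t) i))\<^sup>2) \<longlongrightarrow> 0) (at t within I)"
    unfolding zero_power2 by (rule Lim_transform_eventually)
  moreover have "(\<lambda>i. (cmod (coef s (u t) i))\<^sup>2) summable_on \<Phi>"
    using parseval[OF S[OF t]] unfolding coef_def by (rule has_sum_imp_summable)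
  ultimately show "(\<lambda>i. (cmod (coef s (u t) i))\<^sup>2) summable_on \<Phi> \<and>
      ((\<lambda>r. \<Sum>\<^sub>\<infinity>i\<in>\<Phi>. (cmod (coef s (u r) i - coef s (u t) i))\<^sup>2) \<longlongrightarrow> 0) (at t within I)" by blast
qed

lemma coef_continuous:
  assumes "u \<in> C_Sobolev h V s I" "\<phi> \<in> \<Phi>"
  shows "continuous_on I (\<lambda>t. coef s (u t) \<phi>)"
  by (rule l2_coordinate_continuous[OF coef_l2_continuous[OF assms(1)] assms(2)])

text \<open>Pairing with an eigenfunction turns H into multiplication by its eigenvalue and the
  problem into a scalar Caputo equation, which is then integrated. The weight of order s is
  independent of time and factors out of both sides.\<close>

lemma coef_integral_equation:
  assumes T: "0 < T" and g: "admissible_kernel g"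
    and k: "decreasing_kernel k" and ae: "AE t in lborel. 0 < t \<longrightarrow> g t = k t"
    and u: "u \<in> C_Sobolev h V s {0..T}" and sol: "solves_problem h V T g a f u0 u"
    and \<phi>: "\<phi> \<in> \<Phi>" and t: "t \<in> {0..T}"
  shows "(LINT x:{0<..T}|lborel. k x *\<^sub>R (coef s (u (max 0 (t - x))) \<phi> - coef s (u 0) \<phi>)) =
    integral {0..t} (\<lambda>\<tau>. coef s (f \<tau>) \<phi> - of_real (a \<tau> * lam \<phi>) * coef s (u \<tau>) \<phi>)"
proof -
  define w where "w = complex_of_real ((1 + lam \<phi>) powr (s / 2))"
  have "0 < 1 + lam \<phi>" using lam_ge[OF \<phi>] V0 by linarith
  then have w: "w \<noteq> 0" by (simp add: w_def)
  have cw: "coef s U \<phi> = w * U \<phi>" for U by (simp add: coef_def w_def)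
  \<comment> \<open>Continuity is known for the weighted coefficient; the weight is nonzero because
    the eigenvalue is positive, so it can be divided out.\<close>
  have "continuous_on {0..T} (\<lambda>t. inverse w * coef s (u t) \<phi>)"
    by (intro continuous_intros coef_continuous[OF u \<phi>])
  then have yc: "continuous_on {0..T} (\<lambda>t. u t \<phi>)" using w by (simp add: cw mult.assoc[symmetric])
  have caputo: "has_caputo T g (\<lambda>\<tau>. u \<tau> \<phi>) (f t \<phi> - of_real (a t * lam \<phi>) * u t \<phi>) t" if t: "t \<in> {0<..T}" for t
  proof -
    obtain d where d: "has_caputo_functional h V T g u d t"
      and eq: "(\<lambda>\<phi>. d \<phi> + complex_of_real (a t) * schroedinger_dual h V (u t) \<phi>) = f t"
      using sol t unfolding solves_problem_def by blast
    have "u t \<in> H_minf h V" using u t by (simp add: C_Sobolev_def Sobolev_def)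
    then have "\<forall>\<phi>\<in>H_inf h V. \<forall>c. u t (\<lambda>x. c * \<phi> x) = c * u t \<phi>"
      unfolding H_minf_def by blast
    then have "schroedinger_dual h V (u t) \<phi> = of_real (lam \<phi>) * u t \<phi>"
      using basis_H_inf[OF \<phi>] basis_eigen[OF \<phi>] by (simp add: schroedinger_dual_def)
    with fun_cong[OF eq, of \<phi>] have "d \<phi> = f t \<phi> - of_real (a t * lam \<phi>) * u t \<phi>"
      by (simp add: algebra_simps)
    with d show ?thesis
      using basis_H_inf[OF \<phi>] unfolding has_caputo_functional_def by metis
  qed
  have eq: "(LINT x:{0<..T}|lborel. k x *\<^sub>R (u (max 0 (t - x)) \<phi> - u 0 \<phi>)) =
      integral {0..t} (\<lambda>\<tau>. f \<tau> \<phi> - of_real (a \<tau> * lam \<phi>) * u \<tau> \<phi>)"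
    by (rule caputo_integral_equation(1)[OF T g k ae yc caputo t])
  have "(LINT x:{0<..T}|lborel. k x *\<^sub>R (coef s (u (max 0 (t - x))) \<phi> - coef s (u 0) \<phi>)) =
      w * (LINT x:{0<..T}|lborel. k x *\<^sub>R (u (max 0 (t - x)) \<phi> - u 0 \<phi>))"
    unfolding cw set_integral_mult_right[symmetric]
    by (intro arg_cong[where f = "set_lebesgue_integral lborel {0<..T}"] ext) (simp add: scaleR_conv_of_real algebra_simps)
  also have "\<dots> = integral {0..t} (\<lambda>\<tau>. w * (f \<tau> \<phi> - of_real (a \<tau> * lam \<phi>) * u \<tau> \<phi>))"
    unfolding eq by (rule Henstock_Kurzweil_Integration.integral_mult_right[symmetric])
  also have "(\<lambda>\<tau>. w * (f \<tau> \<phi> - of_real (a \<tau> * lam \<phi>) * u \<tau> \<phi>)) =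
      (\<lambda>\<tau>. coef s (f \<tau>) \<phi> - of_real (a \<tau> * lam \<phi>) * coef s (u \<tau>) \<phi>)"
    by (simp add: cw fun_eq_iff algebra_simps)
  finally show ?thesis .
qed

lemma source_regularization_converges:
  assumes T: "0 < T" and reg: "source_regularization h V s T f fn" and \<eta>: "0 < \<eta>"
  shows "\<forall>\<^sub>F \<epsilon> in at_right 0. \<forall>t\<in>{0..T}. \<forall>S. finite S \<longrightarrow> S \<subseteq> \<Phi> \<longrightarrow>
    (\<Sum>i\<in>S. (cmod (coef s (fn \<epsilon> t) i - coef s (f t) i))\<^sup>2) \<le> \<eta>"
proof -
  obtain \<psi> \<omega> F where \<psi>: "friedrichs_mollifier T \<psi>" and \<omega>: "regularizing_scale \<omega>"
    and F: "F \<in> C_Sobolev h V s UNIV" "\<forall>t\<in>{0..T}. F t = f t"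
    and fn: "\<forall>\<epsilon>\<in>{0<..1}. \<forall>t\<in>{0..T}.
      fn \<epsilon> t = (\<lambda>\<phi>. LINT \<tau>|lborel. scaled_mollifier \<psi> (\<omega> \<epsilon>) \<tau> *\<^sub>R F (t - \<tau>) \<phi>)"
    using reg unfolding source_regularization_def by (elim exE conjE)
  note conv = mollified_modes_converge[OF T \<psi> \<omega> coef_l2_continuous[OF F(1)] \<eta>]
  have "\<forall>\<^sub>F \<epsilon> in at_right 0. \<epsilon> \<in> {0<..<1::real}"
    by (rule eventually_at_right_real) simp
  with conv show ?thesis
  proof eventually_elim
    case (elim \<epsilon>)
    show ?case
    proof (intro ballI allI impI)
      fix t S assume t: "t \<in> {0..T}" and S: "finite S" "S \<subseteq> \<Phi>"
      have \<epsilon>: "\<epsilon> \<in> {0<..1}" using elim(2) by simp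
      have "coef s (fn \<epsilon> t) i = (LINT \<tau>|lborel. scaled_mollifier \<psi> (\<omega> \<epsilon>) \<tau> *\<^sub>R coef s (F (t - \<tau>)) i)" for i
      proof -
        have "coef s (fn \<epsilon> t) i = (LINT \<tau>|lborel. complex_of_real ((1 + lam i) powr (s / 2)) * (scaled_mollifier \<psi> (\<omega> \<epsilon>) \<tau> *\<^sub>R F (t - \<tau>) i))"
          unfolding coef_def bspec[OF bspec[OF fn \<epsilon>] t] by (rule integral_mult_right_zero[symmetric])
        then show ?thesis by (simp add: coef_def)
      qed
      moreover have "f t = F t" using F(2) t by simp
      ultimately show "(\<Sum>i\<in>S. (cmod (coef s (fn \<epsilon> t) i - coef s (f t) i))\<^sup>2) \<le> \<eta>"
        using bspec[OF elim(1) t, THEN spec, THEN mp, OF S(1), THEN mp, OF S(2)] by simp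
    qed
  qed
qed

text \<open>Parseval at order 2 + s makes each squared Sobolev norm the supremum of finite sums of
  squares. A bound uniform in the finite set and in t therefore passes to the norm of the
  curve.\<close>

lemma very_weak_solution_converges:
  assumes T: "0 < T" and g: "admissible_kernel g"
    and f: "f \<in> C_Sobolev h V (2 + s) {0..T}"
    and ac: "continuous_on {0..T} a" and a0: "(INF t\<in>{0..T}. a t) > 0"
    and u: "classical_solution h V T g s a f u0 u"
    and un: "very_weak_solution h V T g s a f u0 an fn un"
  shows "((\<lambda>\<epsilon>. C_Sobolev_norm h V (2 + s) T (\<lambda>t \<phi>. un \<epsilon> t \<phi> - u t \<phi>)) \<longlongrightarrow> 0) (at_right 0)"
proof -
  obtain k where k: "decreasing_kernel k" and ae: "AE t in lborel. 0 < t \<longrightarrow> g t = k t"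
    by (rule admissible_kernel_decreasing_kernel[OF g])
  interpret decreasing_kernel k by (rule k)
  let ?c = "coef (2 + s)"
  have uC: "u \<in> C_Sobolev h V (2 + s) {0..T}" and usol: "solves_problem h V T g a f u0 u"
    using u unfolding classical_solution_def by blast+
  have areg: "coeff_regularization T a an" and amod: "C_moderate an"
    and freg: "source_regularization h V (2 + s) T f fn"
    and fmod: "C_Sobolev_moderate h V (2 + s) T fn" and umod: "C_Sobolev_moderate h V (2 + s) T un"
    and nsol: "\<And>\<epsilon>. \<epsilon> \<in> {0<..1} \<Longrightarrow> solves_problem h V T g (an \<epsilon>) (fn \<epsilon>) u0 (un \<epsilon>)"
    using un unfolding very_weak_solution_def by blast+
  have fnC: "fn \<epsilon> \<in> C_Sobolev h V (2 + s) {0..T}" and unC: "un \<epsilon> \<in> C_Sobolev h V (2 + s) {0..T}"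
    if "\<epsilon> \<in> {0<..1}" for \<epsilon>
    using fmod umod that unfolding C_Sobolev_moderate_def by blast+
  have anc: "continuous_on {0..T} (an \<epsilon>)" if "\<epsilon> \<in> {0<..1}" for \<epsilon>
  proof -
    have "continuous_on UNIV (an \<epsilon>)" using amod that unfolding C_moderate_def by blast
    then show ?thesis by (rule continuous_on_subset) simp
  qed
  have "bdd_below (a ` {0..T})"
    by (rule bounded_imp_bdd_below[OF compact_imp_bounded[OF compact_continuous_image[OF ac compact_Icc]]])
  then have alow: "(INF t\<in>{0..T}. a t) \<le> a t" if "t \<in> {0..T}" for t
    using that by (rule cINF_lower)
  have main: "\<forall>\<^sub>F \<epsilon> in at_right 0. \<forall>t\<in>{0..T}. \<forall>S. finite S \<longrightarrow> S \<subseteq> \<Phi> \<longrightarrow>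
      (\<Sum>i\<in>S. (cmod (?c (un \<epsilon> t) i - ?c (u t) i))\<^sup>2) \<le> \<eta>" if \<eta>: "0 < \<eta>" for \<eta>
  proof (rule mode_convergence[where a = a and an = an and f = "\<lambda>t. ?c (f t)" and fn = "\<lambda>\<epsilon> t. ?c (fn \<epsilon> t)",
        OF T V0 lam_ge coef_l2_continuous[OF uC] coef_l2_continuous[OF f] ac a0 alow _ _ anc _ _ _ _ _ \<eta>])
    fix \<epsilon> :: real and i assume \<epsilon>: "\<epsilon> \<in> {0<..1}" and i: "i \<in> \<Phi>"
    show "continuous_on {0..T} (\<lambda>t. ?c (un \<epsilon> t) i)" by (rule coef_continuous[OF unC[OF \<epsilon>] i])
    show "continuous_on {0..T} (\<lambda>t. ?c (fn \<epsilon> t) i)" by (rule coef_continuous[OF fnC[OF \<epsilon>] i])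
    have "un \<epsilon> 0 = u 0" using usol nsol[OF \<epsilon>] by (simp add: solves_problem_def)
    then show "?c (un \<epsilon> 0) i = ?c (u 0) i" by simp
    fix t assume t: "t \<in> {0..T}"
    show "(LINT x:{0<..T}|lborel. k x *\<^sub>R (?c (un \<epsilon> (max 0 (t - x))) i - ?c (un \<epsilon> 0) i)) =
        integral {0..t} (\<lambda>\<tau>. ?c (fn \<epsilon> \<tau>) i - of_real (an \<epsilon> \<tau> * lam i) * ?c (un \<epsilon> \<tau>) i)"
      by (rule coef_integral_equation[OF T g k ae unC[OF \<epsilon>] nsol[OF \<epsilon>] i t])
  next
    fix i t assume i: "i \<in> \<Phi>" and t: "t \<in> {0..T}"
    show "(LINT x:{0<..T}|lborel. k x *\<^sub>R (?c (u (max 0 (t - x))) i - ?c (u 0) i)) =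
        integral {0..t} (\<lambda>\<tau>. ?c (f \<tau>) i - of_real (a \<tau> * lam i) * ?c (u \<tau>) i)"
      by (rule coef_integral_equation[OF T g k ae uC usol i t])
  next
    fix \<eta> :: real assume "0 < \<eta>"
    then show "\<forall>\<^sub>F \<epsilon> in at_right 0. \<forall>t\<in>{0..T}. \<bar>an \<epsilon> t - a t\<bar> \<le> \<eta>"
      by (rule coeff_regularization_converges[OF T areg])
  next
    fix \<eta> :: real assume "0 < \<eta>"
    then show "\<forall>\<^sub>F \<epsilon> in at_right 0. \<forall>t\<in>{0..T}. \<forall>S. finite S \<longrightarrow> S \<subseteq> \<Phi> \<longrightarrow>
        (\<Sum>i\<in>S. (cmod (?c (fn \<epsilon> t) i - ?c (f t) i))\<^sup>2) \<le> \<eta>"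
      by (rule source_regularization_converges[OF T freg])
  qed
  let ?N = "\<lambda>\<epsilon>. C_Sobolev_norm h V (2 + s) T (\<lambda>t \<phi>. un \<epsilon> t \<phi> - u t \<phi>)"
  show ?thesis
  proof (rule tendstoI)
    fix e :: real assume e: "0 < e"
    have "\<forall>\<^sub>F \<epsilon> in at_right 0. \<epsilon> \<in> {0<..<1::real}"
      by (rule eventually_at_right_real) simp
    \<comment> \<open>Passing to the supremum over t loses strictness; aiming at e / 2 restores
      it.\<close>
    moreover have "0 < (e / 2)\<^sup>2" using e by simp
    note main[OF this]
    ultimately show "\<forall>\<^sub>F \<epsilon> in at_right 0. dist (?N \<epsilon>) 0 < e"
    proof eventually_elim
      case (elim \<epsilon>)
      have \<epsilon>: "\<epsilon> \<in> {0<..1}" using elim(1) by simp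
      have D: "(\<lambda>\<phi>. un \<epsilon> t \<phi> - u t \<phi>) \<in> Sobolev h V (2 + s)" if "t \<in> {0..T}" for t
        using unC[OF \<epsilon>] uC that by (intro Sobolev_diff) (simp_all add: C_Sobolev_def)
      let ?n = "\<lambda>t. Sobolev_norm h V (2 + s) (\<lambda>\<phi>. un \<epsilon> t \<phi> - u t \<phi>)"
      have le: "?n t \<le> e / 2" if t: "t \<in> {0..T}" for t
      proof (rule power2_le_imp_le)
        have "((\<lambda>\<phi>. (cmod (?c (un \<epsilon> t) \<phi> - ?c (u t) \<phi>))\<^sup>2) has_sum (?n t)\<^sup>2) \<Phi>"
          using parseval[OF D[OF t]] by (simp add: coef_def right_diff_distrib)
        then show "(?n t)\<^sup>2 \<le> (e / 2)\<^sup>2"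
        proof (rule has_sum_le_finite_sums)
          fix S assume "finite S" "S \<subseteq> \<Phi>"
          then show "(\<Sum>\<phi>\<in>S. (cmod (?c (un \<epsilon> t) \<phi> - ?c (u t) \<phi>))\<^sup>2) \<le> (e / 2)\<^sup>2"
            using bspec[OF elim(2) t] by blast
        qed
      qed (use e in simp)
      have "?N \<epsilon> \<le> e / 2"
        unfolding C_Sobolev_norm_def by (rule cSUP_least) (use T le in auto)
      \<comment> \<open>A real supremum dominates its members only if they are bounded above, which
        \<open>le\<close> guarantees.\<close>
      moreover have "0 \<le> ?N \<epsilon>"
      proof -
        have "0 \<in> {0..T}" using T by simp
        have "0 \<le> ?n 0" by (rule Sobolev_norm_nonneg[OF D[OF \<open>0 \<in> {0..T}\<close>]])
        also have "\<dots> \<le> ?N \<epsilon>"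
          unfolding C_Sobolev_norm_def by (rule cSUP_upper[OF \<open>0 \<in> {0..T}\<close> bdd_aboveI2[OF le]])
        finally show ?thesis .
      qed
      ultimately show ?case using e by (simp add: dist_real_def)
    qed
  qed
qed

end

theorem theorem2p10:
  fixes h T s V0 :: real
    and V :: "real ^ 'n \<Rightarrow> real"
    and g a :: "real \<Rightarrow> real"
    and f u :: "real \<Rightarrow> 'n functional"
    and u0 :: "'n functional"
    and a_net :: "real \<Rightarrow> real \<Rightarrow> real"
    and f_net u_net :: "real \<Rightarrow> real \<Rightarrow> 'n functional"
  assumes "h > 0" and "T > 0"
    and "admissible_kernel g"
    and "V0 > 0" and "\<And>k. k \<in> lattice h \<Longrightarrow> V k \<ge> V0"
    and "filterlim (\<lambda>k. \<bar>V k\<bar>) at_top (inf at_infinity (principal (lattice h)))"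
    and "f \<in> C_Sobolev h V (2 + s) {0..T}"
    and "u0 \<in> Sobolev h V (2 + s)"
    and "continuous_on {0..T} a" and "(INF t\<in>{0..T}. a t) > 0"
    and "classical_solution h V T g s a f u0 u"
    and "very_weak_solution h V T g s a f u0 a_net f_net u_net"
  shows "((\<lambda>\<epsilon>. C_Sobolev_norm h V (2 + s) T (\<lambda>t \<phi>. u_net \<epsilon> t \<phi> - u t \<phi>)) \<longlongrightarrow> 0) (at_right 0)"
  proof -
  show ?thesis
  proof (rule Sobolev_eigenbasis[OF assms(5)])
    fix \<Phi> lam
    assume basis: "\<And>\<phi>. \<phi> \<in> \<Phi> \<Longrightarrow> \<phi> \<in> H_inf h V" "\<And>\<phi>. \<phi> \<in> \<Phi> \<Longrightarrow> V0 \<le> lam \<phi>"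
      "\<And>\<phi>. \<phi> \<in> \<Phi> \<Longrightarrow> schroedinger h V \<phi> = (\<lambda>x. complex_of_real (lam \<phi>) * \<phi> x)"
      "\<And>s U. U \<in> Sobolev h V s \<Longrightarrow>
        ((\<lambda>\<phi>. (cmod (complex_of_real ((1 + lam \<phi>) powr (s / 2)) * U \<phi>))\<^sup>2) has_sum (Sobolev_norm h V s U)\<^sup>2) \<Phi>"
    interpret spectral_basis h V0 V \<Phi> lam
      by unfold_locales (fact basis assms(4))+
    show ?thesis
      by (rule very_weak_solution_converges) (fact assms)+
  qed
qed

end
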